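(* Let $M,N$ be coprime positive integers, $\mathsf{b}=\sqrt{M/N}$, $\mathsf{s}=\sqrt{MN}$, $q_+=e^{2\pi i M/N}$, $q_-=e^{2\pi i N/M}$, and $c_{\mathsf{b}}=\frac{i}{2}(\mathsf{b}+\mathsf{b}^{-1})$. Then $$ \Phi_{\mathsf{b}}\left(\frac{z}{2\pi\mathsf{s}}-c_{\mathsf{b}}\right)= \frac{e^{\frac{i}{2\pi\mathsf{s}^2}\mathrm{Li}_2(e^{z})} \left(1-e^z\right)^{1+\frac{i z}{2\pi\mathsf{s}^2}}}{ D_N(e^{z/N};q_+)\,D_M(e^{z/M};q_-)} $$ as an identity of functions of the complex variable $z$.
   Context: Faddeev's quantum dilogarithm $\Phi_{\mathsf{b}}$, for $\mathsf{b}>0$, is the meromorphic function on $\mathbb{C}$ given for $|\mathrm{Im}\,x|<|\mathrm{Im}\,c_{\mathsf{b}}|$ by $\Phi_{\mathsf{b}}(x)=\exp\left(\int_{\mathbb{R}+i\epsilon}\frac{e^{-2ixt}}{4\sinh(t\mathsf{b})\sinh(t\mathsf{b}^{-1})}\frac{dt}{t}\right)$ with small $\epsilon>0$. The Euler dilogarithm is $\mathrm{Li}_2(y)=\sum_{n\ge1}y^n/n^2$ for $|y|<1$, analytically continued as a multivalued function on $\mathbb{C}\setminus\{0,1\}$. The cyclic dilogarithm is $D_n(x;q)=\prod_{k=1}^{n-1}(1-q^kx)^{k/n}$ (so $D_1=1$). Branches: for $\mathrm{Re}\,z<0$ the multivalued functions on the right-hand side are given by their convergent power series, i.e. $\mathrm{Li}_2(e^z)$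 by the series above, and $\log(1-e^z)$ and $\log(1-q_\pm^k y)$ (for $y=e^{z/N}$, resp. $y=e^{z/M}$) by the principal branch. For other $z$ they are obtained by simultaneous analytic continuation in $z$ along a path in $\mathbb{C}\setminus 2\pi i\mathbb{Z}$; the left-hand side is the meromorphic function $\Phi_{\mathsf{b}}$. *)

theory Defs
  imports "HOL-Complex_Analysis.Complex_Analysis"
begin

definition faddeev_c :: "real \<Rightarrow> complex" where
  "faddeev_c b = \<i> / 2 * of_real (b + inverse b)"

text \<open>The integral over the horizontal line \<open>\<real> + \<i>\<epsilon>\<close>, parametrised by \<open>t = u + \<i>\<epsilon>\<close>, \<open>u \<in> \<real>\<close>.
  For \<open>b > 0\<close>, \<open>\<bar>Im x\<bar> < \<bar>Im (faddeev_c b)\<bar>\<close> and \<open>0 < \<epsilon> < pi * min b (1/b)\<close> it converges absolutely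
  and does not depend on \<open>\<epsilon>\<close>.\<close>

definition faddeev_integral :: "real \<Rightarrow> real \<Rightarrow> complex \<Rightarrow> complex" where
  "faddeev_integral b \<epsilon> x =
     (LBINT u. let t = of_real u + \<i> * of_real \<epsilon>
               in exp (- 2 * \<i> * x * t) /
                  (4 * sinh (t * of_real b) * sinh (t * of_real (inverse b))) / t)"

text \<open>Being nicely meromorphic fixes the function at every point: it takes its limit where that
  exists and the value \<open>0\<close> at poles.\<close>

definition quantum_dilog :: "real \<Rightarrow> complex \<Rightarrow> complex" where
  "quantum_dilog b =
     (THE \<Phi>. \<Phi> nicely_meromorphic_on UNIV \<and>
             (\<forall>x. \<bar>Im x\<bar> < \<bar>Im (faddeev_c b)\<bar> \<longrightarrow>
                  (\<forall>\<^sub>F \<epsilon> in at_right 0. \<Phi> x = exp (faddeev_integral b \<epsilon> x))))"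

text \<open>The power series of the Euler dilogarithm (its sum for \<open>norm y < 1\<close>).\<close>

definition Li2 :: "complex \<Rightarrow> complex" where
  "Li2 y = (\<Sum>n. y ^ Suc n / of_nat (Suc n) ^ 2)"

text \<open>\<open>F t\<close> represents the germ at \<open>\<gamma> t\<close> of the continuation along \<open>\<gamma>\<close> of the germ of \<open>f\<close> at
  \<open>\<gamma> 0\<close>; only the behaviour of \<open>F t\<close> near \<open>\<gamma> t\<close> matters.\<close>

definition analytic_continuation_along ::
    "(real \<Rightarrow> complex) \<Rightarrow> (complex \<Rightarrow> complex) \<Rightarrow> (real \<Rightarrow> complex \<Rightarrow> complex) \<Rightarrow> bool" where
  "analytic_continuation_along \<gamma> f F \<longleftrightarrow>
     (\<forall>t\<in>{0..1}. F t analytic_on {\<gamma> t}) \<and>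
     (\<forall>t\<in>{0..1}. \<forall>\<^sub>F u in at t within {0..1}. \<forall>\<^sub>F w in nhds (\<gamma> u). F u w = F t w) \<and>
     (\<forall>\<^sub>F w in nhds (\<gamma> 0). F 0 w = f w)"

text \<open>The value at the endpoint \<open>\<gamma> 1\<close> of the analytic continuation of \<open>f\<close> along \<open>\<gamma>\<close>.\<close>

definition continued_value :: "(real \<Rightarrow> complex) \<Rightarrow> (complex \<Rightarrow> complex) \<Rightarrow> complex" where
  "continued_value \<gamma> f = (THE v. \<exists>F. analytic_continuation_along \<gamma> f F \<and> v = F 1 (\<gamma> 1))"

text \<open>The power \<open>g ^ a\<close> at the endpoint of \<open>\<gamma>\<close>, taken with the branch of \<open>log g\<close> which is principal
  near \<open>\<gamma> 0\<close> and is continued along \<open>\<gamma>\<close>; \<open>a\<close> is the value of the exponent at the endpoint.\<close>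

definition continued_power :: "(real \<Rightarrow> complex) \<Rightarrow> (complex \<Rightarrow> complex) \<Rightarrow> complex \<Rightarrow> complex" where
  "continued_power \<gamma> g a = exp (a * continued_value \<gamma> (\<lambda>z. Ln (g z)))"

text \<open>The cyclic dilogarithm \<open>D\<^sub>n(x; q)\<close> of a function \<open>x\<close> of \<open>z\<close>, with its factors continued along \<open>\<gamma>\<close>
  and evaluated at the endpoint.\<close>

definition cyclic_dilog ::
    "(real \<Rightarrow> complex) \<Rightarrow> nat \<Rightarrow> (complex \<Rightarrow> complex) \<Rightarrow> complex \<Rightarrow> complex" where
  "cyclic_dilog \<gamma> n x q =
     (\<Prod>k = 1..<n. continued_power \<gamma> (\<lambda>z. 1 - q ^ k * x z) (of_nat k / of_nat n))"

end

theory Submission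
  imports Defs
begin

text \<open>
  Write \<open>z\<close> for \<open>2\<pi>s (x + c)\<close>, where \<open>c\<close> is \<^const>\<open>faddeev_c\<close>. After the substitution \<open>t = s v / 2\<close> the
  exponent in Faddeev's formula becomes
  \<open>I(z) = \<integral> exp (-i z v / 2\<pi>) / ((exp (M v) - 1) (exp (N v) - 1)) dv / v\<close>
  over a line \<open>Im v = d\<close> with small \<open>d > 0\<close>, for \<open>0 < Im z < 2\<pi>(M + N)\<close>. Differentiation in \<open>z\<close> cancels
  the factor \<open>1 / v\<close>, and what remains is multiplied by \<open>exp z\<close> when \<open>v\<close> moves by \<open>2\<pi>i\<close>; this is where
  the rationality of \<open>b\<^sup>2 = M / N\<close> enters. Comparing the lines \<open>Im v = d\<close> and \<open>Im v = d + 2\<pi>\<close>, the residue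
  theorem evaluates \<open>(1 - exp z) I'(z)\<close> as a finite sum (\<open>integral_kern_line\<close>), made of simple
  poles at \<open>2\<pi>ik/N\<close> and \<open>2\<pi>il/M\<close> and a double pole at \<open>2\<pi>i\<close>. For \<open>Re z < 0\<close> the logarithm of the
  right-hand side, with principal branches, has the same derivative: the terms with \<open>Li\<^sub>2\<close> cancel, and
  the sums over roots of unity agree by partial fractions (\<open>has_field_derivative_principal_log\<close>).
  Both functions tend to \<open>0\<close> as \<open>Re z\<close> tends to \<open>-\<infinity>\<close>, so they coincide.

  That \<open>exp I\<close> extends to a meromorphic function on the plane follows from the functional equation
  \<open>exp (I(z + 2\<pi>iM)) (1 - exp (z/N)) = exp (I(z))\<close>, which itself is read off from the derivative. It allows
  translates of the strip to be glued (\<open>glued_meromorphic\<close>); the result is holomorphic off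
  \<open>2\<pi>i\<int>\<close>, where zeros and poles are confined, and the identity theorem identifies it with
  \<^const>\<open>quantum_dilog\<close> (\<open>quantum_dilog_rational\<close>).

  The passage to arbitrary paths rests on a monodromy argument. \<open>Li\<^sub>2 (exp w)\<close> and the
  logarithms on the right all have second derivatives that are single-valued and holomorphic off
  \<open>2\<pi>i\<int>\<close>, so their germs can be continued along every path there
  (\<open>analytic_continuation_along_exists\<close>). The right-hand side built from these continuations
  continues the germ of the quantum dilogarithm at the starting point. The quantum dilogarithm is
  single-valued, hence is its own continuation, and continuation along a path is unique
  (\<open>analytic_continuation_along_unique\<close>); so both sides agree at the end point.
\<close>

section \<open>Analytic continuation along a path\<close>

lemma holomorphic_eq_of_eventually_eq:
  assumes "f holomorphic_on S" "g holomorphic_on S" "open S" "connected S" "p \<in> S"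
    and "\<forall>\<^sub>F w in nhds p. f w = g w" and "w \<in> S"
  shows "f w = g w"
proof -
  obtain U where U: "open U" "p \<in> U" "\<And>w. w \<in> U \<Longrightarrow> f w = g w"
    using assms(6) by (auto simp: eventually_nhds)
  show ?thesis
    by (rule analytic_continuation_open[of "U \<inter> S" S]) (use assms U in auto)
qed

text \<open>
  Agreement of the two germs is an open and closed condition on the parameter: near a parameter \<open>a\<close>
  all germs of either continuation are restrictions of \<open>F a\<close> or \<open>G a\<close>, and two holomorphic functions
  on a disc agree everywhere on it as soon as they agree near one of its points.
\<close>
lemma analytic_continuation_along_unique:
  assumes F: "analytic_continuation_along \<gamma> f F" and G: "analytic_continuation_along \<gamma> f G"
    and "path \<gamma>" and t: "t \<in> {0..1}"
  shows "\<forall>\<^sub>F w in nhds (\<gamma> t). F t w = G t w"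
proof (rule connected_induction_simple[of "{0..1::real}" 0 t "\<lambda>t. \<forall>\<^sub>F w in nhds (\<gamma> t). F t w = G t w"])
  show "\<forall>\<^sub>F w in nhds (\<gamma> 0). F 0 w = G 0 w"
    using F G unfolding analytic_continuation_along_def
    by (auto elim: eventually_elim2)
next
  fix a :: real assume a: "a \<in> {0..1}"
  have "F a analytic_on {\<gamma> a}" "G a analytic_on {\<gamma> a}"
    using F G a by (auto simp: analytic_continuation_along_def)
  then obtain r1 r2 where r: "r1 > 0" "r2 > 0" "F a holomorphic_on ball (\<gamma> a) r1"
      "G a holomorphic_on ball (\<gamma> a) r2"
    unfolding analytic_on_def by auto
  define B where "B = ball (\<gamma> a) (min r1 r2)"
  have B: "F a holomorphic_on B" "G a holomorphic_on B" "open B" "connected B" "\<gamma> a \<in> B"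
    using r by (auto simp: B_def intro: holomorphic_on_subset)
  have ev: "\<forall>\<^sub>F u in at a within {0..1}. (\<forall>\<^sub>F w in nhds (\<gamma> u). F u w = F a w)"
       "\<forall>\<^sub>F u in at a within {0..1}. (\<forall>\<^sub>F w in nhds (\<gamma> u). G u w = G a w)"
    using F G a by (auto simp: analytic_continuation_along_def)
  have "(\<gamma> \<longlongrightarrow> \<gamma> a) (at a within {0..1})"
    using \<open>path \<gamma>\<close> a by (auto simp: path_def continuous_on_def)
  then have "\<forall>\<^sub>F u in at a within {0..1}. \<gamma> u \<in> B"
    using B by (auto elim: topological_tendstoD)
  with ev have "\<forall>\<^sub>F u in at a within {0..1}. (\<forall>\<^sub>F w in nhds (\<gamma> u). F u w = F a w) \<and>
      (\<forall>\<^sub>F w in nhds (\<gamma> u). G u w = G a w) \<and> \<gamma> u \<in> B"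
    by eventually_elim auto
  then obtain S where S: "open S" "a \<in> S" "\<And>u. u \<in> S \<Longrightarrow> u \<in> {0..1} \<Longrightarrow> u \<noteq> a \<Longrightarrow>
      (\<forall>\<^sub>F w in nhds (\<gamma> u). F u w = F a w) \<and> (\<forall>\<^sub>F w in nhds (\<gamma> u). G u w = G a w) \<and> \<gamma> u \<in> B"
    unfolding eventually_at_topological by blast
  have S': "(\<forall>\<^sub>F w in nhds (\<gamma> u). F u w = F a w) \<and> (\<forall>\<^sub>F w in nhds (\<gamma> u). G u w = G a w) \<and> \<gamma> u \<in> B"
    if "u \<in> S \<inter> {0..1}" for u
    using S(3)[of u] B that by (cases "u = a") auto
  have "\<forall>\<^sub>F w in nhds (\<gamma> y). F y w = G y w"
    if x: "x \<in> S \<inter> {0..1}" and y: "y \<in> S \<inter> {0..1}" and ex: "\<forall>\<^sub>F w in nhds (\<gamma> x). F x w = G x w"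
    for x y
  proof -
    have "\<forall>\<^sub>F w in nhds (\<gamma> x). F a w = G a w"
      using S'[OF x, THEN conjunct1] S'[OF x, THEN conjunct2, THEN conjunct1] ex
      by eventually_elim simp
    then have eq: "F a w = G a w" if "w \<in> B" for w
      using holomorphic_eq_of_eventually_eq[OF B(1-4) _ _ that] S'[OF x] by auto
    have "\<forall>\<^sub>F w in nhds (\<gamma> y). w \<in> B"
      using S'[OF y] B by (intro eventually_nhds_in_open) auto
    moreover have "\<forall>\<^sub>F w in nhds (\<gamma> y). F y w = F a w" "\<forall>\<^sub>F w in nhds (\<gamma> y). G y w = G a w"
      using S'[OF y] by auto
    ultimately show ?thesis
      by eventually_elim (use eq in auto)
  qed
  moreover have "openin (top_of_set {0..1}) (S \<inter> {0..1})"
    using S by (auto simp: openin_open)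
  ultimately show "\<exists>T. openin (top_of_set {0..1}) T \<and> a \<in> T \<and> (\<forall>x\<in>T. \<forall>y\<in>T.
      (\<forall>\<^sub>F w in nhds (\<gamma> x). F x w = G x w) \<longrightarrow> (\<forall>\<^sub>F w in nhds (\<gamma> y). F y w = G y w))"
    using S a by blast
qed (use t in auto)

lemma continued_value_eq:
  assumes "analytic_continuation_along \<gamma> f F" and "path \<gamma>"
  shows "continued_value \<gamma> f = F 1 (\<gamma> 1)"
  unfolding continued_value_def
proof (rule the_equality)
  fix v assume "\<exists>G. analytic_continuation_along \<gamma> f G \<and> v = G 1 (\<gamma> 1)"
  then obtain G where G: "analytic_continuation_along \<gamma> f G" "v = G 1 (\<gamma> 1)" by auto
  show "v = F 1 (\<gamma> 1)"
    using eventually_nhds_x_imp_x[OF analytic_continuation_along_unique[OF G(1) assms, of 1]] G by auto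
qed (use assms in auto)

lemma analytic_continuation_along_self:
  assumes "f analytic_on path_image \<gamma>"
  shows "analytic_continuation_along \<gamma> f (\<lambda>_. f)"
  using assms unfolding analytic_continuation_along_def path_image_def
  by (auto intro: analytic_on_subset)

lemma analytic_continuation_along_cong:
  assumes "analytic_continuation_along \<gamma> f F" "\<forall>\<^sub>F w in nhds (\<gamma> 0). f w = g w"
  shows "analytic_continuation_along \<gamma> g F"
  using assms unfolding analytic_continuation_along_def
  by (auto elim: eventually_elim2)

lemma analytic_continuation_along_add:
  assumes "analytic_continuation_along \<gamma> f F" "analytic_continuation_along \<gamma> g G"
  shows "analytic_continuation_along \<gamma> (\<lambda>w. f w + g w) (\<lambda>t w. F t w + G t w)"
proof -
  have "\<forall>\<^sub>F u in at t within {0..1}. \<forall>\<^sub>F w in nhds (\<gamma> u). F u w + G u w = F t w + G t w"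
    if "t \<in> {0..1}" for t
  proof -
    have "\<forall>\<^sub>F u in at t within {0..1}. \<forall>\<^sub>F w in nhds (\<gamma> u). F u w = F t w"
      "\<forall>\<^sub>F u in at t within {0..1}. \<forall>\<^sub>F w in nhds (\<gamma> u). G u w = G t w"
      using assms that by (auto simp: analytic_continuation_along_def)
    then show ?thesis
      by eventually_elim (auto elim: eventually_elim2)
  qed
  with assms show ?thesis
    unfolding analytic_continuation_along_def by (auto intro: analytic_intros elim: eventually_elim2)
qed

lemma analytic_continuation_along_mult:
  assumes "analytic_continuation_along \<gamma> f F" "analytic_continuation_along \<gamma> g G"
  shows "analytic_continuation_along \<gamma> (\<lambda>w. f w * g w) (\<lambda>t w. F t w * G t w)"
proof -
  have "\<forall>\<^sub>F u in at t within {0..1}. \<forall>\<^sub>F w in nhds (\<gamma> u). F u w * G u w = F t w * G t w"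
    if "t \<in> {0..1}" for t
  proof -
    have "\<forall>\<^sub>F u in at t within {0..1}. \<forall>\<^sub>F w in nhds (\<gamma> u). F u w = F t w"
      "\<forall>\<^sub>F u in at t within {0..1}. \<forall>\<^sub>F w in nhds (\<gamma> u). G u w = G t w"
      using assms that by (auto simp: analytic_continuation_along_def)
    then show ?thesis
      by eventually_elim (auto elim: eventually_elim2)
  qed
  with assms show ?thesis
    unfolding analytic_continuation_along_def by (auto intro: analytic_intros elim: eventually_elim2)
qed

lemma analytic_continuation_along_exp:
  assumes "analytic_continuation_along \<gamma> f F"
  shows "analytic_continuation_along \<gamma> (\<lambda>w. exp (f w)) (\<lambda>t w. exp (F t w))"
proof -
  have "\<forall>\<^sub>F u in at t within {0..1}. \<forall>\<^sub>F w in nhds (\<gamma> u). exp (F u w) = exp (F t w)"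
    if "t \<in> {0..1}" for t
  proof -
    have "\<forall>\<^sub>F u in at t within {0..1}. \<forall>\<^sub>F w in nhds (\<gamma> u). F u w = F t w"
      using assms that by (auto simp: analytic_continuation_along_def)
    then show ?thesis
      by eventually_elim (auto elim: eventually_mono)
  qed
  with assms show ?thesis
    unfolding analytic_continuation_along_def by (auto intro: analytic_intros elim: eventually_mono)
qed

lemma analytic_continuation_along_sum:
  assumes "\<And>k. k \<in> A \<Longrightarrow> analytic_continuation_along \<gamma> (f k) (F k)"
  shows "analytic_continuation_along \<gamma> (\<lambda>w. \<Sum>k\<in>A. f k w) (\<lambda>t w. \<Sum>k\<in>A. F k t w)"
  using assms
proof (induction A rule: infinite_finite_induct)
  case (insert k A)
  then show ?case
    using analytic_continuation_along_add[of \<gamma> "f k" "F k"] by simp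
qed (simp_all add: analytic_continuation_along_self analytic_on_const)

text \<open>
  On a convex set a holomorphic function has a second antiderivative, unique up to an affine function,
  and the affine function can be chosen to match a given germ. Convex sets thus carry the
  continuation; the existence proof below only has to chain them.
\<close>
lemma second_antiderivative_extends:
  assumes B: "convex B" "open B" and g: "g holomorphic_on B" and p: "p \<in> B"
    and f: "f analytic_on {p}" "\<forall>\<^sub>F w in nhds p. deriv (deriv f) w = g w"
  obtains h where "h holomorphic_on B" "\<forall>w\<in>B. deriv (deriv h) w = g w" "\<forall>\<^sub>F w in nhds p. h w = f w"
proof -
  obtain G1 where G1: "\<And>x. x \<in> B \<Longrightarrow> (G1 has_field_derivative g x) (at x)"
    using holomorphic_convex_primitive'[OF B g] at_within_open[OF _ B(2)] by metis
  have "G1 holomorphic_on B"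
    using G1 B(2) by (auto simp: holomorphic_on_open)
  then obtain G2 where G2: "\<And>x. x \<in> B \<Longrightarrow> (G2 has_field_derivative G1 x) (at x)"
    using holomorphic_convex_primitive'[OF B] at_within_open[OF _ B(2)] by metis
  define a where "a = deriv f p - G1 p"
  define h where "h = (\<lambda>w. G2 w + a * (w - p) + (f p - G2 p))"
  have h': "(h has_field_derivative G1 w + a) (at w)" if "w \<in> B" for w
    unfolding h_def by (auto intro!: derivative_eq_intros G2 that)
  have h'': "(deriv h has_field_derivative g w) (at w)" if "w \<in> B" for w
  proof -
    have "((\<lambda>w. G1 w + a) has_field_derivative g w) (at w)"
      by (auto intro!: derivative_eq_intros G1 that)
    moreover have "deriv h w = G1 w + a" if "w \<in> B" for w
      using h'[OF that] by (rule DERIV_imp_deriv)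
    ultimately show ?thesis
      using has_field_derivative_transform_within_open[OF _ B(2) that] by simp
  qed
  obtain e1 where e1: "e1 > 0" "f holomorphic_on ball p e1"
    using f(1) by (auto simp: analytic_on_def)
  have "\<forall>\<^sub>F w in nhds p. deriv (deriv f) w = g w \<and> w \<in> B"
    using f(2) eventually_nhds_in_open[OF B(2) p] by eventually_elim auto
  then obtain e2 where e2: "e2 > 0" "\<And>w. w \<in> ball p e2 \<Longrightarrow> deriv (deriv f) w = g w \<and> w \<in> B"
    by (auto simp: eventually_nhds_metric dist_commute)
  define C where "C = ball p (min e1 e2)"
  have C: "convex C" "open C" "p \<in> C" "C \<subseteq> B" "\<And>w. w \<in> C \<Longrightarrow> deriv (deriv f) w = g w"
      "f holomorphic_on C"
    using e1 e2 by (auto simp: C_def intro: holomorphic_on_subset)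
  have f': "(f has_field_derivative deriv f w) (at w)"
       "(deriv f has_field_derivative g w) (at w)" if "w \<in> C" for w
    using holomorphic_derivI[OF C(6) C(2) that]
      holomorphic_derivI[OF holomorphic_deriv[OF C(6) C(2)] C(2) that] C(5)[OF that] by auto
  have d: "deriv f w - deriv h w = 0" if "w \<in> C" for w
  proof -
    have "\<exists>c. \<forall>x\<in>C. deriv f x - deriv h x = c"
    proof (rule has_field_derivative_zero_constant[OF C(1)])
      fix x assume x: "x \<in> C"
      then have "x \<in> B" using C(4) by auto
      from DERIV_diff[OF f'(2)[OF x] h''[OF this]]
      show "((\<lambda>x. deriv f x - deriv h x) has_field_derivative 0) (at x within C)"
        by (auto intro: has_field_derivative_at_within)
    qed
    moreover have "deriv f p - deriv h p = 0"
      using DERIV_imp_deriv[OF h'[OF p]] by (simp add: a_def)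
    ultimately show ?thesis using that C by metis
  qed
  have "f w - h w = 0" if "w \<in> C" for w
  proof -
    have "\<exists>c. \<forall>x\<in>C. f x - h x = c"
    proof (rule has_field_derivative_zero_constant[OF C(1)])
      fix x assume x: "x \<in> C"
      have "(h has_field_derivative deriv h x) (at x)"
        using h'[of x] DERIV_imp_deriv[OF h'[of x]] x C(4) by (simp add: subset_iff)
      from DERIV_diff[OF f'(1)[OF x] this]
      show "((\<lambda>x. f x - h x) has_field_derivative 0) (at x within C)"
        using d[OF x] by (auto intro: has_field_derivative_at_within)
    qed
    moreover have "f p - h p = 0" by (simp add: h_def)
    ultimately show ?thesis using that C by metis
  qed
  then have "\<forall>\<^sub>F w in nhds p. h w = f w"
    using C(2,3) by (auto simp: eventually_nhds)
  moreover have "h holomorphic_on B"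
    using h' B(2) by (auto simp: holomorphic_on_open)
  moreover have "\<forall>w\<in>B. deriv (deriv h) w = g w"
    using h'' DERIV_imp_deriv by blast
  ultimately show ?thesis using that by blast
qed

text \<open>
  Both the logarithms \<open>log (1 - a exp (w/n))\<close> and \<open>Li\<^sub>2 (exp w)\<close> become single-valued
  after two differentiations, so a hypothesis on the second derivative covers all the multivalued
  functions at hand. The path is cut into pieces so short that each lies in a disc inside \<open>\<Omega>\<close>, and the
  germ is passed from one disc to the next.
\<close>
lemma analytic_continuation_along_exists:
  assumes \<gamma>: "path \<gamma>" "path_image \<gamma> \<subseteq> \<Omega>" and \<Omega>: "open \<Omega>" and g: "g holomorphic_on \<Omega>"
    and f: "f analytic_on {\<gamma> 0}" "\<forall>\<^sub>F w in nhds (\<gamma> 0). deriv (deriv f) w = g w"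
  obtains F where "analytic_continuation_along \<gamma> f F"
proof -
  have "compact (path_image \<gamma>)" using \<gamma> by (simp add: compact_path_image)
  then obtain r where r: "r > 0" "\<And>p. p \<in> path_image \<gamma> \<Longrightarrow> ball p r \<subseteq> \<Omega>"
    using compact_subset_open_imp_ball_epsilon_subset[OF _ \<Omega> \<gamma>(2)] by (metis UN_subset_iff)
  have "uniformly_continuous_on {0..1} \<gamma>"
    using \<gamma> by (intro compact_uniformly_continuous) (auto simp: path_def)
  then obtain d where d: "d > 0" "\<And>s t. s \<in> {0..1} \<Longrightarrow> t \<in> {0..1} \<Longrightarrow> dist s t < d \<Longrightarrow> dist (\<gamma> s) (\<gamma> t) < r"
    using r(1) unfolding uniformly_continuous_on_def by metis
  obtain n where n: "n > 0" "2 / real n < d"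
  proof -
    obtain n where "real n > 2 / d" using reals_Archimedean2 by blast
    moreover from this d have "n > 0" by (cases n) (auto simp: field_simps)
    ultimately show ?thesis using d by (intro that[of n]) (auto simp: field_simps)
  qed
  \<comment> \<open>The nodes are clipped at \<open>1\<close> so that the choice below may run over all naturals.\<close>
  define p where "p i = \<gamma> (min 1 (real i / real n))" for i
  define B where "B i = ball (p i) r" for i
  have pin: "p i \<in> path_image \<gamma>" for i
    by (auto simp: p_def path_image_def)
  have near: "\<gamma> u \<in> B i" if "u \<in> {0..1}" "\<bar>u - real i / real n\<bar> < d" for u i
  proof -
    have "dist (min 1 (real i / real n)) u < d"
      using that unfolding dist_real_def atLeastAtMost_iff min_def by (smt (verit))
    then show ?thesis
      using d(2)[of "min 1 (real i / real n)" u] that by (auto simp: B_def p_def)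
  qed
  have pB: "p (Suc i) \<in> B i" for i
  proof -
    have "dist (min 1 (real (Suc i) / real n)) (min 1 (real i / real n)) \<le> 1 / real n"
    proof -
      have "real (Suc i) / real n = real i / real n + 1 / real n"
        by (simp add: add_divide_distrib)
      moreover have "1 / real n > 0" using n by simp
      ultimately show ?thesis unfolding dist_real_def min_def by (smt (verit))
    qed
    also have "\<dots> < d" using n by (auto simp: field_simps)
    finally show ?thesis
      using d(2)[of "min 1 (real i / real n)" "min 1 (real (Suc i) / real n)"]
      by (auto simp: B_def p_def dist_commute)
  qed
  have B: "convex (B i)" "open (B i)" "g holomorphic_on B i" "p i \<in> B i" for i
    using r pin[of i] g by (auto simp: B_def intro: holomorphic_on_subset)
  define P where "P i h \<longleftrightarrow> h holomorphic_on B i \<and> (\<forall>w\<in>B i. deriv (deriv h) w = g w) \<and>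
      (i = 0 \<longrightarrow> (\<forall>\<^sub>F w in nhds (p 0). h w = f w))" for i h
  have "\<exists>h. \<forall>i. P i (h i) \<and> (\<forall>\<^sub>F w in nhds (p (Suc i)). h (Suc i) w = h i w)"
  proof (rule dependent_nat_choice)
    have "p 0 = \<gamma> 0" by (simp add: p_def)
    then show "\<exists>h. P 0 h"
      using second_antiderivative_extends[OF B(1-4)[of 0], of f] f unfolding P_def by metis
  next
    fix h i assume h: "P i h"
    have "h analytic_on {p (Suc i)}"
      using h pB[of i] B(2)[of i] by (auto simp: P_def analytic_at)
    moreover have "\<forall>\<^sub>F w in nhds (p (Suc i)). deriv (deriv h) w = g w"
      using h eventually_nhds_in_open[OF B(2) pB[of i]] unfolding P_def by (auto elim: eventually_mono)
    ultimately show "\<exists>h'. P (Suc i) h' \<and> (\<forall>\<^sub>F w in nhds (p (Suc i)). h' w = h w)"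
      using second_antiderivative_extends[OF B(1-4)[of "Suc i"]] unfolding P_def by (metis nat.distinct(1))
  qed
  then obtain h where h: "\<And>i. P i (h i)" and step: "\<And>i. \<forall>\<^sub>F w in nhds (p (Suc i)). h (Suc i) w = h i w"
    by auto
  have agree: "h (Suc i) w = h i w" if "w \<in> B i" "w \<in> B (Suc i)" for w i
  proof (rule holomorphic_eq_of_eventually_eq[where f = "h (Suc i)" and g = "h i" and S = "B i \<inter> B (Suc i)" and p = "p (Suc i)"])
    show "h (Suc i) holomorphic_on B i \<inter> B (Suc i)" "h i holomorphic_on B i \<inter> B (Suc i)"
      using h[of i] h[of "Suc i"] by (auto simp: P_def intro: holomorphic_on_subset)
    show "connected (B i \<inter> B (Suc i))"
      by (intro convex_connected convex_Int B)
  qed (use that pB[of i] B step in auto)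
  \<comment> \<open>The germ at \<open>\<gamma> t\<close> comes from the disc around the last node before \<open>t\<close>. The bound \<open>2 / n < d\<close> keeps
      the discs of neighbouring nodes in reach, too.\<close>
  define F where "F t = h (nat \<lfloor>t * real n\<rfloor>)" for t
  have cell: "\<bar>t - real (nat \<lfloor>t * real n\<rfloor>) / real n\<bar> \<le> 1 / real n" if "t \<ge> 0" for t
  proof -
    have "real (nat \<lfloor>t * real n\<rfloor>) = of_int \<lfloor>t * real n\<rfloor>" using that by simp
    then have "\<bar>t * real n - real (nat \<lfloor>t * real n\<rfloor>)\<bar> \<le> 1"
      using of_int_floor_le[of "t * real n"] real_of_int_floor_add_one_gt[of "t * real n"] by linarith
    then have "\<bar>t * real n - real (nat \<lfloor>t * real n\<rfloor>)\<bar> / real n \<le> 1 / real n"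
      using n by (intro divide_right_mono) auto
    moreover have "\<bar>t * real n - real (nat \<lfloor>t * real n\<rfloor>)\<bar> / real n = \<bar>t - real (nat \<lfloor>t * real n\<rfloor>) / real n\<bar>"
    proof -
      have "t - real (nat \<lfloor>t * real n\<rfloor>) / real n = (t * real n - real (nat \<lfloor>t * real n\<rfloor>)) / real n"
        using n by (simp add: diff_divide_distrib)
      then show ?thesis by simp
    qed
    ultimately show ?thesis by simp
  qed
  have nd: "1 / real n < d" using n by (auto simp: field_simps)
  have "analytic_continuation_along \<gamma> f F"
    unfolding analytic_continuation_along_def
  proof (intro conjI ballI)
    fix t :: real assume t: "t \<in> {0..1}"
    let ?i = "nat \<lfloor>t * real n\<rfloor>"
    have ti: "\<gamma> t \<in> B ?i"
      using near[OF t, of ?i] cell[of t] t nd by auto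
    then show "F t analytic_on {\<gamma> t}"
      using h[of ?i] B(2)[of ?i] by (auto simp: F_def P_def analytic_at)
    have "\<forall>\<^sub>F u in at t within {0..1}. u \<in> {0..1} \<and> \<bar>u - t\<bar> < 1 / real n"
      unfolding eventually_at dist_real_def using n by (intro exI[of _ "1 / real n"]) auto
    then show "\<forall>\<^sub>F u in at t within {0..1}. \<forall>\<^sub>F w in nhds (\<gamma> u). F u w = F t w"
    proof eventually_elim
      case (elim u)
      let ?j = "nat \<lfloor>u * real n\<rfloor>"
      have "\<bar>u - t\<bar> * real n < 1"
        using elim n by (simp add: field_simps)
      then have "\<bar>u * real n - t * real n\<bar> < 1"
        by (simp add: abs_mult flip: left_diff_distrib)
      moreover have "real ?i \<le> t * real n \<and> t * real n < real ?i + 1"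
        "real ?j \<le> u * real n \<and> u * real n < real ?j + 1"
        using elim t by (simp_all add: of_nat_nat)
      ultimately have "real ?i < real ?j + 2" "real ?j < real ?i + 2" by linarith+
      then consider "?j = ?i" | "?j = Suc ?i" | "?i = Suc ?j" by linarith
      moreover have ui: "\<gamma> u \<in> B ?i"
      proof (rule near)
        have "2 / real n = 1 / real n + 1 / real n" by simp
        then show "\<bar>u - real ?i / real n\<bar> < d"
          using elim(1)[THEN conjunct2] cell[of t] t n(2) by (smt (verit) atLeastAtMost_iff)
      qed (use elim in auto)
      moreover have uj: "\<gamma> u \<in> B ?j"
      proof (rule near)
        show "\<bar>u - real ?j / real n\<bar> < d"
          using elim(1)[THEN conjunct1] cell[of u] nd by (smt (verit) atLeastAtMost_iff)
      qed (use elim in auto)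
      moreover have ev: "\<forall>\<^sub>F w in nhds (\<gamma> u). w \<in> B ?i \<inter> B ?j"
        using ui uj B by (intro eventually_nhds_in_open) auto
      ultimately show ?case
      proof cases
        case 2
        then show ?thesis using ev agree[of _ ?i] by (auto simp: F_def elim: eventually_mono)
      next
        case 3
        then show ?thesis using ev agree[of _ ?j] by (auto simp: F_def elim!: eventually_mono)
      qed (auto simp: F_def)
    qed
  next
    show "\<forall>\<^sub>F w in nhds (\<gamma> 0). F 0 w = f w"
      using h[of 0] by (simp add: F_def P_def p_def)
  qed
  then show ?thesis by (rule that)
qed

section \<open>Integrals over horizontal lines\<close>

lemma norm_exp_minus_one_le:
  fixes w :: complex
  shows "norm (exp w - 1) \<le> norm w * exp (norm w)"
proof -
  have "norm (exp w - exp 0) \<le> exp (norm w) * norm (w - 0)"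
  proof (rule field_differentiable_bound[where S = "cball 0 (norm w)" and f' = exp])
    fix x :: complex assume "x \<in> cball 0 (norm w)"
    then show "norm (exp x) \<le> exp (norm w)"
      using norm_exp[of x] by (simp add: order_trans)
  qed (auto intro: DERIV_subset[OF DERIV_exp])
  then show ?thesis by (simp add: mult.commute)
qed

text \<open>
  Differentiation under the integral sign. The difference quotients of \<open>exp (w l)\<close> at \<open>z\<close> are bounded by
  \<open>\<bar>l\<bar> exp (\<rho>/2 \<bar>l\<bar>) \<bar>exp (z l)\<bar>\<close>, and \<open>exp (\<rho>/2 \<bar>l\<bar>)\<close> absorbs the factor \<open>\<bar>l\<bar>\<close>; this is
  why integrability is required with the weight \<open>exp (\<rho> \<bar>l\<bar>)\<close>.
\<close>
lemma has_field_derivative_exp_transform: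
  fixes l k :: "real \<Rightarrow> complex"
  assumes [measurable]: "l \<in> borel_measurable borel" "k \<in> borel_measurable borel"
    and "\<rho> > 0"
    and int: "integrable lborel (\<lambda>u. exp (\<rho> * norm (l u)) * norm (exp (z * l u) * k u))"
  shows "((\<lambda>w. LBINT u. exp (w * l u) * k u) has_field_derivative
           (LBINT u. l u * (exp (z * l u) * k u))) (at z)"
proof -
  define D where "D u = exp (\<rho> * norm (l u)) * norm (exp (z * l u) * k u)" for u
  have D0: "D u \<ge> 0" for u by (simp add: D_def)
  have le_exp: "norm (l u) * exp (\<rho> / 2 * norm (l u)) \<le> 2 / \<rho> * exp (\<rho> * norm (l u))" for u
  proof -
    have "\<rho> / 2 * norm (l u) \<le> exp (\<rho> / 2 * norm (l u))"
      by (meson exp_ge_add_one_self le_add_same_cancel2 order_trans zero_le_one)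
    then have "norm (l u) \<le> 2 / \<rho> * exp (\<rho> / 2 * norm (l u))"
      using \<open>\<rho> > 0\<close> by (simp add: field_simps)
    then have "norm (l u) * exp (\<rho> / 2 * norm (l u)) \<le> 2 / \<rho> * exp (\<rho> / 2 * norm (l u)) * exp (\<rho> / 2 * norm (l u))"
      by (intro mult_right_mono) auto
    also have "\<dots> = 2 / \<rho> * exp (\<rho> * norm (l u))"
      by (simp add: mult.assoc flip: exp_add)
    finally show ?thesis .
  qed
  have int_near: "integrable lborel (\<lambda>u. exp (w * l u) * k u)" if "norm (w - z) \<le> \<rho>" for w
  proof (rule Bochner_Integration.integrable_bound[OF int])
    show "AE u in lborel. norm (exp (w * l u) * k u) \<le>
        norm (exp (\<rho> * norm (l u)) * norm (exp (z * l u) * k u))"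
    proof (intro AE_I2)
      fix u
      have "norm (exp (w * l u) * k u) = norm (exp ((w - z) * l u)) * norm (exp (z * l u) * k u)"
        by (simp add: norm_mult left_diff_distrib exp_diff norm_divide)
      also have "norm (exp ((w - z) * l u)) \<le> exp (norm ((w - z) * l u))"
        by (rule norm_exp)
      also have "\<dots> \<le> exp (\<rho> * norm (l u))"
        using that by (auto simp: norm_mult intro!: mult_right_mono)
      finally show "norm (exp (w * l u) * k u) \<le> norm (exp (\<rho> * norm (l u)) * norm (exp (z * l u) * k u))"
        by (simp add: mult_right_mono)
    qed
  qed simp
  have "((\<lambda>h. (LBINT u. (exp ((z + h) * l u) * k u - exp (z * l u) * k u) / h)) \<longlongrightarrow>
           (LBINT u. l u * (exp (z * l u) * k u))) (at 0)"
    unfolding tendsto_at_iff_sequentially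
  proof (intro allI impI)
    fix X :: "nat \<Rightarrow> complex" assume X: "\<forall>i. X i \<in> UNIV - {0}" "X \<longlonglongrightarrow> 0"
    \<comment> \<open>The dominating function works only for \<open>norm (X i) \<le> \<rho> / 2\<close>, hence the passage to a tail of \<open>X\<close>.\<close>
    have "eventually (\<lambda>i. norm (X i) < \<rho> / 2) sequentially"
      using tendstoD[OF X(2), of "\<rho> / 2"] \<open>\<rho> > 0\<close> by simp
    then obtain n0 where n0: "\<And>i. norm (X (i + n0)) \<le> \<rho> / 2"
      unfolding eventually_sequentially using le_add2 less_imp_le by metis
    have "(\<lambda>i. LBINT u. (exp ((z + X (i + n0)) * l u) * k u - exp (z * l u) * k u) / X (i + n0)) \<longlonglongrightarrow>
            (LBINT u. l u * (exp (z * l u) * k u))"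
    proof (rule integral_dominated_convergence[where w = "\<lambda>u. 2 / \<rho> * D u"])
      show "integrable lborel (\<lambda>u. 2 / \<rho> * D u)"
        unfolding D_def by (intro integrable_mult_right int)
      show "AE u in lborel. (\<lambda>i. (exp ((z + X (i + n0)) * l u) * k u - exp (z * l u) * k u) / X (i + n0))
              \<longlonglongrightarrow> l u * (exp (z * l u) * k u)"
      proof (intro AE_I2)
        fix u
        have "((\<lambda>w. exp (w * l u) * k u) has_field_derivative l u * (exp (z * l u) * k u)) (at z)"
          by (auto intro!: derivative_eq_intros)
        then have *: "((\<lambda>h. (exp ((z + h) * l u) * k u - exp (z * l u) * k u) / h)
            \<longlongrightarrow> l u * (exp (z * l u) * k u)) (at 0)"
          by (simp add: DERIV_def)
        have "filterlim (\<lambda>i. X (i + n0)) (at 0) sequentially"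
          using X LIMSEQ_ignore_initial_segment[OF X(2)] by (auto simp: filterlim_at)
        from filterlim_compose[OF * this]
        show "(\<lambda>i. (exp ((z + X (i + n0)) * l u) * k u - exp (z * l u) * k u) / X (i + n0))
              \<longlonglongrightarrow> l u * (exp (z * l u) * k u)" .
      qed
      fix i
      show "AE u in lborel. norm ((exp ((z + X (i + n0)) * l u) * k u - exp (z * l u) * k u) / X (i + n0))
           \<le> 2 / \<rho> * D u"
      proof (intro AE_I2)
        fix u
        define x where "x = X (i + n0)"
        have x: "x \<noteq> 0" "norm x \<le> \<rho> / 2" using X n0 by (auto simp: x_def)
        have "norm ((exp ((z + x) * l u) * k u - exp (z * l u) * k u) / x) =
              norm (exp (x * l u) - 1) / norm x * norm (exp (z * l u) * k u)"
          by (simp add: ring_distribs exp_add norm_divide norm_mult[symmetric]) (simp add: algebra_simps)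
        also have "norm (exp (x * l u) - 1) / norm x \<le> norm (l u) * exp (\<rho> / 2 * norm (l u))"
        proof -
          have "norm (exp (x * l u) - 1) \<le> norm (x * l u) * exp (norm (x * l u))"
            by (rule norm_exp_minus_one_le)
          also have "\<dots> \<le> (norm x * norm (l u)) * exp (\<rho> / 2 * norm (l u))"
          proof (unfold norm_mult, rule mult_left_mono)
            show "exp (norm x * norm (l u)) \<le> exp (\<rho> / 2 * norm (l u))"
              using mult_right_mono[OF x(2) norm_ge_zero[of "l u"]] by (subst exp_le_cancel_iff)
          qed simp
          finally show ?thesis using x by (simp add: field_simps)
        qed
        also have "\<dots> \<le> 2 / \<rho> * exp (\<rho> * norm (l u))"
          by (rule le_exp)
        finally show "norm ((exp ((z + X (i + n0)) * l u) * k u - exp (z * l u) * k u) / X (i + n0))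
           \<le> 2 / \<rho> * D u"
          by (simp add: D_def x_def mult_right_mono)
      qed
    qed auto
    then have "(\<lambda>i. LBINT u. (exp ((z + X i) * l u) * k u - exp (z * l u) * k u) / X i) \<longlonglongrightarrow>
            (LBINT u. l u * (exp (z * l u) * k u))"
      by (rule LIMSEQ_offset)
    then show "((\<lambda>h. LBINT u. (exp ((z + h) * l u) * k u - exp (z * l u) * k u) / h) \<circ> X) \<longlonglongrightarrow>
            (LBINT u. l u * (exp (z * l u) * k u))"
      by (simp add: o_def)
  qed
  moreover have "\<forall>\<^sub>F h in at 0. (LBINT u. (exp ((z + h) * l u) * k u - exp (z * l u) * k u) / h) =
       ((LBINT u. exp ((z + h) * l u) * k u) - (LBINT u. exp (z * l u) * k u)) / h"
  proof -
    have "\<forall>\<^sub>F h::complex in at 0. norm h < \<rho>"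
      using \<open>\<rho> > 0\<close> by (auto simp: eventually_at intro!: exI[of _ \<rho>])
    then show ?thesis
    proof eventually_elim
      case (elim h)
      have "integrable lborel (\<lambda>u. exp ((z + h) * l u) * k u)" "integrable lborel (\<lambda>u. exp (z * l u) * k u)"
        using int_near[of "z + h"] int_near[of z] elim \<open>\<rho> > 0\<close> by simp_all
      then show ?case by (simp only: integral_divide_zero Bochner_Integration.integral_diff)
    qed
  qed
  ultimately show ?thesis
    unfolding DERIV_def by (rule Lim_transform_eventually)
qed

lemma integrable_exp_minus_abs:
  fixes c :: real
  assumes "c > 0"
  shows "integrable lborel (\<lambda>u::real. exp (- c * \<bar>u\<bar>))"
proof -
  define f where "f u = indicator {0..} u *\<^sub>R exp (- c * u)" for u :: real
  have "(\<lambda>x. exp (- c * x)) absolutely_integrable_on {0..}"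
    by (intro nonnegative_absolutely_integrable_1 integrable_on_exp_minus_to_infinity assms) auto
  then have f: "integrable lborel f"
    unfolding set_integrable_def f_def by (subst (asm) integrable_completion) auto
  have "integrable lborel (\<lambda>u. f (0 + (-1) * u))"
    by (intro lborel_integrable_real_affine f) auto
  then have "integrable lborel (\<lambda>u. f u + f (- u))"
    using f by simp
  then show ?thesis
    by (rule Bochner_Integration.integrable_bound)
       (auto simp: f_def indicator_def)
qed

lemma contour_integral_linepath_same_Im:
  assumes "a < b"
  shows "contour_integral (linepath (Complex a c) (Complex b c)) f =
           integral {a..b} (\<lambda>x. f (Complex x c))"
proof -
  have "contour_integral (linepath (Complex a c) (Complex b c)) f =
        contour_integral (linepath (of_real a) (of_real b)) (\<lambda>v. f (v + \<i> * of_real c))"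
    by (simp add: contour_integral_integral linepath_def scaleR_conv_of_real Complex_eq algebra_simps)
  also have "\<dots> = integral {a..b} (\<lambda>x. f (Complex x c))"
    by (subst contour_integral_linepath_Reals_eq) (use assms in \<open>auto simp: Complex_eq\<close>)
  finally show ?thesis .
qed

lemma integral_symmetric_interval_tendsto_lborel:
  fixes f :: "real \<Rightarrow> complex"
  assumes f: "integrable lborel f"
  shows "(\<lambda>n. integral {- real n..real n} f) \<longlonglongrightarrow> (LBINT u. f u)"
proof -
  have [measurable]: "f \<in> borel_measurable borel" using f by auto
  have "(\<lambda>n. LBINT u. indicator {- real n..real n} u *\<^sub>R f u) \<longlonglongrightarrow> (LBINT u. f u)"
  proof (rule integral_dominated_convergence[where w = "\<lambda>u. norm (f u)"])
    show "AE u in lborel. (\<lambda>n. indicator {- real n..real n} u *\<^sub>R f u) \<longlonglongrightarrow> f u"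
    proof (intro AE_I2 tendsto_eventually)
      fix u :: real
      have "\<forall>\<^sub>F n in sequentially. real n \<ge> \<bar>u\<bar>"
        by (rule eventually_sequentiallyI[of "nat \<lceil>\<bar>u\<bar>\<rceil>"]) linarith
      then show "\<forall>\<^sub>F n in sequentially. indicator {- real n..real n} u *\<^sub>R f u = f u"
        by eventually_elim (auto simp: indicator_def abs_le_iff)
    qed
  qed (use f in \<open>auto simp: indicator_def\<close>)
  moreover have "integral {- real n..real n} f = (LBINT u. indicator {- real n..real n} u *\<^sub>R f u)" for n
  proof -
    have "set_integrable lborel {- real n..real n} f"
      unfolding set_integrable_def using f by (intro integrable_mult_indicator) auto
    from set_borel_integral_eq_integral(2)[OF this] show ?thesis
      by (simp add: set_lebesgue_integral_def)
  qed
  ultimately show ?thesis by simp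
qed

text \<open>
  The residue theorem for the rectangles \<open>[-n, n] \<times> [a, b]\<close>: the decay hypothesis removes the
  vertical sides in the limit, and the horizontal sides become the two line integrals.
\<close>
lemma integral_line_shift_eq_sum_residues:
  fixes f :: "complex \<Rightarrow> complex"
  assumes ab: "a' < a" "a < b" "b < b'"
    and pts: "finite pts" "\<And>p. p \<in> pts \<Longrightarrow> a < Im p \<and> Im p < b"
    and holo: "f holomorphic_on {v. a' < Im v \<and> Im v < b'} - pts"
    and int_a: "integrable lborel (\<lambda>u. f (Complex u a))"
    and int_b: "integrable lborel (\<lambda>u. f (Complex u b))"
    and decay: "\<forall>\<^sub>F u in at_top. \<forall>y\<in>{a..b}. norm (f (Complex u y)) \<le> B u \<and> norm (f (Complex (- u) y)) \<le> B u"
    and B: "(B \<longlongrightarrow> 0) at_top"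
  shows "(LBINT u. f (Complex u a)) - (LBINT u. f (Complex u b)) = 2 * pi * \<i> * (\<Sum>p\<in>pts. residue f p)"
proof -
  define S where "S = {v. a' < Im v \<and> Im v < b'}"
  have S: "open S" "convex S"
  proof -
    have "S = {v. a' < Im v} \<inter> {v. Im v < b'}" by (auto simp: S_def)
    then show "open S" "convex S"
      by (auto intro!: open_Int open_halfspace_Im_gt open_halfspace_Im_lt convex_Int
          convex_halfspace_Im_gt convex_halfspace_Im_lt)
  qed
  define V1 where "V1 n = contour_integral (linepath (Complex (real n) a) (Complex (real n) b)) f" for n
  define V2 where "V2 n = contour_integral (linepath (Complex (- real n) b) (Complex (- real n) a)) f" for n
  define Ha where "Ha n = integral {- real n..real n} (\<lambda>u. f (Complex u a))" for n
  define Hb where "Hb n = integral {- real n..real n} (\<lambda>u. f (Complex u b))" for n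
  obtain K where K: "\<And>p. p \<in> pts \<Longrightarrow> norm p \<le> K"
    using finite_imp_bounded[OF pts(1)] by (auto simp: bounded_iff)
  have big: "\<forall>\<^sub>F n in sequentially. real n > max K 1"
    using filterlim_real_sequentially unfolding filterlim_at_top_dense by blast
  have cont: "f contour_integrable_on linepath p q" if "closed_segment p q \<subseteq> S - pts" for p q
    by (rule contour_integrable_continuous_linepath)
       (use holo that in \<open>auto simp: S_def intro: holomorphic_on_imp_continuous_on holomorphic_on_subset\<close>)
  have rect: "Ha n + V1 n - Hb n + V2 n = 2 * pi * \<i> * (\<Sum>p\<in>pts. residue f p)
      \<and> f contour_integrable_on linepath (Complex (real n) a) (Complex (real n) b)
      \<and> f contour_integrable_on linepath (Complex (- real n) b) (Complex (- real n) a)"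
    if n: "real n > max K 1" for n
  proof -
    let ?a1 = "Complex (- real n) a" and ?a2 = "Complex (real n) a"
      and ?a3 = "Complex (real n) b" and ?a4 = "Complex (- real n) b"
    have Re_p: "\<bar>Re p\<bar> < real n" if "p \<in> pts" for p
      using K[OF that] abs_Re_le_cmod[of p] n by linarith
    have img: "path_image (rectpath ?a1 ?a3) \<subseteq> S - pts"
      using n ab pts(2) Re_p by (fastforce simp: path_image_rectpath S_def)
    have eq: "rectpath ?a1 ?a3 = linepath ?a1 ?a2 +++ linepath ?a2 ?a3 +++ linepath ?a3 ?a4 +++ linepath ?a4 ?a1"
      by (simp add: rectpath_def Let_def)
    have segs: "closed_segment ?a1 ?a2 \<subseteq> S - pts" "closed_segment ?a2 ?a3 \<subseteq> S - pts"
        "closed_segment ?a3 ?a4 \<subseteq> S - pts" "closed_segment ?a4 ?a1 \<subseteq> S - pts"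
      using img unfolding eq by (simp_all add: path_image_join)
    note ci = segs[THEN cont]
    have "contour_integral (rectpath ?a1 ?a3) f =
        contour_integral (linepath ?a1 ?a2) f + (V1 n + (contour_integral (linepath ?a3 ?a4) f + V2 n))"
      unfolding eq V1_def V2_def using ci by (simp add: contour_integrable_join)
    also have "contour_integral (linepath ?a3 ?a4) f = - contour_integral (linepath ?a4 ?a3) f"
      using contour_integral_reversepath[of "linepath ?a4 ?a3" f] by simp
    also have "contour_integral (linepath ?a1 ?a2) f = Ha n"
      unfolding Ha_def using n by (intro contour_integral_linepath_same_Im) auto
    also have "contour_integral (linepath ?a4 ?a3) f = Hb n"
      unfolding Hb_def using n by (intro contour_integral_linepath_same_Im) auto
    finally have "contour_integral (rectpath ?a1 ?a3) f = Ha n + V1 n - Hb n + V2 n" by simp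
    moreover have "contour_integral (rectpath ?a1 ?a3) f =
        2 * pi * \<i> * (\<Sum>p\<in>pts. winding_number (rectpath ?a1 ?a3) p * residue f p)"
    proof (rule Residue_theorem[of S])
      show "\<forall>z. z \<notin> S \<longrightarrow> winding_number (rectpath ?a1 ?a3) z = 0"
        using n ab by (intro allI impI winding_number_rectpath_outside)
          (auto simp: S_def in_cbox_complex_iff)
    qed (use S pts holo img in \<open>auto simp: S_def[symmetric] convex_connected\<close>)
    moreover have "(\<Sum>p\<in>pts. winding_number (rectpath ?a1 ?a3) p * residue f p) = (\<Sum>p\<in>pts. residue f p)"
    proof (intro sum.cong refl)
      fix p assume p: "p \<in> pts"
      have "p \<in> box ?a1 ?a3"
        using Re_p[OF p] pts(2)[OF p] by (auto simp: in_box_complex_iff abs_if split: if_splits)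
      then show "winding_number (rectpath ?a1 ?a3) p * residue f p = residue f p"
        by (simp add: winding_number_rectpath)
    qed
    ultimately show ?thesis using ci by simp
  qed
  have decay': "\<forall>\<^sub>F n in sequentially. \<forall>y\<in>{a..b}. norm (f (Complex (real n) y)) \<le> B (real n) \<and>
      norm (f (Complex (- real n) y)) \<le> B (real n)"
    using eventually_compose_filterlim[OF decay filterlim_real_sequentially] .
  have BV: "\<forall>\<^sub>F n in sequentially. norm (V1 n) \<le> B (real n) * (b - a) \<and> norm (V2 n) \<le> B (real n) * (b - a)"
    using decay' big
  proof eventually_elim
    case (elim n)
    have B0: "B (real n) \<ge> 0"
      using order_trans[OF norm_ge_zero bspec[OF elim(1), of a, THEN conjunct1]] ab by simp
    have "norm (V1 n) \<le> B (real n) * norm (Complex (real n) b - Complex (real n) a)"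
      unfolding V1_def
    proof (intro contour_integral_bound_linepath B0)
      fix x assume "x \<in> closed_segment (Complex (real n) a) (Complex (real n) b)"
      then have "Re x = real n" and Im: "Im x \<in> {a..b}"
        using ab by (simp_all add: closed_segment_same_Re closed_segment_eq_real_ivl)
      then show "norm (f x) \<le> B (real n)"
        using bspec[OF elim(1) Im] by (cases x) simp
    qed (rule rect[OF elim(2), THEN conjunct2, THEN conjunct1])
    moreover have "norm (V2 n) \<le> B (real n) * norm (Complex (- real n) a - Complex (- real n) b)"
      unfolding V2_def
    proof (intro contour_integral_bound_linepath B0)
      fix x assume "x \<in> closed_segment (Complex (- real n) b) (Complex (- real n) a)"
      then have "Re x = - real n" and Im: "Im x \<in> {a..b}"
        using ab by (simp_all add: closed_segment_same_Re closed_segment_eq_real_ivl)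
      then show "norm (f x) \<le> B (real n)"
        using bspec[OF elim(1) Im] by (cases x) simp
    qed (rule rect[OF elim(2), THEN conjunct2, THEN conjunct2])
    moreover have "norm (Complex (real n) b - Complex (real n) a) = b - a"
      "norm (Complex (- real n) a - Complex (- real n) b) = b - a"
      using ab by (simp_all add: cmod_def)
    ultimately show ?case by simp
  qed
  have "(\<lambda>n. B (real n) * (b - a)) \<longlonglongrightarrow> 0"
    using filterlim_compose[OF B filterlim_real_sequentially] by (auto intro: tendsto_mult_left_zero)
  then have "V1 \<longlonglongrightarrow> 0" "V2 \<longlonglongrightarrow> 0"
    using BV by (auto intro: Lim_null_comparison elim: eventually_mono)
  then have "(\<lambda>n. Ha n + V1 n - Hb n + V2 n) \<longlonglongrightarrow> (LBINT u. f (Complex u a)) + 0 - (LBINT u. f (Complex u b)) + 0"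
    unfolding Ha_def Hb_def
    by (intro tendsto_intros integral_symmetric_interval_tendsto_lborel int_a int_b)
  moreover have "(\<lambda>n. Ha n + V1 n - Hb n + V2 n) \<longlonglongrightarrow> 2 * pi * \<i> * (\<Sum>p\<in>pts. residue f p)"
    by (intro tendsto_eventually eventually_mono[OF big]) (rule rect[THEN conjunct1])
  ultimately show ?thesis
    using LIMSEQ_unique by fastforce
qed

section \<open>The kernel and its residues\<close>

text \<open>
  Both \<open>exp w - 1\<close> and \<open>exp (-w) - 1\<close> are bounded below by their imaginary parts, and the two differ
  by the factor \<open>- exp w\<close>. On a line \<open>Im w = const\<close> off the multiples of \<open>\<pi>\<close> this controls \<open>1 / (exp w - 1)\<close> at both ends.
\<close>
lemma norm_exp_minus_one_ge_sin:
  fixes w :: complex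
  shows "\<bar>sin (Im w)\<bar> * max 1 (exp (Re w)) \<le> norm (exp w - 1)"
proof -
  have *: "exp (Re v) * \<bar>sin (Im v)\<bar> \<le> norm (exp v - 1)" for v :: complex
    using abs_Im_le_cmod[of "exp v - 1"] by (simp add: Im_exp abs_mult)
  have "\<bar>sin (Im w)\<bar> \<le> norm (exp w - 1)"
  proof -
    have "exp w - 1 = - exp w * (exp (- w) - 1)" by (simp add: algebra_simps flip: exp_add)
    then have "norm (exp w - 1) = exp (Re w) * norm (exp (- w) - 1)" by (simp add: norm_mult)
    moreover have "exp (Re w) * (exp (- Re w) * \<bar>sin (Im w)\<bar>) \<le> exp (Re w) * norm (exp (- w) - 1)"
      using *[of "- w"] by (intro mult_left_mono) auto
    moreover have "exp (Re w) * (exp (- Re w) * \<bar>sin (Im w)\<bar>) = \<bar>sin (Im w)\<bar>"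
      by (simp add: mult.assoc[symmetric] flip: exp_add)
    ultimately show ?thesis by simp
  qed
  then show ?thesis using *[of w] by (simp add: max_def mult.commute)
qed

text \<open>
  The bound of the same shape that is uniform in \<open>Im w\<close>, needed on the vertical sides of the rectangles.
\<close>
lemma norm_exp_minus_one_ge_half:
  fixes w :: complex
  assumes "\<bar>Re w\<bar> \<ge> 1"
  shows "1 / 2 * max 1 (exp (Re w)) \<le> norm (exp w - 1)"
proof (cases "Re w \<ge> 0")
  case True
  then have "exp (Re w) \<ge> 2" using assms exp_ge_add_one_self[of "Re w"] by linarith
  moreover have "norm (exp w - 1) \<ge> norm (exp w) - norm (1::complex)" by (rule norm_triangle_ineq2)
  ultimately show ?thesis by simp
next
  case False
  then have "exp (- Re w) \<ge> 2" using assms exp_ge_add_one_self[of "- Re w"] by linarith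
  then have "exp (Re w) \<le> 1 / 2" by (simp add: exp_minus field_simps)
  moreover have "norm (exp w - 1) \<ge> norm (1::complex) - norm (exp w)"
    using norm_triangle_ineq2[of 1 "exp w"] by (simp add: norm_minus_commute)
  ultimately show ?thesis by simp
qed

lemma exp_mult_eq_1_iff:
  assumes "k > 0"
  shows "exp (of_nat k * v) = 1 \<longleftrightarrow> (\<exists>l::int. v = 2 * of_real pi * \<i> * of_int l / of_nat k)"
proof -
  have "exp (of_nat k * v) = 1 \<longleftrightarrow> (\<exists>l::int. of_nat k * v = 2 * of_real pi * \<i> * of_int l)"
    unfolding exp_eq_1 by (auto simp: complex_eq_iff algebra_simps)
  also have "\<dots> \<longleftrightarrow> (\<exists>l::int. v = 2 * of_real pi * \<i> * of_int l / of_nat k)"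
    using assms by (auto simp: field_simps)
  finally show ?thesis .
qed

text \<open>
  For coprime \<open>m\<close> and \<open>n\<close> a primitive \<open>n\<close>-th root of unity; \<open>q\<^sub>+\<close> and \<open>q\<^sub>-\<close> arise as
  \<open>root_of_unity M N\<close> and \<open>root_of_unity N M\<close>.
\<close>
definition root_of_unity :: "nat \<Rightarrow> nat \<Rightarrow> complex" where
  "root_of_unity m n = exp (2 * of_real pi * \<i> * of_nat m / of_nat n)"

lemma root_of_unity_power: "root_of_unity m n ^ k = exp (of_nat m * (2 * of_real pi * \<i> * of_nat k / of_nat n))"
  unfolding root_of_unity_def by (simp add: mult_ac flip: exp_of_nat_mult)

lemma root_of_unity_power_eq_1_iff:
  assumes "coprime m n" "n > 0"
  shows "root_of_unity m n ^ k = 1 \<longleftrightarrow> n dvd k"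
proof
  assume "root_of_unity m n ^ k = 1"
  then obtain l :: int where "2 * pi * (of_nat m * of_nat k / of_nat n) = 2 * pi * of_int l"
    unfolding root_of_unity_power exp_eq_1 by (auto simp: mult_ac)
  then have "real m * real k / real n = of_int l" by (subst (asm) mult_cancel_left) auto
  then have "real_of_int (int m * int k) = real_of_int (l * int n)"
    using assms by (simp add: field_simps)
  then have "int m * int k = l * int n" by (simp only: of_int_eq_iff)
  then have "int n dvd int (m * k)" by simp
  then have "n dvd m * k" by (simp only: int_dvd_int_iff)
  then show "n dvd k" using assms by (simp add: coprime_commute coprime_dvd_mult_right_iff)
next
  assume "n dvd k"
  then obtain j where "k = n * j" ..
  then have "of_nat m * (2 * of_real pi * \<i> * of_nat k / of_nat n) = 2 * of_real pi * \<i> * of_int (int (m * j))"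
    using assms by simp
  then show "root_of_unity m n ^ k = 1"
    unfolding root_of_unity_power exp_eq_1 by (intro conjI exI[of _ "int (m * j)"]) simp_all
qed

text \<open>
  Isolates the simple zero of \<open>exp w - 1\<close> at the origin, with enough of the Taylor expansion of the
  cofactor to compute a residue at a double pole.
\<close>
lemma exp_minus_one_factor:
  obtains \<phi> :: "complex \<Rightarrow> complex" where "\<phi> holomorphic_on UNIV" "\<phi> 0 = 1" "deriv \<phi> 0 = 1 / 2"
    "\<And>w. exp w - 1 = w * \<phi> w"
proof -
  define \<phi> :: "complex \<Rightarrow> complex" where
    "\<phi> = (\<lambda>z. if z = 0 then deriv exp 0 else (exp z - exp 0) / (z - 0))"
  have holo: "\<phi> holomorphic_on UNIV"
    unfolding \<phi>_def by (rule pole_lemma) (auto intro: holomorphic_intros)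
  have \<phi>0: "\<phi> 0 = 1" using DERIV_imp_deriv[OF DERIV_exp, of 0] by (simp add: \<phi>_def)
  have eq: "exp w - 1 = w * \<phi> w" for w by (simp add: \<phi>_def)
  have D: "(\<phi> has_field_derivative deriv \<phi> w) (at w)" for w
    using holomorphic_derivI[OF holo open_UNIV] by auto
  have D2: "(deriv \<phi> has_field_derivative deriv (deriv \<phi>) w) (at w)" for w
    using holomorphic_derivI[OF holomorphic_deriv[OF holo open_UNIV] open_UNIV] by auto
  have exp_eq: "exp w = \<phi> w + w * deriv \<phi> w" for w
  proof -
    have "((\<lambda>w. w * \<phi> w) has_field_derivative \<phi> w + w * deriv \<phi> w) (at w)"
      by (auto intro!: derivative_eq_intros D)
    moreover have "((\<lambda>w. exp w - 1) has_field_derivative exp w) (at w)"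
      by (auto intro!: derivative_eq_intros)
    ultimately show ?thesis unfolding eq by (rule DERIV_unique[symmetric])
  qed
  have "((\<lambda>w. \<phi> w + w * deriv \<phi> w) has_field_derivative deriv \<phi> 0 + (deriv \<phi> 0 + 0 * deriv (deriv \<phi>) 0)) (at 0)"
    by (auto intro!: derivative_eq_intros D D2)
  moreover have "((\<lambda>w. \<phi> w + w * deriv \<phi> w) has_field_derivative exp 0) (at 0)"
    unfolding exp_eq[symmetric] by (rule DERIV_exp)
  ultimately have "deriv \<phi> 0 + (deriv \<phi> 0 + 0 * deriv (deriv \<phi>) 0) = exp 0"
    by (rule DERIV_unique)
  then have "deriv \<phi> 0 = 1 / 2" by (simp add: field_simps)
  with holo \<phi>0 eq show ?thesis using that by blast
qed

definition kern :: "nat \<Rightarrow> nat \<Rightarrow> complex \<Rightarrow> complex \<Rightarrow> complex" where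
  "kern M N z v = exp (- (\<i> * z * v) / (2 * of_real pi)) /
     ((exp (of_nat M * v) - 1) * (exp (of_nat N * v) - 1))"

definition kern_strip :: "nat \<Rightarrow> nat \<Rightarrow> complex set" where
  "kern_strip M N = {z. 0 < Im z \<and> Im z < 2 * pi * real (M + N)}"

text \<open>
  The exponential rate at which the kernel decays along horizontal lines; it is positive exactly when
  \<open>z\<close> lies in the strip where the integrals converge.
\<close>
definition kern_rate :: "nat \<Rightarrow> nat \<Rightarrow> complex \<Rightarrow> real" where
  "kern_rate M N z = min (Im z) (2 * pi * real (M + N) - Im z) / (2 * pi)"

lemma kern_rate_pos: "z \<in> kern_strip M N \<Longrightarrow> kern_rate M N z > 0"
  by (simp add: kern_strip_def kern_rate_def)

lemma kern_commute: "kern M N z v = kern N M z v"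
  by (simp add: kern_def mult.commute)

text \<open>
  The key property of the kernel: both denominators have period \<open>2\<pi>i\<close> in \<open>v\<close>, for the exponents \<open>M\<close>
  and \<open>N\<close> are integers.
\<close>
lemma kern_periodic: "kern M N z (v + 2 * of_real pi * \<i>) = exp z * kern M N z v"
proof -
  have "- (\<i> * z * (v + 2 * of_real pi * \<i>)) / (2 * of_real pi) = z + - (\<i> * z * v) / (2 * of_real pi)"
    by (simp add: field_simps)
  moreover have "exp (of_nat k * (v + 2 * of_real pi * \<i>)) = exp (of_nat k * v)" for k
    by (simp only: exp_of_nat_mult exp_add exp_two_pi_i mult_1_right)
  ultimately show ?thesis by (simp only: kern_def exp_add times_divide_eq_right)
qed

text \<open>
  The product of the two maxima is \<open>exp ((M + N) max 0 u)\<close> with \<open>u = Re v\<close>. For \<open>z\<close> in the strip it wins over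
  \<open>exp (Im z u / 2\<pi>)\<close> to the right, while to the left the latter decays by itself. The constants
  \<open>\<kappa>\<close> and \<open>\<mu>\<close> accommodate both kinds of lower bounds above.
\<close>
lemma norm_kern_le:
  assumes M: "\<kappa> * max 1 (exp (real M * Re v)) \<le> norm (exp (of_nat M * v) - 1)"
    and N: "\<mu> * max 1 (exp (real N * Re v)) \<le> norm (exp (of_nat N * v) - 1)"
    and pos: "\<kappa> > 0" "\<mu> > 0"
  shows "norm (kern M N z v) \<le> exp (Re z * Im v / (2 * pi)) / (\<kappa> * \<mu>) * exp (- kern_rate M N z * \<bar>Re v\<bar>)"
proof -
  define u where "u = Re v"
  have mx: "max 1 (exp (real k * u)) = exp (real k * max 0 u)" for k
  proof (cases "u \<ge> 0")
    case False
    then have "real k * u \<le> 0" by (simp add: mult_nonneg_nonpos)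
    then show ?thesis using False by (simp add: max_def)
  qed (simp add: max_def)
  have "norm (exp (- (\<i> * z * v) / (2 * of_real pi))) = exp (Re (- (\<i> * z * v) / (2 * of_real pi)))"
    by simp
  also have "Re (- (\<i> * z * v) / (2 * of_real pi)) = (Re z * Im v + Im z * u) / (2 * pi)"
  proof -
    have "2 * of_real pi = (of_real (2 * pi) :: complex)" by simp
    then show ?thesis by (simp only: Re_divide_of_real) (simp add: u_def)
  qed
  finally have nexp: "norm (exp (- (\<i> * z * v) / (2 * of_real pi))) = exp ((Re z * Im v + Im z * u) / (2 * pi))" .
  have "norm ((exp (of_nat M * v) - 1) * (exp (of_nat N * v) - 1)) \<ge>
      (\<kappa> * exp (real M * max 0 u)) * (\<mu> * exp (real N * max 0 u))"
    unfolding norm_mult using M N pos by (intro mult_mono) (auto simp: mx u_def[symmetric])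
  then have "norm ((exp (of_nat M * v) - 1) * (exp (of_nat N * v) - 1)) \<ge> \<kappa> * \<mu> * exp (real (M + N) * max 0 u)"
    by (simp add: exp_add ring_distribs mult_ac)
  moreover have "\<kappa> * \<mu> * exp (real (M + N) * max 0 u) > 0" using pos by simp
  ultimately have "norm (kern M N z v) \<le> exp ((Re z * Im v + Im z * u) / (2 * pi)) / (\<kappa> * \<mu> * exp (real (M + N) * max 0 u))"
    unfolding kern_def norm_divide nexp
    by (metis divide_left_mono exp_ge_zero less_le_trans mult_pos_pos)
  also have "\<dots> = exp (Re z * Im v / (2 * pi)) / (\<kappa> * \<mu>) * exp (Im z * u / (2 * pi) - real (M + N) * max 0 u)"
    by (simp add: add_divide_distrib exp_add exp_diff)
  also have "\<dots> \<le> exp (Re z * Im v / (2 * pi)) / (\<kappa> * \<mu>) * exp (- kern_rate M N z * \<bar>u\<bar>)"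
  proof (intro mult_left_mono)
    have "Im z * u / (2 * pi) - real (M + N) * max 0 u \<le> - kern_rate M N z * \<bar>u\<bar>"
    proof (cases "u \<ge> 0")
      case True
      have "kern_rate M N z \<le> (2 * pi * real (M + N) - Im z) / (2 * pi)"
        unfolding kern_rate_def by (intro divide_right_mono) auto
      also have "\<dots> = real (M + N) - Im z / (2 * pi)" by (simp add: field_simps)
      finally have "kern_rate M N z * u \<le> (real (M + N) - Im z / (2 * pi)) * u"
        using True by (rule mult_right_mono)
      then show ?thesis using True by (simp add: algebra_simps)
    next
      case False
      have "kern_rate M N z \<le> Im z / (2 * pi)"
        unfolding kern_rate_def by (intro divide_right_mono) auto
      then have "Im z / (2 * pi) * u \<le> kern_rate M N z * u"
        using False by (intro mult_right_mono_neg) auto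
      then show ?thesis using False by simp
    qed
    then show "exp (Im z * u / (2 * pi) - real (M + N) * max 0 u) \<le> exp (- kern_rate M N z * \<bar>u\<bar>)" by simp
  qed (use pos in auto)
  finally show ?thesis by (simp add: u_def)
qed

text \<open>
  At \<open>2\<pi>ik/N\<close> only the second denominator vanishes, because \<open>M\<close> and \<open>N\<close> are coprime.
\<close>
lemma residue_kern_simple:
  assumes "coprime M N" "N > 0" "\<not> N dvd k"
  shows "residue (kern M N z) (2 * of_real pi * \<i> * of_nat k / of_nat N) =
           exp (z * of_nat k / of_nat N) / (of_nat N * (root_of_unity M N ^ k - 1))"
proof -
  define p :: complex where "p = 2 * of_real pi * \<i> * of_nat k / of_nat N"
  have expM: "exp (of_nat M * p) = root_of_unity M N ^ k"
    unfolding p_def root_of_unity_power ..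
  have neq: "exp (of_nat M * p) \<noteq> 1"
    unfolding expM using root_of_unity_power_eq_1_iff assms by blast
  have expN: "exp (of_nat N * p) = 1"
    using exp_mult_eq_1_iff[OF assms(2), of p] by (auto simp: p_def intro!: exI[of _ "int k"])
  have "open {v. exp (of_nat M * v) \<noteq> (1::complex)}"
    by (intro open_Collect_neq continuous_intros)
  then obtain r where r: "r > 0" "ball p r \<subseteq> {v. exp (of_nat M * v) \<noteq> (1::complex)}"
    using neq unfolding open_contains_ball by blast
  define f where "f = (\<lambda>v. exp (- (\<i> * z * v) / (2 * of_real pi)) / (exp (of_nat M * v) - 1))"
  have "residue (\<lambda>w. f w / (exp (of_nat N * w) - 1)) p = f p / of_nat N"
  proof (rule residue_simple_pole_deriv[where s = "ball p r"])
    show "f holomorphic_on ball p r"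
      unfolding f_def using r by (intro holomorphic_intros) auto
    show "((\<lambda>w. exp (of_nat N * w) - 1) has_field_derivative of_nat N) (at p)"
      by (auto intro!: derivative_eq_intros simp: expN)
    show "f p \<noteq> 0" using neq by (simp add: f_def)
  qed (use r assms expN in \<open>auto intro!: holomorphic_intros\<close>)
  moreover have "- (\<i> * z * p) / (2 * of_real pi) = z * of_nat k / of_nat N"
    by (simp add: p_def field_simps)
  ultimately show ?thesis
    unfolding p_def[symmetric] kern_def f_def expM[symmetric]
    by (simp only: divide_divide_eq_left mult_ac)
qed

text \<open>
  By periodicity the residue is \<open>exp z\<close> times the one at \<open>0\<close>. There \<open>exp w - 1 = w (1 + w/2 + \<dots>)\<close> turns
  the kernel into \<open>P(v) / v\<^sup>2\<close>, whose residue is \<open>P'(0)\<close>.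
\<close>
lemma residue_kern_double:
  assumes "M > 0" "N > 0"
  shows "residue (kern M N z) (2 * of_real pi * \<i>) =
           exp z / (of_nat M * of_nat N) * (- (\<i> * z) / (2 * of_real pi) - of_nat (M + N) / 2)"
proof -
  obtain \<phi> :: "complex \<Rightarrow> complex" where \<phi>: "\<phi> holomorphic_on UNIV" "\<phi> 0 = 1" "deriv \<phi> 0 = 1 / 2"
    "\<And>w. exp w - 1 = w * \<phi> w"
    using exp_minus_one_factor by blast
  define P where "P = (\<lambda>v. exp z * exp (- (\<i> * z * v) / (2 * of_real pi)) /
      (of_nat M * of_nat N * (\<phi> (of_nat M * v) * \<phi> (of_nat N * v))))"
  define A where "A = {v. \<phi> (of_nat M * v) * \<phi> (of_nat N * v) \<noteq> 0}"
  have cont: "continuous_on UNIV \<phi>" using \<phi>(1) by (rule holomorphic_on_imp_continuous_on)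
  have h: "(\<lambda>v. \<phi> (of_nat k * v)) holomorphic_on S" for k S
    using holomorphic_on_compose_gen[OF _ \<phi>(1), of "\<lambda>v. of_nat k * v" S]
    by (auto simp: o_def intro: holomorphic_intros)
  have A: "open A"
    unfolding A_def
    by (intro open_Collect_neq continuous_on_mult continuous_on_const h[THEN holomorphic_on_imp_continuous_on])
  have A0: "0 \<in> A" by (simp add: A_def \<phi>(2))
  have P: "P holomorphic_on A"
    unfolding P_def by (intro holomorphic_intros h) (use assms in \<open>auto simp: A_def\<close>)
  have "residue (kern M N z) (2 * of_real pi * \<i>) = residue (\<lambda>v. kern M N z (2 * of_real pi * \<i> + v)) 0"
    by (rule residue_shift_0)
  also have "(\<lambda>v. kern M N z (2 * of_real pi * \<i> + v)) = (\<lambda>v. P v / v ^ Suc 1)"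
  proof
    fix v
    have "kern M N z (2 * of_real pi * \<i> + v) = exp z * kern M N z v"
      using kern_periodic[of M N z v] by (simp add: add.commute)
    then show "kern M N z (2 * of_real pi * \<i> + v) = P v / v ^ Suc 1"
      by (simp add: kern_def P_def \<phi>(4) mult_ac)
  qed
  also have "residue \<dots> 0 = (deriv ^^ 1) P 0 / fact 1"
    by (rule residue_holomorphic_over_power'[OF A A0 P])
  also have "\<dots> = deriv P 0" by simp
  also have "deriv P 0 = exp z / (of_nat M * of_nat N) * (- (\<i> * z) / (2 * of_real pi) - of_nat (M + N) / 2)"
  proof (rule DERIV_imp_deriv)
    have d\<phi>: "((\<lambda>v. \<phi> (of_nat k * v)) has_field_derivative of_nat k / 2) (at 0)" for k
    proof -
      have "(\<phi> has_field_derivative 1 / 2) (at (of_nat k * 0))"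
        using holomorphic_derivI[OF \<phi>(1) open_UNIV, of 0] \<phi>(3) by simp
      moreover have "((\<lambda>v. of_nat k * v) has_field_derivative of_nat k) (at (0::complex))"
        by (auto intro!: derivative_eq_intros)
      ultimately have "((\<lambda>v. \<phi> (of_nat k * v)) has_field_derivative 1 / 2 * of_nat k) (at 0)"
        by (rule DERIV_chain2[where f = \<phi>])
      then show ?thesis by simp
    qed
    show "(P has_field_derivative exp z / (of_nat M * of_nat N) *
        (- (\<i> * z) / (2 * of_real pi) - of_nat (M + N) / 2)) (at 0)"
    proof -
      have "((\<lambda>v. exp z * exp (- (\<i> * z * v) / (2 * of_real pi))) has_field_derivative
          exp z * (- (\<i> * z) / (2 * of_real pi))) (at 0)"
        by (auto intro!: derivative_eq_intros)
      moreover have "((\<lambda>v. of_nat M * of_nat N * (\<phi> (of_nat M * v) * \<phi> (of_nat N * v))) has_field_derivative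
          of_nat M * of_nat N * (of_nat (M + N) / 2)) (at 0)"
        using DERIV_cmult[OF DERIV_mult[OF d\<phi>[of M] d\<phi>[of N]], of "of_nat M * of_nat N"]
        by (simp add: \<phi>(2) add_divide_distrib add.commute)
      ultimately have D: "(P has_field_derivative
          (exp z * (- (\<i> * z) / (2 * of_real pi)) * (of_nat M * of_nat N * (\<phi> (of_nat M * 0) * \<phi> (of_nat N * 0)))
           - exp z * exp (- (\<i> * z * 0) / (2 * of_real pi)) * (of_nat M * of_nat N * (of_nat (M + N) / 2))) /
          ((of_nat M * of_nat N * (\<phi> (of_nat M * 0) * \<phi> (of_nat N * 0))) *
           (of_nat M * of_nat N * (\<phi> (of_nat M * 0) * \<phi> (of_nat N * 0))))) (at 0)"
        unfolding P_def by (rule DERIV_divide) (use assms \<phi>(2) in simp)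
      have alg: "(e * x * (c * (1 * 1)) - e * 1 * (c * y)) / ((c * (1 * 1)) * (c * (1 * 1))) = e / c * (x - y)"
        if "c \<noteq> 0" for e x y c :: complex
        using that by (simp add: field_simps)
      have nz: "of_nat M * of_nat N \<noteq> (0::complex)" using assms by simp
      show ?thesis
        using D by (simp only: mult_zero_right \<phi>(2) minus_zero div_0 exp_zero alg[OF nz])
    qed
  qed
  finally show ?thesis .
qed

section \<open>The integral and its logarithmic derivative\<close>

text \<open>
  The line \<open>Im v = d\<close> has to run between the real axis and the first poles of the kernel; the bounds are
  half as large as the distance to these poles, so that also the sines in \<open>line_denom_ge\<close> are positive
  and no pole lies between \<open>Im v = 2\<pi>\<close> and \<open>Im v = 2\<pi> + 2d\<close>.
\<close>
locale dilog_line =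
  fixes M N :: nat and d :: real
  assumes M_pos: "M > 0" and N_pos: "N > 0" and cop: "coprime M N"
    and d_pos: "d > 0" and Md: "real M * d < pi" and Nd: "real N * d < pi"
begin

lemma sin_pos: "sin (real M * d) > 0" "sin (real N * d) > 0"
  using M_pos N_pos d_pos Md Nd by (auto intro!: sin_gt_zero)

lemma line_denom_ge:
  assumes "k \<in> {M, N}"
  shows "sin (real k * d) * max 1 (exp (real k * u)) \<le> norm (exp (of_nat k * Complex u d) - 1)"
  using norm_exp_minus_one_ge_sin[of "of_nat k * Complex u d"] assms sin_pos by auto

lemma line_denom_nonzero:
  assumes "k \<in> {M, N}"
  shows "exp (of_nat k * Complex u d) \<noteq> 1"
proof -
  have "0 < sin (real k * d) * max 1 (exp (real k * u))"
    using sin_pos assms by (auto simp: less_max_iff_disj)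
  then show ?thesis using line_denom_ge[OF assms, of u] by auto
qed

lemma norm_kern_line_le:
  "norm (kern M N z (Complex u d)) \<le>
     exp (Re z * d / (2 * pi)) / (sin (real M * d) * sin (real N * d)) * exp (- kern_rate M N z * \<bar>u\<bar>)"
  using norm_kern_le[of "sin (real M * d)" M "Complex u d" "sin (real N * d)" N z] line_denom_ge sin_pos
  by simp

lemma continuous_on_kern_line: "continuous_on UNIV (\<lambda>u. kern M N z (Complex u d))"
  unfolding kern_def using line_denom_nonzero
  by (intro continuous_intros) (auto intro!: continuous_intros simp: Complex_eq)

lemma measurable_kern_line [measurable]: "(\<lambda>u. kern M N z (Complex u d)) \<in> borel_measurable borel"
  by (rule borel_measurable_continuous_onI[OF continuous_on_kern_line])

lemma integrable_kern_line:
  assumes "z \<in> kern_strip M N"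
  shows "integrable lborel (\<lambda>u. kern M N z (Complex u d))"
proof (rule Bochner_Integration.integrable_bound)
  show "integrable lborel (\<lambda>u. exp (Re z * d / (2 * pi)) / (sin (real M * d) * sin (real N * d)) *
      exp (- kern_rate M N z * \<bar>u\<bar>))"
    by (intro integrable_mult_right integrable_exp_minus_abs kern_rate_pos assms)
  show "AE u in lborel. norm (kern M N z (Complex u d)) \<le> norm (exp (Re z * d / (2 * pi)) /
      (sin (real M * d) * sin (real N * d)) * exp (- kern_rate M N z * \<bar>u\<bar>))"
    using sin_pos by (intro AE_I2 order_trans[OF norm_kern_line_le]) (simp add: abs_mult)
qed simp

text \<open>
  The exponent in Faddeev's formula as a function of \<open>z\<close>.
\<close>
definition log_phi :: "complex \<Rightarrow> complex" where
  "log_phi z = (LBINT u. kern M N z (Complex u d) / Complex u d)"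

lemma has_field_derivative_log_phi:
  assumes z: "z \<in> kern_strip M N"
  shows "(log_phi has_field_derivative (- \<i> / (2 * of_real pi)) * (LBINT u. kern M N z (Complex u d))) (at z)"
proof -
  define l where "l u = - (\<i> * Complex u d) / (2 * of_real pi)" for u
  define k where "k u = 1 / ((exp (of_nat M * Complex u d) - 1) * (exp (of_nat N * Complex u d) - 1) * Complex u d)" for u
  define c where "c = kern_rate M N z"
  have c: "c > 0" using kern_rate_pos[OF z] by (simp add: c_def)
  have kern_eq: "exp (w * l u) * k u = kern M N w (Complex u d) / Complex u d" for w u
    by (simp add: l_def k_def kern_def mult_ac)
  have nz: "Complex u d \<noteq> 0" for u using d_pos by (simp add: complex_eq_iff)
  have nd: "d \<le> norm (Complex u d)" "norm (Complex u d) \<le> \<bar>u\<bar> + d" for u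
    using abs_Im_le_cmod[of "Complex u d"] cmod_le[of "Complex u d"] d_pos by simp_all
  have "continuous_on UNIV l"
    unfolding l_def Complex_eq by (intro continuous_intros) auto
  then have [measurable]: "l \<in> borel_measurable borel"
    by (rule borel_measurable_continuous_onI)
  have "continuous_on UNIV k"
    unfolding k_def using line_denom_nonzero nz
    by (intro continuous_intros) (auto intro!: continuous_intros simp: Complex_eq)
  then have [measurable]: "k \<in> borel_measurable borel"
    by (rule borel_measurable_continuous_onI)
  have "((\<lambda>w. LBINT u. exp (w * l u) * k u) has_field_derivative
           (LBINT u. l u * (exp (z * l u) * k u))) (at z)"
  \<comment> \<open>As \<open>\<bar>l u\<bar> \<le> (\<bar>u\<bar> + d) / 2\<pi>\<close>, the weight \<open>exp (\<pi> c \<bar>l u\<bar>)\<close> uses up half of the decay rate \<open>c\<close>.\<close>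
  proof (rule has_field_derivative_exp_transform[where \<rho> = "pi * c"])
    define C where "C = exp (Re z * d / (2 * pi)) / (sin (real M * d) * sin (real N * d))"
    have C: "C \<ge> 0" using sin_pos by (simp add: C_def)
    show "integrable lborel (\<lambda>u. exp (pi * c * norm (l u)) * norm (exp (z * l u) * k u))"
    proof (rule Bochner_Integration.integrable_bound)
      show "integrable lborel (\<lambda>u. (exp (c * d / 2) * C / d) * exp (- (c / 2) * \<bar>u\<bar>))"
        using c by (intro integrable_mult_right integrable_exp_minus_abs) simp
      show "AE u in lborel. norm (exp (pi * c * norm (l u)) * norm (exp (z * l u) * k u)) \<le>
          norm ((exp (c * d / 2) * C / d) * exp (- (c / 2) * \<bar>u\<bar>))"
      proof (intro AE_I2)
        fix u
        have "pi * c * norm (l u) = c / 2 * norm (Complex u d)"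
          by (simp add: l_def norm_divide norm_mult)
        also have "\<dots> \<le> c / 2 * (\<bar>u\<bar> + d)"
          using nd c by (intro mult_left_mono) auto
        finally have 1: "exp (pi * c * norm (l u)) \<le> exp (c / 2 * (\<bar>u\<bar> + d))" by simp
        have "norm (exp (z * l u) * k u) \<le> C * exp (- c * \<bar>u\<bar>) / d"
          unfolding kern_eq norm_divide C_def c_def
          using norm_kern_line_le[of z u] nd(1)[of u] d_pos sin_pos by (intro frac_le) auto
        with 1 have "exp (pi * c * norm (l u)) * norm (exp (z * l u) * k u) \<le>
            exp (c / 2 * (\<bar>u\<bar> + d)) * (C * exp (- c * \<bar>u\<bar>) / d)"
          by (intro mult_mono) auto
        also have "\<dots> = (C / d) * exp (c / 2 * (\<bar>u\<bar> + d) + - c * \<bar>u\<bar>)"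
          by (simp only: exp_add) simp
        also have "c / 2 * (\<bar>u\<bar> + d) + - c * \<bar>u\<bar> = c * d / 2 + - (c / 2) * \<bar>u\<bar>"
          by (simp add: field_simps)
        also have "(C / d) * exp (c * d / 2 + - (c / 2) * \<bar>u\<bar>) = (exp (c * d / 2) * C / d) * exp (- (c / 2) * \<bar>u\<bar>)"
          by (simp only: exp_add) simp
        finally show "norm (exp (pi * c * norm (l u)) * norm (exp (z * l u) * k u)) \<le>
          norm ((exp (c * d / 2) * C / d) * exp (- (c / 2) * \<bar>u\<bar>))"
          using C d_pos by (simp add: abs_mult)
      qed
    qed simp
  qed (use c in auto)
  moreover have "l u * (kern M N z (Complex u d) / Complex u d) = (- \<i> / (2 * of_real pi)) * kern M N z (Complex u d)" for u
    using nz[of u] by (simp add: l_def)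
  ultimately show ?thesis
    unfolding kern_eq log_phi_def[abs_def] by simp
qed

text \<open>
  The factor \<open>exp (-i z v / 2\<pi>)\<close> contributes \<open>exp (x d / 2\<pi>)\<close> to the size of the integrand, uniformly on the line.
\<close>
lemma log_phi_tendsto_0:
  assumes "Complex 0 y \<in> kern_strip M N"
  shows "((\<lambda>x. log_phi (Complex x y)) \<longlongrightarrow> 0) at_bot"
proof -
  define c where "c = kern_rate M N (Complex 0 y)"
  have c: "c > 0" using kern_rate_pos[OF assms] by (simp add: c_def)
  define C where "C = (LBINT u. 1 / (sin (real M * d) * sin (real N * d)) * exp (- c * \<bar>u\<bar>) / d)"
  have "norm (log_phi (Complex x y)) \<le> exp (x * d / (2 * pi)) * C" for x
  proof -
    have x: "Complex x y \<in> kern_strip M N" "kern_rate M N (Complex x y) = c"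
      using assms by (auto simp: kern_strip_def kern_rate_def c_def)
    have "norm (log_phi (Complex x y)) \<le> (LBINT u. exp (x * d / (2 * pi)) *
        (1 / (sin (real M * d) * sin (real N * d)) * exp (- c * \<bar>u\<bar>) / d))"
      unfolding log_phi_def
    proof -
      have int: "integrable lborel (\<lambda>u. exp (x * d / (2 * pi)) *
        (1 / (sin (real M * d) * sin (real N * d)) * exp (- c * \<bar>u\<bar>) / d))"
        by (intro integrable_mult_right integrable_divide integrable_exp_minus_abs c)
      have bnd: "norm (kern M N (Complex x y) (Complex u d) / Complex u d) \<le> exp (x * d / (2 * pi)) *
        (1 / (sin (real M * d) * sin (real N * d)) * exp (- c * \<bar>u\<bar>) / d)" for u
      proof -
        have "norm (kern M N (Complex x y) (Complex u d) / Complex u d) \<le>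
           (exp (x * d / (2 * pi)) / (sin (real M * d) * sin (real N * d)) * exp (- c * \<bar>u\<bar>)) / d"
          unfolding norm_divide
          using norm_kern_line_le[of "Complex x y" u] abs_Im_le_cmod[of "Complex u d"] d_pos x sin_pos
          by (intro frac_le) auto
        then show ?thesis by simp
      qed
      have "(\<lambda>u. kern M N (Complex x y) (Complex u d) / Complex u d) \<in> borel_measurable lborel"
      proof -
        have "continuous_on UNIV (\<lambda>u. Complex u d)"
          unfolding Complex_eq by (intro continuous_intros)
        then have "(\<lambda>u. Complex u d) \<in> borel_measurable borel"
          by (rule borel_measurable_continuous_onI)
        then show ?thesis by simp
      qed
      then have "integrable lborel (\<lambda>u. kern M N (Complex x y) (Complex u d) / Complex u d)"
        by (rule Bochner_Integration.integrable_bound[OF int])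
           (unfold real_norm_def, intro AE_I2 order_trans[OF bnd abs_ge_self])
      then have "(LBINT u. norm (kern M N (Complex x y) (Complex u d) / Complex u d)) \<le>
          (LBINT u. exp (x * d / (2 * pi)) * (1 / (sin (real M * d) * sin (real N * d)) * exp (- c * \<bar>u\<bar>) / d))"
        by (intro integral_mono integrable_norm int bnd)
      then show "norm (LBINT u. kern M N (Complex x y) (Complex u d) / Complex u d) \<le> (LBINT u. exp (x * d / (2 * pi)) *
          (1 / (sin (real M * d) * sin (real N * d)) * exp (- c * \<bar>u\<bar>) / d))"
        by (rule order_trans[OF integral_norm_bound])
    qed
    then show ?thesis unfolding C_def integral_mult_right_zero .
  qed
  moreover have "((\<lambda>x. exp (x * d / (2 * pi)) * C) \<longlongrightarrow> 0) at_bot"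
  proof -
    have "filterlim (\<lambda>x. d / (2 * pi) * x) at_bot at_bot"
      using d_pos by (intro filterlim_tendsto_pos_mult_at_bot[OF tendsto_const] filterlim_ident) simp
    from filterlim_compose[OF exp_at_bot this]
    have "((\<lambda>x. exp (x * d / (2 * pi))) \<longlongrightarrow> 0) at_bot"
      by (simp add: mult.commute)
    then show ?thesis by (rule tendsto_mult_left_zero)
  qed
  ultimately show ?thesis
    by (rule Lim_null_comparison[OF always_eventually[OF allI]])
qed

end

text \<open>
  The sum of the residues of the kernel at its poles with imaginary part in \<open>{0<..2\<pi>}\<close>.
\<close>
definition dilog_residues :: "nat \<Rightarrow> nat \<Rightarrow> complex \<Rightarrow> complex" where
  "dilog_residues M N z =
     (\<Sum>k = 1..<N. exp (z * of_nat k / of_nat N) / (of_nat N * (root_of_unity M N ^ k - 1))) +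
     (\<Sum>k = 1..<M. exp (z * of_nat k / of_nat M) / (of_nat M * (root_of_unity N M ^ k - 1))) +
     exp z / (of_nat M * of_nat N) * (- (\<i> * z) / (2 * of_real pi) - of_nat (M + N) / 2)"

context dilog_line
begin

text \<open>
  The line \<open>Im v = d + 2\<pi>\<close> reproduces the integral over \<open>Im v = d\<close> up to the factor \<open>exp z\<close>, so the
  difference of the two, a sum of residues, determines the integral.
\<close>
lemma integral_kern_line:
  assumes z: "z \<in> kern_strip M N"
  shows "(1 - exp z) * (LBINT u. kern M N z (Complex u d)) = 2 * of_real pi * \<i> * dilog_residues M N z"
proof -
  define pA where "pA k = 2 * of_real pi * \<i> * of_nat k / of_nat N" for k :: nat
  define pB where "pB k = 2 * of_real pi * \<i> * of_nat k / of_nat M" for k :: nat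
  define A where "A = pA ` {1..<N}"
  define B where "B = pB ` {1..<M}"
  define P where "P = insert (2 * of_real pi * \<i>) (A \<union> B)"
  have ImA: "Im (pA k) = 2 * pi * (real k / real N)" for k by (simp add: pA_def Im_divide_of_nat)
  have ImB: "Im (pB k) = 2 * pi * (real k / real M)" for k by (simp add: pB_def Im_divide_of_nat)
  have small: "2 * d < 2 * pi / real M" "2 * d < 2 * pi / real N"
    using M_pos N_pos Md Nd by (simp_all add: field_simps)
  have node: "d < 2 * pi * (real k / real n) \<and> 2 * pi * (real k / real n) < 2 * pi"
    if "n \<in> {M, N}" "k \<in> {1..<n}" for k n
  proof
    have "d < 2 * pi / real n" using small d_pos that by auto
    also have "\<dots> \<le> 2 * pi * (real k / real n)"
      using that by (simp add: field_simps)
    finally show "d < 2 * pi * (real k / real n)" .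
    show "2 * pi * (real k / real n) < 2 * pi" using that by (simp add: field_simps)
  qed
  have zeros: "v = 2 * of_real pi * \<i> \<or> (\<exists>k\<in>{1..<n}. v = 2 * of_real pi * \<i> * of_nat k / of_nat n)"
    if ev: "exp (of_nat n * v) = 1" and "n \<in> {M, N}" "0 < Im v" "Im v < 2 * pi + 2 * d" for n v
  proof -
    have n: "n > 0" "2 * d < 2 * pi / real n" using that M_pos N_pos small by auto
    obtain l :: int where l: "v = 2 * of_real pi * \<i> * of_int l / of_nat n"
      using ev unfolding exp_mult_eq_1_iff[OF n(1)] by blast
    have Iml: "Im v = 2 * pi * (of_int l / real n)" by (simp add: l Im_divide_of_nat)
    have "l > 0" using that(3) n(1) by (simp add: Iml zero_less_mult_iff zero_less_divide_iff)
    have "2 * pi * (of_int l / real n) < 2 * pi * (1 + 1 / real n)"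
      using that(4) n(2) by (simp add: Iml ring_distribs)
    then have "of_int l / real n < 1 + 1 / real n" by (subst (asm) mult_less_cancel_left_pos) auto
    then have "of_int l < real n + 1" using n(1) by (simp add: field_simps)
    then have "l \<le> int n" by linarith
    obtain k where k: "l = int k" "k \<ge> 1" "k \<le> n"
      using \<open>l > 0\<close> \<open>l \<le> int n\<close> by (metis int_one_le_iff_zero_less nat_int of_nat_le_iff of_nat_1 zero_less_imp_eq_int)
    show ?thesis
    proof (cases "k = n")
      case True
      then show ?thesis using n(1) by (simp add: l k)
    next
      case False
      then show ?thesis using k by (intro disjI2 bexI[of _ k]) (auto simp: l)
    qed
  qed
  have rate: "kern_rate M N z > 0" by (rule kern_rate_pos[OF z])
  have shift: "kern M N z (Complex u (2 * pi + d)) = exp z * kern M N z (Complex u d)" for u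
  proof -
    have "Complex u (2 * pi + d) = Complex u d + 2 * of_real pi * \<i>" by (simp add: complex_eq_iff)
    then show ?thesis by (simp only: kern_periodic)
  qed
  have "(LBINT u. kern M N z (Complex u d)) - (LBINT u. kern M N z (Complex u (2 * pi + d))) =
      2 * pi * \<i> * (\<Sum>p\<in>P. residue (kern M N z) p)"
  proof (rule integral_line_shift_eq_sum_residues)
    show "0 < d" "d < 2 * pi + d" "2 * pi + d < 2 * pi + 2 * d"
      using d_pos by auto
    show "finite P" by (simp add: P_def A_def B_def)
    show "d < Im p \<and> Im p < 2 * pi + d" if "p \<in> P" for p
    proof -
      have "d < 2 * pi"
      proof -
        have "1 * d \<le> real M * d" using M_pos d_pos by (intro mult_right_mono) auto
        then show ?thesis using Md pi_gt_zero by linarith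
      qed
      then show ?thesis
        using that node d_pos by (fastforce simp: P_def A_def B_def ImA ImB)
    qed
    show "kern M N z holomorphic_on {v. 0 < Im v \<and> Im v < 2 * pi + 2 * d} - P"
      unfolding kern_def
    proof (intro holomorphic_intros)
      fix v assume v: "v \<in> {v. 0 < Im v \<and> Im v < 2 * pi + 2 * d} - P"
      then have "exp (of_nat M * v) \<noteq> 1" "exp (of_nat N * v) \<noteq> 1"
        using zeros[of M v] zeros[of N v] by (auto simp: P_def A_def B_def pA_def pB_def)
      then show "(exp (of_nat M * v) - 1) * (exp (of_nat N * v) - 1) \<noteq> 0" by simp
    qed auto
    show "integrable lborel (\<lambda>u. kern M N z (Complex u d))"
      by (rule integrable_kern_line[OF z])
    then show "integrable lborel (\<lambda>u. kern M N z (Complex u (2 * pi + d)))"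
      unfolding shift by (rule integrable_mult_right)
    define D where "D = exp (\<bar>Re z\<bar> * (2 * pi + d) / (2 * pi)) / (1 / 2 * (1 / 2))"
    show "((\<lambda>u. D * exp (- kern_rate M N z * u)) \<longlongrightarrow> 0) at_top"
    proof (rule tendsto_mult_right_zero)
      have "filterlim (\<lambda>u. - kern_rate M N z * u) at_bot at_top"
        using rate by (intro filterlim_tendsto_neg_mult_at_bot[OF tendsto_const] filterlim_ident) simp
      then show "((\<lambda>u. exp (- kern_rate M N z * u)) \<longlongrightarrow> 0) at_top"
        by (rule filterlim_compose[OF exp_at_bot])
    qed
    have vert: "norm (kern M N z v) \<le> D * exp (- kern_rate M N z * \<bar>Re v\<bar>)"
      if "\<bar>Re v\<bar> \<ge> 1" "Im v \<in> {d..2 * pi + d}" for v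
    proof -
      have half: "1 / 2 * max 1 (exp (real k * Re v)) \<le> norm (exp (of_nat k * v) - 1)" if "k > 0" for k
      proof -
        have "1 * 1 \<le> real k * \<bar>Re v\<bar>" using that \<open>\<bar>Re v\<bar> \<ge> 1\<close> by (intro mult_mono) auto
        then show ?thesis using norm_exp_minus_one_ge_half[of "of_nat k * v"] by (simp add: abs_mult)
      qed
      have "norm (kern M N z v) \<le> exp (Re z * Im v / (2 * pi)) / (1 / 2 * (1 / 2)) * exp (- kern_rate M N z * \<bar>Re v\<bar>)"
        by (rule norm_kern_le[OF half[OF M_pos] half[OF N_pos]]) auto
      also have "\<dots> \<le> D * exp (- kern_rate M N z * \<bar>Re v\<bar>)"
      proof -
        have "Re z * Im v \<le> \<bar>Re z\<bar> * (2 * pi + d)"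
          using that(2) d_pos by (intro mult_mono) auto
        then have "exp (Re z * Im v / (2 * pi)) \<le> exp (\<bar>Re z\<bar> * (2 * pi + d) / (2 * pi))"
          by (simp add: divide_right_mono)
        then show ?thesis unfolding D_def by (intro mult_right_mono divide_right_mono) auto
      qed
      finally show ?thesis .
    qed
    show "\<forall>\<^sub>F u in at_top. \<forall>y\<in>{d..2 * pi + d}.
        norm (kern M N z (Complex u y)) \<le> D * exp (- kern_rate M N z * u) \<and>
        norm (kern M N z (Complex (- u) y)) \<le> D * exp (- kern_rate M N z * u)"
      using eventually_ge_at_top[of "1::real"]
    proof eventually_elim
      case (elim u)
      then show ?case using vert[of "Complex u _"] vert[of "Complex (- u) _"] by auto
    qed
  qed
  also have "(\<Sum>p\<in>P. residue (kern M N z) p) = dilog_residues M N z"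
  proof -
    have inj: "inj_on pA {1..<N}" "inj_on pB {1..<M}"
      using M_pos N_pos by (auto simp: inj_on_def pA_def pB_def)
    have disj: "A \<inter> B = {}"
    proof -
      have False if "k \<in> {1..<N}" "l \<in> {1..<M}" "pA k = pB l" for k l
      proof -
        have "Im (pA k) = Im (pB l)" using that by simp
        then have "real k * real M = real l * real N"
          using M_pos N_pos by (simp add: ImA ImB field_simps)
        then have "real (k * M) = real (l * N)" by simp
        then have "k * M = l * N" by (simp only: of_nat_eq_iff)
        then have "N dvd k * M" by simp
        then have "N dvd k" using cop by (simp add: coprime_commute coprime_dvd_mult_left_iff)
        then show False using that by (auto dest: dvd_imp_le)
      qed
      then show ?thesis unfolding A_def B_def by blast
    qed
    have notin: "2 * of_real pi * \<i> \<notin> A \<union> B"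
    proof
      assume "2 * of_real pi * \<i> \<in> A \<union> B"
      then consider k where "k \<in> {1..<N}" "2 * of_real pi * \<i> = pA k" | k where "k \<in> {1..<M}" "2 * of_real pi * \<i> = pB k"
        by (auto simp: A_def B_def)
      then show False
      proof cases
        case 1
        have "Im (2 * of_real pi * \<i>) = 2 * pi * (real k / real N)"
          unfolding 1(2) by (rule ImA)
        with node[of N k] 1(1) show False by simp
      next
        case 2
        have "Im (2 * of_real pi * \<i>) = 2 * pi * (real k / real M)"
          unfolding 2(2) by (rule ImB)
        with node[of M k] 2(1) show False by simp
      qed
    qed
    have "(\<Sum>p\<in>P. residue (kern M N z) p) =
        residue (kern M N z) (2 * of_real pi * \<i>) + ((\<Sum>p\<in>A. residue (kern M N z) p) + (\<Sum>p\<in>B. residue (kern M N z) p))"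
      unfolding P_def using notin disj
      by (subst sum.insert) (auto simp: A_def B_def intro!: sum.union_disjoint)
    also have "(\<Sum>p\<in>A. residue (kern M N z) p) =
        (\<Sum>k = 1..<N. exp (z * of_nat k / of_nat N) / (of_nat N * (root_of_unity M N ^ k - 1)))"
      unfolding A_def sum.reindex[OF inj(1)] o_def pA_def
      using cop N_pos by (intro sum.cong refl residue_kern_simple) (auto dest: dvd_imp_le)
    also have "(\<Sum>p\<in>B. residue (kern M N z) p) =
        (\<Sum>k = 1..<M. exp (z * of_nat k / of_nat M) / (of_nat M * (root_of_unity N M ^ k - 1)))"
      unfolding B_def sum.reindex[OF inj(2)] o_def pB_def kern_commute[of M N, abs_def]
      using cop M_pos by (intro sum.cong refl residue_kern_simple) (auto simp: coprime_commute dest: dvd_imp_le)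
    finally show ?thesis
      unfolding dilog_residues_def using residue_kern_double[OF M_pos N_pos] by simp
  qed
  finally show ?thesis
    unfolding shift by (simp add: left_diff_distrib)
qed

lemma has_field_derivative_log_phi':
  assumes "z \<in> kern_strip M N" "exp z \<noteq> 1"
  shows "(log_phi has_field_derivative dilog_residues M N z / (1 - exp z)) (at z)"
proof -
  have "(LBINT u. kern M N z (Complex u d)) = 2 * of_real pi * \<i> * dilog_residues M N z / (1 - exp z)"
    using integral_kern_line[OF assms(1)] assms(2) by (simp add: field_simps)
  then have "- \<i> / (2 * of_real pi) * (LBINT u. kern M N z (Complex u d)) = dilog_residues M N z / (1 - exp z)"
    by simp
  then show ?thesis using has_field_derivative_log_phi[OF assms(1)] by simp
qed

end

section \<open>The elementary side on the left half-plane\<close>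

lemma sum_of_nat_times_power:
  fixes w :: complex
  assumes "w ^ N = 1" "w \<noteq> 1"
  shows "(\<Sum>k<N. of_nat k * w ^ k) = of_nat N / (w - 1)"
proof -
  have "(w - 1) * (\<Sum>k<n. of_nat k * w ^ k) = of_nat n * w ^ n - w * (\<Sum>k<n. w ^ k)" for n
    by (induction n) (simp_all add: algebra_simps)
  moreover have "(\<Sum>k<N. w ^ k) = 0"
    using assms by (simp add: geometric_sum)
  ultimately have "(w - 1) * (\<Sum>k<N. of_nat k * w ^ k) = of_nat N"
    using assms(1) by simp
  then show ?thesis using assms(2) by (simp add: field_simps)
qed

text \<open>
  The expansion in partial fractions which matches the logarithmic derivative of the cyclic
  dilogarithm, on the left, with the simple residues, on the right. Expand
  \<open>1 / (1 - w\<^sup>k y) = (\<Sum>j<N. (w\<^sup>k y)\<^sup>j) / (1 - y\<^sup>N)\<close> and exchange the sums; the inner sum \<open>\<Sum>k. k (w\<^sup>j)\<^sup>k\<close> is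
  \<open>N / (w\<^sup>j - 1)\<close>, except for the power \<open>y\<^sup>N\<close>, where it is \<open>N (N - 1) / 2\<close>.
\<close>
lemma sum_roots_partial_fractions:
  fixes w y :: complex
  assumes N: "N > 0" and w: "\<And>k. w ^ k = 1 \<longleftrightarrow> N dvd k" and y: "y ^ N \<noteq> 1"
  shows "(\<Sum>k = 1..<N. of_nat k * (w ^ k * y / (1 - w ^ k * y))) =
           (of_nat N * (\<Sum>k = 1..<N. y ^ k / (w ^ k - 1)) + of_nat N * (of_nat N - 1) / 2 * y ^ N) / (1 - y ^ N)"
proof -
  have wN: "w ^ N = 1" using w[of N] by simp
  have nz: "1 - y ^ N \<noteq> 0" using y by simp
  have geo: "w ^ k * y / (1 - w ^ k * y) = (\<Sum>j = 1..N. w ^ (k * j) * y ^ j) / (1 - y ^ N)" for k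
  proof -
    define x where "x = w ^ k * y"
    have xN: "x ^ N = y ^ N"
      by (simp add: x_def power_mult_distrib wN flip: power_mult) (simp add: mult.commute[of k] power_mult wN)
    then have "x \<noteq> 1" using y by auto
    have "(1 - x) * (\<Sum>j<N. x ^ j) = 1 - x ^ N"
      by (simp add: one_diff_power_eq)
    then have "x * (1 - y ^ N) = x * (\<Sum>j<N. x ^ j) * (1 - x)"
      unfolding xN[symmetric] by (metis mult.assoc mult.commute)
    then have "x / (1 - x) = x * (\<Sum>j<N. x ^ j) / (1 - y ^ N)"
      using nz \<open>x \<noteq> 1\<close> by (subst frac_eq_eq) auto
    also have "x * (\<Sum>j<N. x ^ j) = (\<Sum>j<N. x ^ Suc j)"
      by (simp add: sum_distrib_left)
    also have "\<dots> = (\<Sum>j = 1..N. x ^ j)"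
      by (rule sum.reindex_bij_witness[of _ "\<lambda>j. j - 1" Suc]) auto
    also have "\<dots> = (\<Sum>j = 1..N. w ^ (k * j) * y ^ j)"
      by (simp add: x_def power_mult_distrib power_mult)
    finally show ?thesis by (simp add: x_def)
  qed
  have gauss: "(\<Sum>k<N. of_nat k :: complex) = of_nat N * (of_nat N - 1) / 2"
    by (induction N) (simp_all add: field_simps)
  have "(\<Sum>k = 1..<N. of_nat k * (w ^ k * y / (1 - w ^ k * y))) =
        (\<Sum>k<N. of_nat k * (w ^ k * y / (1 - w ^ k * y)))"
    by (rule sum.mono_neutral_left) auto
  also have "\<dots> = (\<Sum>k<N. \<Sum>j = 1..N. of_nat k * (w ^ j) ^ k * y ^ j) / (1 - y ^ N)"
    unfolding geo by (simp add: sum_divide_distrib sum_distrib_left mult.assoc mult.commute[of _ "_::nat"] flip: power_mult)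
  also have "(\<Sum>k<N. \<Sum>j = 1..N. of_nat k * (w ^ j) ^ k * y ^ j) = (\<Sum>j = 1..N. (\<Sum>k<N. of_nat k * (w ^ j) ^ k) * y ^ j)"
    by (subst sum.swap) (simp add: sum_distrib_right)
  also have "{1..N} = insert N {1..<N}" using N by auto
  also have "(\<Sum>j\<in>insert N {1..<N}. (\<Sum>k<N. of_nat k * (w ^ j) ^ k) * y ^ j) =
      (\<Sum>k<N. of_nat k * (w ^ N) ^ k) * y ^ N + (\<Sum>j = 1..<N. (\<Sum>k<N. of_nat k * (w ^ j) ^ k) * y ^ j)"
    by simp
  also have "(\<Sum>j = 1..<N. (\<Sum>k<N. of_nat k * (w ^ j) ^ k) * y ^ j) = (\<Sum>j = 1..<N. of_nat N / (w ^ j - 1) * y ^ j)"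
  proof (intro sum.cong refl)
    fix j assume "j \<in> {1..<N}"
    then have "w ^ j \<noteq> 1" using w[of j] by (auto dest: dvd_imp_le)
    moreover have "(w ^ j) ^ N = 1" by (metis power_mult mult.commute wN power_one)
    ultimately show "(\<Sum>k<N. of_nat k * (w ^ j) ^ k) * y ^ j = of_nat N / (w ^ j - 1) * y ^ j"
      by (simp add: sum_of_nat_times_power)
  qed
  finally show ?thesis by (simp add: wN gauss sum_distrib_left)
qed

lemma has_field_derivative_Li2:
  assumes y: "norm y < 1"
  shows "(Li2 has_field_derivative (\<Sum>n. y ^ n / of_nat (Suc n))) (at y)"
proof -
  define c :: "nat \<Rightarrow> complex" where "c n = 1 / of_nat n ^ 2" for n
  have summ: "summable (\<lambda>n. c n * K ^ n)" if "norm K < 1" for K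
  proof (rule summable_comparison_test')
    show "summable (\<lambda>n. norm K ^ n)" using that by (simp add: summable_geometric)
    show "norm (c n * K ^ n) \<le> norm K ^ n" if "n \<ge> 0" for n
    proof -
      have "norm (c n) \<le> 1"
        by (cases "n = 0") (auto simp: c_def norm_divide norm_power divide_le_eq_1)
      then show ?thesis by (simp add: norm_mult norm_power mult_left_le_one_le)
    qed
  qed
  obtain r where r: "norm y < r" "r < 1" using y dense by blast
  have eq: "(\<Sum>n. c n * x ^ n) = Li2 x" if "norm x < 1" for x
  proof -
    have "Li2 x = (\<Sum>n. c (Suc n) * x ^ Suc n)" by (simp add: Li2_def c_def)
    also have "\<dots> = (\<Sum>n. c n * x ^ n) - c 0 * x ^ 0" by (rule suminf_split_head[OF summ[OF that]])
    finally show ?thesis by (simp add: c_def)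
  qed
  have "((\<lambda>x. \<Sum>n. c n * x ^ n) has_field_derivative (\<Sum>n. diffs c n * y ^ n)) (at y)"
    by (rule termdiffs_strong[where K = "of_real r"]) (use r summ[of "of_real r"] norm_ge_zero[of y] in auto)
  moreover have "diffs c n * y ^ n = y ^ n / of_nat (Suc n)" for n
    by (simp add: diffs_def c_def power2_eq_square del: of_nat_Suc)
  ultimately have "((\<lambda>x. \<Sum>n. c n * x ^ n) has_field_derivative (\<Sum>n. y ^ n / of_nat (Suc n))) (at y)"
    by simp
  then show ?thesis
    by (rule has_field_derivative_transform_within_open[of _ _ _ "ball 0 1"]) (use y eq in auto)
qed

text \<open>
  Differentiating the power series termwise yields the series of \<open>- log (1 - y) / y\<close>.
\<close>
lemma has_field_derivative_Li2_exp:
  assumes z: "Re z < 0"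
  shows "((\<lambda>z. Li2 (exp z)) has_field_derivative - Ln (1 - exp z)) (at z)"
proof -
  define y where "y = exp z"
  have y: "norm y < 1" "y \<noteq> 0" using z by (simp_all add: y_def)
  have "(\<lambda>n. - (y ^ n) / of_nat n) sums Ln (1 - y)"
    using Ln_series'[of "- y"] y by simp
  then have "(\<lambda>n. - (y ^ Suc n) / of_nat (Suc n)) sums Ln (1 - y)"
    by (subst sums_Suc_iff) simp
  then have "(\<lambda>n. - (1 / y) * (- (y ^ Suc n) / of_nat (Suc n))) sums (- (1 / y) * Ln (1 - y))"
    by (rule sums_mult)
  moreover have "- (1 / y) * (- (y ^ Suc n) / of_nat (Suc n)) = y ^ n / of_nat (Suc n)" for n
    using y(2) by simp
  ultimately have "(\<lambda>n. y ^ n / of_nat (Suc n)) sums (- (1 / y) * Ln (1 - y))"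
    by (simp only:)
  then have "(\<Sum>n. y ^ n / of_nat (Suc n)) = - (1 / y) * Ln (1 - y)"
    by (rule sums_unique[symmetric])
  then have "(Li2 has_field_derivative - (1 / y) * Ln (1 - y)) (at (exp z))"
    using has_field_derivative_Li2[OF y(1)] by (simp add: y_def)
  from DERIV_chain2[OF this DERIV_exp] y(2) show ?thesis by (simp add: y_def)
qed

lemma norm_root_of_unity_power: "norm (root_of_unity M N ^ k) = 1"
proof -
  have "2 * of_real pi * \<i> * of_nat M / of_nat N = \<i> * of_real (2 * pi * real M / real N)"
    by simp
  then show ?thesis unfolding root_of_unity_def norm_power by (metis norm_exp_i_times power_one)
qed

lemma norm_exp_divide_less_1: "Re z < 0 \<Longrightarrow> N > 0 \<Longrightarrow> norm (exp (z / of_nat N)) < 1"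
  by (simp add: divide_neg_pos)

lemma one_minus_notin_nonpos_Reals: "norm w < 1 \<Longrightarrow> 1 - w \<notin> \<real>\<^sub>\<le>\<^sub>0" for w :: complex
  using abs_Re_le_cmod[of w] by (auto simp: complex_nonpos_Reals_iff)

text \<open>
  The logarithm of \<open>D\<^sub>N (exp (z/N))\<close>, with principal branches of the factors.
\<close>
definition cyclic_log :: "nat \<Rightarrow> nat \<Rightarrow> complex \<Rightarrow> complex" where
  "cyclic_log M N z =
     (\<Sum>k = 1..<N. of_nat k / of_nat N * Ln (1 - root_of_unity M N ^ k * exp (z / of_nat N)))"

text \<open>
  The logarithm of the right-hand side for \<open>Re z < 0\<close>, where all branches are principal.
\<close>
definition principal_log :: "nat \<Rightarrow> nat \<Rightarrow> complex \<Rightarrow> complex" where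
  "principal_log M N z =
     \<i> / (2 * of_real pi * (of_nat M * of_nat N)) * Li2 (exp z) +
     (1 + \<i> * z / (2 * of_real pi * (of_nat M * of_nat N))) * Ln (1 - exp z) -
     cyclic_log M N z - cyclic_log N M z"

lemma has_field_derivative_cyclic_log:
  assumes "coprime M N" "N > 0" "Re z < 0"
  shows "(cyclic_log M N has_field_derivative
           - ((\<Sum>k = 1..<N. exp (z * of_nat k / of_nat N) / (of_nat N * (root_of_unity M N ^ k - 1))) +
             (of_nat N - 1) / (2 * of_nat N) * exp z) / (1 - exp z)) (at z)"
proof -
  define w where "w = root_of_unity M N"
  define y where "y = exp (z / of_nat N)"
  have y: "norm y < 1" unfolding y_def by (rule norm_exp_divide_less_1[OF assms(3,2)])
  have yN: "y ^ k = exp (z * of_nat k / of_nat N)" for k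
    by (simp add: y_def mult_ac flip: exp_of_nat_mult)
  have yN': "y ^ N = exp z" using assms(2) by (simp add: yN)
  have "norm (w ^ k * y) < 1" for k
    using y norm_root_of_unity_power[of M N k] by (simp add: w_def norm_mult)
  then have np: "1 - w ^ k * y \<notin> \<real>\<^sub>\<le>\<^sub>0" for k by (rule one_minus_notin_nonpos_Reals)
  have "(cyclic_log M N has_field_derivative
      (\<Sum>k = 1..<N. of_nat k / of_nat N * (- (w ^ k * (y / of_nat N)) / (1 - w ^ k * y)))) (at z)"
    unfolding cyclic_log_def[abs_def] w_def[symmetric]
  proof (intro DERIV_sum DERIV_cmult)
    fix k
    have "((\<lambda>z. 1 - w ^ k * exp (z / of_nat N)) has_field_derivative - (w ^ k * (y / of_nat N))) (at z)"
      using assms(2) by (auto intro!: derivative_eq_intros simp: y_def)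
    moreover have "(Ln has_field_derivative inverse (1 - w ^ k * exp (z / of_nat N))) (at (1 - w ^ k * exp (z / of_nat N)))"
      using np[of k] by (intro has_field_derivative_Ln) (simp add: y_def)
    ultimately have "((\<lambda>z. Ln (1 - w ^ k * exp (z / of_nat N))) has_field_derivative
        inverse (1 - w ^ k * exp (z / of_nat N)) * - (w ^ k * (y / of_nat N))) (at z)"
      by (rule DERIV_chain2[rotated])
    then show "((\<lambda>z. Ln (1 - w ^ k * exp (z / of_nat N))) has_field_derivative
        - (w ^ k * (y / of_nat N)) / (1 - w ^ k * y)) (at z)"
      by (simp add: y_def field_simps)
  qed
  also have "(\<Sum>k = 1..<N. of_nat k / of_nat N * (- (w ^ k * (y / of_nat N)) / (1 - w ^ k * y))) =
      - (1 / of_nat N ^ 2) * (\<Sum>k = 1..<N. of_nat k * (w ^ k * y / (1 - w ^ k * y)))"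
    unfolding sum_distrib_left by (intro sum.cong refl) (simp add: power2_eq_square)
  also have "(\<Sum>k = 1..<N. of_nat k * (w ^ k * y / (1 - w ^ k * y))) =
      (of_nat N * (\<Sum>k = 1..<N. y ^ k / (w ^ k - 1)) + of_nat N * (of_nat N - 1) / 2 * y ^ N) / (1 - y ^ N)"
  proof (rule sum_roots_partial_fractions)
    show "w ^ k = 1 \<longleftrightarrow> N dvd k" for k
      unfolding w_def using assms by (intro root_of_unity_power_eq_1_iff) auto
    show "y ^ N \<noteq> 1" unfolding yN' using assms(3) by (metis norm_exp_eq_Re norm_one exp_less_one_iff less_irrefl)
  qed (use assms in auto)
  also have "- (1 / of_nat N ^ 2) * ((of_nat N * (\<Sum>k = 1..<N. y ^ k / (w ^ k - 1)) +
        of_nat N * (of_nat N - 1) / 2 * y ^ N) / (1 - y ^ N)) =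
      - ((1 / of_nat N) * (\<Sum>k = 1..<N. y ^ k / (w ^ k - 1)) + (of_nat N - 1) / (2 * of_nat N) * y ^ N) / (1 - y ^ N)"
  proof -
    have "(1 / n ^ 2) * (n * a + n * (n - 1) / 2 * b) = (1 / n) * a + (n - 1) / (2 * n) * b"
      if "n \<noteq> 0" for n a b :: complex
      using that by (simp add: field_simps power2_eq_square)
    then have eq: "(1 / of_nat N ^ 2) * (of_nat N * a + of_nat N * (of_nat N - 1) / 2 * b) =
        (1 / of_nat N) * a + (of_nat N - 1) / (2 * of_nat N) * b" for a b :: complex
      using assms(2) by simp
    show ?thesis
      unfolding eq[symmetric] by simp
  qed
  also have "(1 / of_nat N) * (\<Sum>k = 1..<N. y ^ k / (w ^ k - 1)) =
      (\<Sum>k = 1..<N. exp (z * of_nat k / of_nat N) / (of_nat N * (root_of_unity M N ^ k - 1)))"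
    by (simp add: sum_distrib_left yN w_def)
  finally show ?thesis by (simp add: yN')
qed

lemma exp_neq_1_of_Re_neg: "Re z < 0 \<Longrightarrow> exp z \<noteq> 1"
  by (metis norm_exp_eq_Re norm_one exp_less_one_iff less_irrefl)

text \<open>
  The derivative of \<open>c Li\<^sub>2 (exp z)\<close> cancels against that of the exponent \<open>1 + c z\<close>, so no logarithm
  survives. The contributions \<open>(N - 1) / 2N\<close> and \<open>(M - 1) / 2M\<close> of the cyclic dilogarithms combine with
  \<open>-1\<close> to \<open>-(M + N) / 2MN\<close>, the constant part of the double residue.
\<close>
lemma has_field_derivative_principal_log:
  assumes "coprime M N" "M > 0" "N > 0" "Re z < 0"
  shows "(principal_log M N has_field_derivative dilog_residues M N z / (1 - exp z)) (at z)"
proof -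
  define c where "c = \<i> / (2 * of_real pi * (of_nat M * of_nat N))"
  define SN where "SN = (\<Sum>k = 1..<N. exp (z * of_nat k / of_nat N) / (of_nat N * (root_of_unity M N ^ k - 1)))"
  define SM where "SM = (\<Sum>k = 1..<M. exp (z * of_nat k / of_nat M) / (of_nat M * (root_of_unity N M ^ k - 1)))"
  define L where "L = Ln (1 - exp z)"
  have nz: "1 - exp z \<noteq> 0" using exp_neq_1_of_Re_neg[OF assms(4)] by simp
  have "1 - exp z \<notin> \<real>\<^sub>\<le>\<^sub>0" using assms(4) by (intro one_minus_notin_nonpos_Reals) simp
  then have "((\<lambda>z. Ln (1 - exp z)) has_field_derivative - exp z / (1 - exp z)) (at z)"
    by (auto intro!: derivative_eq_intros simp: field_simps)
  moreover have "((\<lambda>z. 1 + c * z) has_field_derivative c) (at z)"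
    by (auto intro!: derivative_eq_intros)
  ultimately have d1: "((\<lambda>z. (1 + c * z) * Ln (1 - exp z)) has_field_derivative
      c * L + - exp z / (1 - exp z) * (1 + c * z)) (at z)"
    unfolding L_def by (rule DERIV_mult[rotated])
  have d2: "((\<lambda>z. c * Li2 (exp z)) has_field_derivative c * - L) (at z)"
    unfolding L_def by (intro DERIV_cmult has_field_derivative_Li2_exp assms)
  have dN: "(cyclic_log M N has_field_derivative - (SN + (of_nat N - 1) / (2 * of_nat N) * exp z) / (1 - exp z)) (at z)"
    unfolding SN_def using assms by (intro has_field_derivative_cyclic_log)
  have dM: "(cyclic_log N M has_field_derivative - (SM + (of_nat M - 1) / (2 * of_nat M) * exp z) / (1 - exp z)) (at z)"
    unfolding SM_def using assms by (intro has_field_derivative_cyclic_log) (auto simp: coprime_commute)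
  have "((\<lambda>z. c * Li2 (exp z) + (1 + c * z) * Ln (1 - exp z) - cyclic_log M N z - cyclic_log N M z) has_field_derivative
      c * - L + (c * L + - exp z / (1 - exp z) * (1 + c * z))
      - - (SN + (of_nat N - 1) / (2 * of_nat N) * exp z) / (1 - exp z)
      - - (SM + (of_nat M - 1) / (2 * of_nat M) * exp z) / (1 - exp z)) (at z)"
    by (intro DERIV_diff DERIV_add d1 d2 dN dM)
  also have "c * - L + (c * L + - exp z / (1 - exp z) * (1 + c * z))
      - - (SN + (of_nat N - 1) / (2 * of_nat N) * exp z) / (1 - exp z)
      - - (SM + (of_nat M - 1) / (2 * of_nat M) * exp z) / (1 - exp z) =
      (SN + SM + exp z * ((of_nat N - 1) / (2 * of_nat N) + (of_nat M - 1) / (2 * of_nat M) - 1 - c * z)) / (1 - exp z)"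
    using nz by (simp add: add_divide_distrib diff_divide_distrib ring_distribs)
  also have "exp z * ((of_nat N - 1) / (2 * of_nat N) + (of_nat M - 1) / (2 * of_nat M) - 1 - c * z) =
      exp z / (of_nat M * of_nat N) * (- (\<i> * z) / (2 * of_real pi) - of_nat (M + N) / 2)"
    using assms(2,3) by (simp add: c_def field_simps)
  also have "SN + SM + exp z / (of_nat M * of_nat N) * (- (\<i> * z) / (2 * of_real pi) - of_nat (M + N) / 2) =
      dilog_residues M N z"
    by (simp add: dilog_residues_def SN_def SM_def)
  finally show ?thesis
    unfolding principal_log_def[abs_def] c_def by simp
qed

lemma exp_left_half_plane_tendsto_0: "N > 0 \<Longrightarrow> ((\<lambda>x. exp (Complex x y / of_nat N)) \<longlongrightarrow> 0) at_bot"
proof (rule tendsto_norm_zero_cancel)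
  assume "N > 0"
  then have "filterlim (\<lambda>x. 1 / real N * x) at_bot at_bot"
    by (intro filterlim_tendsto_pos_mult_at_bot[OF tendsto_const] filterlim_ident) simp
  from filterlim_compose[OF exp_at_bot this]
  show "((\<lambda>x. norm (exp (Complex x y / of_nat N))) \<longlongrightarrow> 0) at_bot" by simp
qed

lemma cyclic_log_tendsto_0:
  assumes "N > 0"
  shows "((\<lambda>x. cyclic_log M N (Complex x y)) \<longlongrightarrow> 0) at_bot"
  unfolding cyclic_log_def
proof (rule tendsto_null_sum)
  fix k
  have "((\<lambda>x. 1 - root_of_unity M N ^ k * exp (Complex x y / of_nat N)) \<longlongrightarrow> 1 - root_of_unity M N ^ k * 0) at_bot"
    by (intro tendsto_intros exp_left_half_plane_tendsto_0 assms)
  then have "((\<lambda>x. Ln (1 - root_of_unity M N ^ k * exp (Complex x y / of_nat N))) \<longlongrightarrow> Ln 1) at_bot"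
    by (intro tendsto_Ln) auto
  then show "((\<lambda>x. of_nat k / of_nat N * Ln (1 - root_of_unity M N ^ k * exp (Complex x y / of_nat N))) \<longlongrightarrow> 0) at_bot"
    by (intro tendsto_mult_right_zero) simp
qed

lemma principal_log_tendsto_0:
  assumes "M > 0" "N > 0"
  shows "((\<lambda>x. principal_log M N (Complex x y)) \<longlongrightarrow> 0) at_bot"
proof -
  define c where "c = \<i> / (2 * of_real pi * (of_nat M * of_nat N))"
  have e0: "((\<lambda>x. exp (Complex x y)) \<longlongrightarrow> 0) at_bot"
    using exp_left_half_plane_tendsto_0[of 1 y] by simp
  have "isCont Li2 0"
    using has_field_derivative_Li2[of 0] by (auto intro: DERIV_isCont)
  moreover have "Li2 0 = 0" by (simp add: Li2_def)
  ultimately have Li: "((\<lambda>x. Li2 (exp (Complex x y))) \<longlongrightarrow> 0) at_bot"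
    using isCont_tendsto_compose[OF _ e0, of Li2] by simp
  have "((\<lambda>x. Ln (1 - exp (Complex x y))) \<longlongrightarrow> Ln (1 - 0)) at_bot"
    by (intro tendsto_Ln tendsto_intros e0) auto
  then have Ln0: "((\<lambda>x. Ln (1 - exp (Complex x y))) \<longlongrightarrow> 0) at_bot" by simp
  have zLn: "((\<lambda>x. Complex x y * Ln (1 - exp (Complex x y))) \<longlongrightarrow> 0) at_bot"
  proof (rule Lim_null_comparison)
    show "((\<lambda>x. (\<bar>x\<bar> + \<bar>y\<bar>) * (2 * exp x)) \<longlongrightarrow> 0) at_bot" by real_asymp
    have "\<forall>\<^sub>F x::real in at_bot. x \<le> - 2" by (rule eventually_le_at_bot)
    then show "\<forall>\<^sub>F x in at_bot. norm (Complex x y * Ln (1 - exp (Complex x y))) \<le> (\<bar>x\<bar> + \<bar>y\<bar>) * (2 * exp x)"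
    proof eventually_elim
      case (elim x)
      have "exp (- x) \<ge> 3" using exp_ge_add_one_self[of "- x"] elim by linarith
      then have "exp x < 1 / 2" by (simp add: exp_minus field_simps)
      then have "norm (Ln (1 + - exp (Complex x y))) \<le> 2 * norm (- exp (Complex x y))"
        by (intro norm_Ln_le) simp
      then have "norm (Ln (1 - exp (Complex x y))) \<le> 2 * exp x" by simp
      moreover have "norm (Complex x y) \<le> \<bar>x\<bar> + \<bar>y\<bar>"
        using cmod_le[of "Complex x y"] by simp
      ultimately show ?case
        unfolding norm_mult by (intro mult_mono) auto
    qed
  qed
  have "((\<lambda>x. c * Li2 (exp (Complex x y)) + (Ln (1 - exp (Complex x y)) + c * (Complex x y * Ln (1 - exp (Complex x y)))) -
     cyclic_log M N (Complex x y) - cyclic_log N M (Complex x y)) \<longlongrightarrow> c * 0 + (0 + c * 0) - 0 - 0) at_bot"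
    by (intro tendsto_intros Li Ln0 zLn cyclic_log_tendsto_0 assms)
  then show ?thesis
    by (simp add: principal_log_def c_def ring_distribs mult.assoc)
qed

section \<open>Functional equation and meromorphic continuation\<close>

text \<open>
  Under the shift by \<open>2\<pi>iM\<close> the residue at \<open>2\<pi>ik/N\<close> is multiplied by \<open>q\<^sub>+\<^sup>k\<close>, which cancels its denominator
  \<open>q\<^sub>+\<^sup>k - 1\<close> in the difference. A geometric sum remains, and it is the derivative of
  \<open>- log (1 - exp (z/N))\<close>. The constant is found at \<open>Re z = -\<infinity>\<close>.
\<close>
lemma principal_log_shift:
  assumes "coprime M N" "M > 0" "N > 0" and z: "Re z < 0"
  shows "principal_log M N (z + 2 * of_real pi * \<i> * of_nat M) + Ln (1 - exp (z / of_nat N)) = principal_log M N z"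
proof -
  define s where "s = 2 * of_real pi * \<i> * of_nat M"
  define D where "D = (\<lambda>z. principal_log M N (z + s) + Ln (1 - exp (z / of_nat N)) - principal_log M N z)"
  define T where "T = {z. Re z < 0}"
  have Re_s: "Re s = 0" by (simp add: s_def)
  have exps: "exp (w + s) = exp w" for w
    by (simp add: exp_add s_def mult.commute[of _ "of_nat M"] exp_of_nat_mult)
  have "(D has_field_derivative 0) (at z)" if "Re z < 0" for z
  proof -
    define y where "y = exp (z / of_nat N)"
    have y: "norm y < 1" unfolding y_def by (rule norm_exp_divide_less_1[OF that assms(3)])
    have yk: "y ^ k = exp (z * of_nat k / of_nat N)" for k
      by (simp add: y_def mult_ac flip: exp_of_nat_mult)
    have yN: "y ^ N = exp z" using assms(3) by (simp add: yk)
    have "y \<noteq> 1" using y by auto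
    have nz: "1 - exp z \<noteq> 0" using exp_neq_1_of_Re_neg[OF that] by simp
    define R where "R w = dilog_residues M N w" for w
    have "(principal_log M N has_field_derivative R (z + s) / (1 - exp z)) (at (z + s))"
      using has_field_derivative_principal_log[OF assms(1-3), of "z + s"] that
      by (simp add: Re_s exps R_def)
    then have d1: "((\<lambda>z. principal_log M N (z + s)) has_field_derivative R (z + s) / (1 - exp z)) (at z)"
      by (simp add: DERIV_shift)
    have d2: "(principal_log M N has_field_derivative R z / (1 - exp z)) (at z)"
      unfolding R_def by (rule has_field_derivative_principal_log[OF assms(1-3) that])
    have "1 - exp (z / of_nat N) \<notin> \<real>\<^sub>\<le>\<^sub>0"
      using y by (intro one_minus_notin_nonpos_Reals) (simp add: y_def)
    then have d3: "((\<lambda>z. Ln (1 - exp (z / of_nat N))) has_field_derivative - (y / of_nat N) / (1 - y)) (at z)"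
      using assms(3) by (auto intro!: derivative_eq_intros simp: y_def field_simps)
    have "R (z + s) - R z = (\<Sum>k = 1..N. y ^ k) / of_nat N"
    proof -
      define a where "a w = (\<Sum>k = 1..<N. exp (w * of_nat k / of_nat N) / (of_nat N * (root_of_unity M N ^ k - 1)))" for w
      define b where "b w = (\<Sum>k = 1..<M. exp (w * of_nat k / of_nat M) / (of_nat M * (root_of_unity N M ^ k - 1)))" for w
      define g where "g w = exp w / (of_nat M * of_nat N) * (- (\<i> * w) / (2 * of_real pi) - of_nat (M + N) / 2)" for w
      have "a (z + s) - a z = (\<Sum>k = 1..<N. y ^ k) / of_nat N"
        unfolding a_def sum_subtractf[symmetric] sum_divide_distrib
      proof (intro sum.cong refl)
        fix k assume k: "k \<in> {1..<N}"
        have "exp ((z + s) * of_nat k / of_nat N) = y ^ k * root_of_unity M N ^ k"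
          unfolding yk root_of_unity_power s_def exp_add[symmetric] by (simp add: algebra_simps add_divide_distrib)
        moreover have "root_of_unity M N ^ k \<noteq> 1"
          using root_of_unity_power_eq_1_iff[OF assms(1,3), of k] k by (auto dest: dvd_imp_le)
        moreover have "y ^ k * w / (of_nat N * (w - 1)) - y ^ k / (of_nat N * (w - 1)) = y ^ k / of_nat N"
          if "w \<noteq> 1" for w
        proof -
          have "y ^ k * w / (of_nat N * (w - 1)) - y ^ k / (of_nat N * (w - 1)) = (y ^ k * (w - 1)) / (of_nat N * (w - 1))"
            by (simp add: right_diff_distrib diff_divide_distrib)
          then show ?thesis using that by simp
        qed
        ultimately show "exp ((z + s) * of_nat k / of_nat N) / (of_nat N * (root_of_unity M N ^ k - 1)) -
            exp (z * of_nat k / of_nat N) / (of_nat N * (root_of_unity M N ^ k - 1)) = y ^ k / of_nat N"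
          by (simp only: yk)
      qed
      moreover have "b (z + s) = b z"
        unfolding b_def
      proof (intro sum.cong refl)
        fix k assume "k \<in> {1..<M}"
        have "(z + s) * of_nat k / of_nat M = z * of_nat k / of_nat M + of_nat k * (2 * of_real pi * \<i>)"
          using assms(2) by (simp add: s_def field_simps)
        then have "exp ((z + s) * of_nat k / of_nat M) = exp (z * of_nat k / of_nat M)"
          by (simp only: exp_add exp_of_nat_mult exp_two_pi_i power_one mult_1_right)
        then show "exp ((z + s) * of_nat k / of_nat M) / (of_nat M * (root_of_unity N M ^ k - 1)) =
            exp (z * of_nat k / of_nat M) / (of_nat M * (root_of_unity N M ^ k - 1))" by simp
      qed
      moreover have "g (z + s) - g z = y ^ N / of_nat N"
      proof -
        have shift: "- (\<i> * (z + s)) / (2 * of_real pi) = - (\<i> * z) / (2 * of_real pi) + of_nat M"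
          by (simp add: s_def field_simps)
        have alg: "a * (x + m - h) - a * (x - h) = a * m" for a x m h :: complex
          by (simp add: algebra_simps)
        show ?thesis unfolding g_def exps shift yN alg using assms(2) by simp
      qed
      moreover have "R w = a w + b w + g w" for w
        by (simp add: R_def a_def b_def g_def dilog_residues_def)
      then have "R (z + s) - R z = (a (z + s) - a z) + (b (z + s) - b z) + (g (z + s) - g z)"
        by simp
      ultimately have "R (z + s) - R z = (\<Sum>k = 1..<N. y ^ k) / of_nat N + y ^ N / of_nat N"
        by simp
      also have "\<dots> = (\<Sum>k\<in>insert N {1..<N}. y ^ k) / of_nat N"
        by (simp add: add_divide_distrib)
      also have "insert N {1..<N} = {1..N}" using assms(3) by auto
      finally show ?thesis .
    qed
    also have "(\<Sum>k = 1..N. y ^ k) = (\<Sum>k<N. y ^ Suc k)"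
      by (rule sum.reindex_bij_witness[of _ Suc "\<lambda>k. k - 1"]) auto
    also have "\<dots> = y * (1 - y ^ N) / (1 - y)"
      using \<open>y \<noteq> 1\<close> by (simp add: one_diff_power_eq flip: sum_distrib_left)
    finally have diff: "R (z + s) - R z = y * (1 - exp z) / (1 - y) / of_nat N"
      by (simp only: yN)
    have "R (z + s) / (1 - exp z) - R z / (1 - exp z) = y / of_nat N / (1 - y)"
      unfolding diff_divide_distrib[symmetric] diff using nz by simp
    moreover have "(D has_field_derivative R (z + s) / (1 - exp z) + - (y / of_nat N) / (1 - y) - R z / (1 - exp z)) (at z)"
      unfolding D_def by (intro DERIV_diff DERIV_add d1 d2 d3)
    ultimately show ?thesis by (simp add: algebra_simps)
  qed
  moreover have "convex T" unfolding T_def by (rule convex_halfspace_Re_lt)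
  ultimately obtain c where c: "\<And>w. w \<in> T \<Longrightarrow> D w = c"
    using has_field_derivative_zero_constant[of T D] has_field_derivative_at_within unfolding T_def by blast
  have "((\<lambda>x. D (Complex x 0)) \<longlongrightarrow> 0 + Ln (1 - 0) - 0) at_bot"
  proof -
    have eq: "Complex x 0 + s = Complex x (2 * pi * real M)" for x
      by (simp add: s_def complex_eq_iff)
    have "((\<lambda>x. principal_log M N (Complex x 0 + s)) \<longlongrightarrow> 0) at_bot"
      unfolding eq by (rule principal_log_tendsto_0[OF assms(2,3)])
    moreover have "((\<lambda>x. Ln (1 - exp (Complex x 0 / of_nat N))) \<longlongrightarrow> Ln (1 - 0)) at_bot"
      by (intro tendsto_Ln tendsto_intros exp_left_half_plane_tendsto_0 assms) auto
    ultimately show ?thesis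
      unfolding D_def by (intro tendsto_diff tendsto_add principal_log_tendsto_0 assms)
  qed
  moreover have "\<forall>\<^sub>F x::real in at_bot. D (Complex x 0) = c"
    using eventually_le_at_bot[of "-1::real"] by eventually_elim (rule c, simp add: T_def)
  then have "((\<lambda>x. D (Complex x 0)) \<longlongrightarrow> c) at_bot" by (rule tendsto_eventually)
  ultimately have "c = 0 + Ln (1 - 0) - 0"
    by (rule tendsto_unique[OF trivial_limit_at_bot_linorder, rotated])
  then have "D z = 0" using c[of z] z by (simp add: T_def)
  then show ?thesis by (simp add: D_def s_def)
qed

context dilog_line
begin

lemma open_convex_kern_strip: "open (kern_strip M N)" "convex (kern_strip M N)"
proof -
  have "kern_strip M N = {z. 0 < Im z} \<inter> {z. Im z < 2 * pi * real (M + N)}"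
    by (auto simp: kern_strip_def)
  then show "open (kern_strip M N)" "convex (kern_strip M N)"
    by (auto intro!: open_Int open_halfspace_Im_gt open_halfspace_Im_lt convex_Int
        convex_halfspace_Im_gt convex_halfspace_Im_lt)
qed

lemma log_phi_holomorphic: "log_phi holomorphic_on kern_strip M N"
  using has_field_derivative_log_phi open_convex_kern_strip(1) by (auto simp: holomorphic_on_open)

lemma log_phi_eq_principal_log:
  assumes "z \<in> kern_strip M N" "Re z < 0"
  shows "log_phi z = principal_log M N z"
proof -
  define T where "T = kern_strip M N \<inter> {z. Re z < 0}"
  have "convex T"
    unfolding T_def by (intro convex_Int open_convex_kern_strip convex_halfspace_Re_lt)
  moreover have "((\<lambda>z. log_phi z - principal_log M N z) has_field_derivative 0) (at w within T)" if "w \<in> T" for w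
  proof -
    have w: "w \<in> kern_strip M N" "Re w < 0" using that by (auto simp: T_def)
    from DERIV_diff[OF has_field_derivative_log_phi'[OF w(1) exp_neq_1_of_Re_neg[OF w(2)]]
        has_field_derivative_principal_log[OF cop M_pos N_pos w(2)]]
    show ?thesis by (simp add: has_field_derivative_at_within)
  qed
  ultimately obtain c where c: "\<And>w. w \<in> T \<Longrightarrow> log_phi w - principal_log M N w = c"
    using has_field_derivative_zero_constant[of T] by metis
  define y where "y = Im z"
  have yT: "Complex x y \<in> kern_strip M N" for x using assms by (simp add: y_def kern_strip_def)
  have "((\<lambda>x. log_phi (Complex x y) - principal_log M N (Complex x y)) \<longlongrightarrow> 0 - 0) at_bot"
    by (intro tendsto_diff log_phi_tendsto_0 yT principal_log_tendsto_0 M_pos N_pos)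
  moreover have "\<forall>\<^sub>F x::real in at_bot. log_phi (Complex x y) - principal_log M N (Complex x y) = c"
    using eventually_le_at_bot[of "-1::real"] by eventually_elim (rule c, simp add: T_def yT)
  then have "((\<lambda>x. log_phi (Complex x y) - principal_log M N (Complex x y)) \<longlongrightarrow> c) at_bot"
    by (rule tendsto_eventually)
  ultimately have "c = 0 - 0"
    by (rule tendsto_unique[OF trivial_limit_at_bot_linorder, rotated])
  then show ?thesis using c[of z] assms by (simp add: T_def)
qed

text \<open>
  For \<open>Re z < 0\<close> this is \<open>principal_log_shift\<close>. The exponential form makes sense, and by the identity
  theorem holds, on the whole strip where both sides are defined.
\<close>
lemma exp_log_phi_shift:
  assumes z: "0 < Im z" "Im z < 2 * pi * real N"
  shows "exp (log_phi (z + 2 * of_real pi * \<i> * of_nat M)) * (1 - exp (z / of_nat N)) = exp (log_phi z)"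
proof (rule analytic_continuation_open[where f = "\<lambda>z. exp (log_phi (z + 2 * of_real pi * \<i> * of_nat M)) * (1 - exp (z / of_nat N))"
      and g = "\<lambda>z. exp (log_phi z)" and s = "{z. 0 < Im z \<and> Im z < 2 * pi * real N} \<inter> {z. Re z < 0}"])
  define U where "U = {z. 0 < Im z \<and> Im z < 2 * pi * real N}"
  have Ueq: "U = {z. 0 < Im z} \<inter> {z. Im z < 2 * pi * real N}" by (auto simp: U_def)
  have U: "open U" "convex U"
    unfolding Ueq by (auto intro!: open_Int open_halfspace_Im_gt open_halfspace_Im_lt convex_Int
        convex_halfspace_Im_gt convex_halfspace_Im_lt)
  show "open U" "connected U" using U by (auto intro: convex_connected)
  show "open (U \<inter> {z. Re z < 0})" by (intro open_Int U open_halfspace_Re_lt)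
  show "U \<inter> {z. Re z < 0} \<subseteq> U" by auto
  have "Complex (-1) (pi * real N) \<in> U \<inter> {z. Re z < 0}"
    using N_pos by (simp add: U_def)
  then show "U \<inter> {z. Re z < 0} \<noteq> {}" by blast
  have strip: "w \<in> kern_strip M N" "w + 2 * of_real pi * \<i> * of_nat M \<in> kern_strip M N" if "w \<in> U" for w
    using that M_pos by (auto simp: U_def kern_strip_def ring_distribs intro: add_pos_pos order_less_trans)
  show "(\<lambda>z. exp (log_phi z)) holomorphic_on U"
    using strip by (intro holomorphic_intros holomorphic_on_subset[OF log_phi_holomorphic]) auto
  have "(\<lambda>z. log_phi (z + 2 * of_real pi * \<i> * of_nat M)) holomorphic_on U"
    by (rule holomorphic_on_compose_gen[unfolded o_def, OF _ log_phi_holomorphic])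
       (auto intro!: holomorphic_intros strip(2))
  then show "(\<lambda>z. exp (log_phi (z + 2 * of_real pi * \<i> * of_nat M)) * (1 - exp (z / of_nat N))) holomorphic_on U"
    using N_pos by (intro holomorphic_intros) auto
  show "exp (log_phi (w + 2 * of_real pi * \<i> * of_nat M)) * (1 - exp (w / of_nat N)) = exp (log_phi w)"
    if "w \<in> U \<inter> {z. Re z < 0}" for w
  proof -
    have w: "w \<in> U" "Re w < 0" using that by auto
    have "1 - exp (w / of_nat N) \<noteq> 0"
      using exp_neq_1_of_Re_neg[of "w / of_nat N"] w(2) N_pos by (simp add: divide_neg_pos)
    then have "exp (log_phi (w + 2 * of_real pi * \<i> * of_nat M)) * (1 - exp (w / of_nat N)) =
        exp (log_phi (w + 2 * of_real pi * \<i> * of_nat M) + Ln (1 - exp (w / of_nat N)))"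
      by (simp add: exp_add)
    also have "log_phi (w + 2 * of_real pi * \<i> * of_nat M) + Ln (1 - exp (w / of_nat N)) = log_phi w"
      using strip[OF w(1)] w(2) principal_log_shift[OF cop M_pos N_pos w(2)]
      by (simp add: log_phi_eq_principal_log)
    finally show ?thesis .
  qed
  show "z \<in> U" using z by (simp add: U_def)
qed

end

definition period_lattice :: "complex set" where
  "period_lattice = range (\<lambda>m::int. 2 * of_real pi * \<i> * of_int m)"

lemma mem_period_lattice_iff: "z \<in> period_lattice \<longleftrightarrow> exp z = 1"
  using exp_mult_eq_1_iff[of 1 z] by (auto simp: period_lattice_def)

lemma closed_period_lattice: "closed period_lattice"
proof -
  have eq: "period_lattice = {z. exp z = 1}" using mem_period_lattice_iff by blast
  show ?thesis unfolding eq by (intro closed_Collect_eq continuous_intros)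
qed

lemma eventually_at_notin_period_lattice: "\<forall>\<^sub>F z in at z0. z \<notin> period_lattice"
proof (cases "z0 \<in> period_lattice")
  case False
  then show ?thesis
    using eventually_at_in_open'[of "- period_lattice" z0] closed_period_lattice by (auto simp: open_Compl)
next
  case True
  then obtain m :: int where m: "z0 = 2 * of_real pi * \<i> * of_int m" by (auto simp: period_lattice_def)
  have "z \<notin> period_lattice" if z: "z \<noteq> z0" "dist z z0 < 2 * pi" for z
  proof
    assume "z \<in> period_lattice"
    then obtain n :: int where n: "z = 2 * of_real pi * \<i> * of_int n" by (auto simp: period_lattice_def)
    have "z - z0 = 2 * of_real pi * \<i> * of_int (n - m)" by (simp add: m n algebra_simps)
    then have "dist z z0 = 2 * pi * \<bar>real_of_int (n - m)\<bar>"
      by (simp only: dist_norm norm_mult norm_of_int) simp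
    with z have "\<bar>real_of_int (n - m)\<bar> < 1" by simp
    then have "n = m" by linarith
    then show False using z m n by simp
  qed
  then show ?thesis
    by (auto simp: eventually_at intro!: exI[of _ "2 * pi"])
qed

context dilog_line
begin

text \<open>
  The \<open>sheet\<close> with index \<open>m\<close> is what the functional equation, applied \<open>\<bar>m\<bar>\<close> times, predicts for the
  continuation on the strip translated by \<open>2\<pi>iMm\<close>. One of the two products is always empty.
\<close>
definition shift_factor :: "int \<Rightarrow> complex \<Rightarrow> complex" where
  "shift_factor j z = 1 - exp ((z - 2 * of_real pi * \<i> * of_nat M * of_int j) / of_nat N)"

definition sheet :: "int \<Rightarrow> complex \<Rightarrow> complex" where
  "sheet m z = exp (log_phi (z - 2 * of_real pi * \<i> * of_nat M * of_int m)) *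
     ((\<Prod>j\<in>{1..m}. inverse (shift_factor j z)) * (\<Prod>j\<in>{m<..0}. shift_factor j z))"

definition sheet_strip :: "int \<Rightarrow> complex set" where
  "sheet_strip m = {z. z - 2 * of_real pi * \<i> * of_nat M * of_int m \<in> kern_strip M N}"

lemma mem_sheet_strip:
  "z \<in> sheet_strip m \<longleftrightarrow> 2 * pi * real M * of_int m < Im z \<and> Im z < 2 * pi * real M * of_int m + 2 * pi * real (M + N)"
  by (auto simp: sheet_strip_def kern_strip_def)

lemma open_sheet_strip: "open (sheet_strip m)"
proof -
  have "sheet_strip m = {z. 2 * pi * real M * of_int m < Im z} \<inter> {z. Im z < 2 * pi * real M * of_int m + 2 * pi * real (M + N)}"
    using mem_sheet_strip by blast
  then show ?thesis by (auto intro!: open_Int open_halfspace_Im_gt open_halfspace_Im_lt)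
qed

lemma shift_factor_nonzero:
  assumes "z \<notin> period_lattice"
  shows "shift_factor j z \<noteq> 0"
proof
  assume "shift_factor j z = 0"
  then have "exp ((z - 2 * of_real pi * \<i> * of_nat M * of_int j) / of_nat N) = 1"
    by (simp add: shift_factor_def)
  then have "exp (of_nat N * ((z - 2 * of_real pi * \<i> * of_nat M * of_int j) / of_nat N)) = 1"
    by (simp only: exp_of_nat_mult power_one)
  then have "exp (z - 2 * of_real pi * \<i> * of_nat M * of_int j) = 1"
    using N_pos by simp
  moreover have "exp (2 * of_real pi * \<i> * of_nat M * of_int j) = (1::complex)"
  proof -
    have "2 * of_real pi * \<i> * of_int (int M * j) \<in> period_lattice"
      unfolding period_lattice_def by (rule rangeI)
    then show ?thesis by (simp add: mem_period_lattice_iff mult.assoc)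
  qed
  ultimately have "exp z = 1" by (simp add: exp_diff)
  then show False using assms by (simp add: mem_period_lattice_iff)
qed

lemma sheet_step:
  assumes "z \<in> sheet_strip m" "z \<in> sheet_strip (m + 1)" "z \<notin> period_lattice"
  shows "sheet m z = sheet (m + 1) z"
proof -
  define w where "w = z - 2 * of_real pi * \<i> * of_nat M * of_int (m + 1)"
  have w': "w + 2 * of_real pi * \<i> * of_nat M = z - 2 * of_real pi * \<i> * of_nat M * of_int m"
    by (simp add: w_def algebra_simps)
  have Im_w: "Im w = Im z - 2 * pi * real M * (of_int m + 1)" by (simp add: w_def)
  have "0 < Im w" "Im w < 2 * pi * real N"
    using assms(1,2) unfolding mem_sheet_strip Im_w by (simp_all add: algebra_simps)
  from exp_log_phi_shift[OF this]
  have e: "exp (log_phi w) = exp (log_phi (z - 2 * of_real pi * \<i> * of_nat M * of_int m)) * shift_factor (m + 1) z"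
    unfolding w' by (simp add: shift_factor_def w_def)
  have nz: "shift_factor (m + 1) z \<noteq> 0" by (rule shift_factor_nonzero[OF assms(3)])
  have "(\<Prod>j\<in>{1..m}. inverse (shift_factor j z)) * (\<Prod>j\<in>{m<..0}. shift_factor j z) =
      shift_factor (m + 1) z * ((\<Prod>j\<in>{1..m + 1}. inverse (shift_factor j z)) * (\<Prod>j\<in>{m + 1<..0}. shift_factor j z))"
  proof (cases "m \<ge> 0")
    case True
    then have "{1..m + 1} = insert (m + 1) {1..m}" "{m<..0} = {}" "{m + 1<..0} = {}" by auto
    then show ?thesis using nz by simp
  next
    case False
    then have "{m<..0} = insert (m + 1) {m + 1<..0}" "{1..m} = {}" "{1..m + 1} = {}" by auto
    then show ?thesis by simp
  qed
  then show ?thesis unfolding sheet_def w_def[symmetric] e by simp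
qed

lemma log_phi_shifted_analytic:
  "(\<lambda>z. exp (log_phi (z - 2 * of_real pi * \<i> * of_nat M * of_int m))) analytic_on sheet_strip m"
proof -
  have "log_phi analytic_on kern_strip M N"
    using log_phi_holomorphic open_convex_kern_strip(1) by (simp add: analytic_on_open)
  then have "(\<lambda>z. log_phi (z - 2 * of_real pi * \<i> * of_nat M * of_int m)) analytic_on sheet_strip m"
    by (rule analytic_on_compose_gen[unfolded o_def, rotated]) (auto simp: sheet_strip_def intro!: analytic_intros)
  then show ?thesis by (intro analytic_intros)
qed

lemma shift_factor_analytic: "shift_factor j analytic_on A"
  unfolding shift_factor_def[abs_def] using N_pos by (intro analytic_intros) auto

lemma sheet_meromorphic: "sheet m meromorphic_on sheet_strip m"
  unfolding sheet_def[abs_def]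
  by (intro meromorphic_intros analytic_on_imp_meromorphic_on log_phi_shifted_analytic shift_factor_analytic)

lemma sheet_analytic: "sheet m analytic_on sheet_strip m - period_lattice"
  unfolding sheet_def[abs_def] using shift_factor_nonzero
  by (intro analytic_intros analytic_on_subset[OF log_phi_shifted_analytic] shift_factor_analytic) auto

text \<open>
  The translated strips overlap; \<open>level\<close> selects one of them so that \<open>z\<close> keeps the distance \<open>\<pi>N\<close> from its
  boundary, and hence points near \<open>z\<close> still lie in it.
\<close>
definition level :: "complex \<Rightarrow> int" where
  "level z = \<lfloor>(Im z - pi * real N) / (2 * pi * real M)\<rfloor>"

definition glued :: "complex \<Rightarrow> complex" where
  "glued z = sheet (level z) z"

lemma level_bounds:
  "2 * pi * real M * of_int (level z) + pi * real N \<le> Im z"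
  "Im z < 2 * pi * real M * of_int (level z) + pi * real N + 2 * pi * real M"
proof -
  have "of_int (level z) \<le> (Im z - pi * real N) / (2 * pi * real M)"
    "(Im z - pi * real N) / (2 * pi * real M) < of_int (level z) + 1"
    unfolding level_def by linarith+
  then show "2 * pi * real M * of_int (level z) + pi * real N \<le> Im z"
    "Im z < 2 * pi * real M * of_int (level z) + pi * real N + 2 * pi * real M"
    using M_pos by (simp_all add: field_simps)
qed

lemma mem_sheet_strip_level: "z \<in> sheet_strip (level z)"
proof -
  have "0 < pi * real N" "0 < pi * real M" using M_pos N_pos by simp_all
  then show ?thesis
    using level_bounds[of z] unfolding mem_sheet_strip by (simp add: ring_distribs)
qed

text \<open>
  Near \<open>z0\<close> the level changes by at most one, and adjacent sheets agree on the overlap of their strips.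
\<close>
lemma glued_eq_sheet_near:
  "\<forall>\<^sub>F z in nhds z0. z \<notin> period_lattice \<longrightarrow> glued z = sheet (level z0) z"
proof -
  have "\<forall>\<^sub>F z in nhds z0. z \<in> sheet_strip (level z0)"
    by (intro eventually_nhds_in_open open_sheet_strip mem_sheet_strip_level)
  moreover have "\<forall>\<^sub>F z in nhds z0. dist z z0 < 2 * pi * real M"
    using M_pos eventually_nhds_ball[of "2 * pi * real M" z0] by (simp add: dist_commute)
  ultimately show ?thesis
  proof eventually_elim
    case (elim z)
    have "\<bar>Im z - Im z0\<bar> < 2 * pi * real M"
      using abs_Im_le_cmod[of "z - z0"] elim(2) by (simp add: dist_norm)
    then have less: "2 * pi * real M * of_int (level z) < 2 * pi * real M * (of_int (level z0) + 2)"
      "2 * pi * real M * of_int (level z0) < 2 * pi * real M * (of_int (level z) + 2)"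
      using level_bounds[of z] level_bounds[of z0] by (simp_all add: ring_distribs abs_less_iff)
    have "real_of_int (level z) < of_int (level z0) + 2" "real_of_int (level z0) < of_int (level z) + 2"
    proof -
      have pos: "2 * pi * real M > 0" using M_pos by simp
      show "real_of_int (level z) < of_int (level z0) + 2" "real_of_int (level z0) < of_int (level z) + 2"
        using less by (simp_all only: mult_less_cancel_left_pos[OF pos])
    qed
    then consider "level z = level z0" | "level z = level z0 + 1" | "level z0 = level z + 1"
      by linarith
    then show ?case
      by cases (use sheet_step elim(1) mem_sheet_strip_level[of z] in \<open>auto simp: glued_def\<close>)
  qed
qed

lemma glued_meromorphic: "glued meromorphic_on UNIV"
proof -
  have "glued meromorphic_on {z0}" for z0
  proof -
    have "sheet (level z0) meromorphic_on {z0}"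
      by (rule meromorphic_on_subset[OF sheet_meromorphic]) (use mem_sheet_strip_level in auto)
    moreover have "\<forall>\<^sub>F w in at z0. glued w = sheet (level z0) w"
      using eventually_at_notin_period_lattice[of z0] eventually_nhds_conv_at[THEN iffD1, OF glued_eq_sheet_near[of z0], THEN conjunct1]
      by eventually_elim auto
    ultimately show ?thesis
      using meromorphic_on_cong[of "{z0}" glued "sheet (level z0)" "{z0}"] by auto
  qed
  then show ?thesis by (auto simp: meromorphic_on_def)
qed

lemma glued_analytic: "glued analytic_on - period_lattice"
proof -
  have "glued analytic_on {z0}" if z0: "z0 \<notin> period_lattice" for z0
  proof -
    have "\<forall>\<^sub>F z in nhds z0. z \<notin> period_lattice"
      using eventually_nhds_in_open[of "- period_lattice" z0] closed_period_lattice z0 by (auto simp: open_Compl)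
    then have "\<forall>\<^sub>F z in nhds z0. glued z = sheet (level z0) z"
      using glued_eq_sheet_near[of z0] by eventually_elim auto
    moreover have "sheet (level z0) analytic_on {z0}"
      by (rule analytic_on_subset[OF sheet_analytic]) (use z0 mem_sheet_strip_level in auto)
    ultimately show ?thesis using analytic_at_cong by blast
  qed
  then show ?thesis using analytic_on_analytic_at by blast
qed

lemma glued_eq_exp_log_phi:
  assumes "pi * real N < Im z" "Im z < pi * real N + 2 * pi * real M"
  shows "glued z = exp (log_phi z)"
proof -
  have "level z = 0"
    unfolding level_def using assms M_pos by (intro floor_unique) (auto simp: field_simps)
  then show ?thesis by (simp add: glued_def sheet_def)
qed

lemma glued_eq_exp_principal_log:
  assumes z: "Re z < 0"
  shows "glued z = exp (principal_log M N z)"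
proof (rule analytic_continuation_open[where f = glued and g = "\<lambda>z. exp (principal_log M N z)" and s' = "{z. Re z < 0}"
      and s = "{z. Re z < 0} \<inter> ({z. pi * real N < Im z} \<inter> {z. Im z < pi * real N + 2 * pi * real M})"])
  show "open ({z. Re z < 0} \<inter> ({z. pi * real N < Im z} \<inter> {z. Im z < pi * real N + 2 * pi * real M}))"
    by (intro open_Int open_halfspace_Re_lt open_halfspace_Im_gt open_halfspace_Im_lt)
  have "Complex (-1) (pi * real N + pi * real M) \<in> {z. Re z < 0} \<inter> ({z. pi * real N < Im z} \<inter> {z. Im z < pi * real N + 2 * pi * real M})"
    using M_pos by simp
  then show "{z. Re z < 0} \<inter> ({z. pi * real N < Im z} \<inter> {z. Im z < pi * real N + 2 * pi * real M}) \<noteq> {}" by blast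
  show "open {z. Re z < 0}" "connected {z. Re z < 0}"
    by (auto intro: open_halfspace_Re_lt convex_connected convex_halfspace_Re_lt)
  have "{z. Re z < 0} \<subseteq> - period_lattice"
    using exp_neq_1_of_Re_neg by (auto simp: mem_period_lattice_iff)
  then show "glued holomorphic_on {z. Re z < 0}"
    using glued_analytic analytic_imp_holomorphic analytic_on_subset by blast
  have "principal_log M N holomorphic_on {z. Re z < 0}"
    using has_field_derivative_principal_log[OF cop M_pos N_pos] open_halfspace_Re_lt[of 0]
    by (auto simp: holomorphic_on_open)
  then show "(\<lambda>z. exp (principal_log M N z)) holomorphic_on {z. Re z < 0}"
    by (intro holomorphic_intros)
  show "glued w = exp (principal_log M N w)"
    if w: "w \<in> {z. Re z < 0} \<inter> ({z. pi * real N < Im z} \<inter> {z. Im z < pi * real N + 2 * pi * real M})" for w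
  proof -
    have "0 < pi * real N" using N_pos by simp
    then have "w \<in> kern_strip M N" using w by (auto simp: kern_strip_def ring_distribs intro: order_less_trans)
    then show ?thesis using w by (simp add: glued_eq_exp_log_phi log_phi_eq_principal_log)
  qed
qed (use z in auto)

end

section \<open>Identification with the quantum dilogarithm\<close>

text \<open>
  The identity theorem. The difference vanishes identically after removal of its singularities, so the
  two functions agree near every point; at the point itself a nicely meromorphic function is determined
  by its values nearby.
\<close>
lemma nicely_meromorphic_eqI:
  assumes f: "f nicely_meromorphic_on A" and g: "g nicely_meromorphic_on A"
    and A: "open A" "connected A" "p \<in> A" and eq: "\<forall>\<^sub>F w in at p. f w = g w" and z: "z \<in> A"
  shows "f z = g z"
proof -
  define h where "h = (\<lambda>w. f w - g w)"
  have h: "h meromorphic_on A"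
    unfolding h_def using f g by (intro meromorphic_intros) (auto simp: nicely_meromorphic_on_def)
  have rs: "\<forall>\<^sub>F w in at q. remove_sings h w = h w" if "q \<in> A" for q
    using h that by (intro eventually_remove_sings_eq_at) (auto dest: meromorphic_on_isolated_singularity meromorphic_on_subset)
  have "\<forall>\<^sub>F w in at p. remove_sings h w = 0"
    using rs[OF A(3)] eq by eventually_elim (simp add: h_def)
  then have "\<exists>\<^sub>F w in at p. remove_sings h w = 0"
    by (intro eventually_frequently) auto
  then have h0: "remove_sings h w = 0" if "w \<in> A" for w
    using frequently_eq_meromorphic_imp_constant[OF _ remove_sings_nicely_meromorphic[OF h] A that] by blast
  have ev: "\<forall>\<^sub>F w in at z. f w = g w"
    using rs[OF z] eventually_at_in_open'[OF A(1) z] by eventually_elim (use h0 in \<open>auto simp: h_def\<close>)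
  consider "is_pole f z" "f z = 0" | "f \<midarrow>z\<rightarrow> f z"
    using f z by (auto simp: nicely_meromorphic_on_def)
  then show ?thesis
  proof cases
    case 1
    then have "is_pole g z" using is_pole_cong[OF ev refl] by simp
    then have "\<not> g \<midarrow>z\<rightarrow> g z" using not_tendsto_and_filterlim_at_infinity[of "at z" g] by (auto simp: is_pole_def)
    then have "g z = 0" using g z by (auto simp: nicely_meromorphic_on_def)
    then show ?thesis using 1 by simp
  next
    case 2
    then have lim: "g \<midarrow>z\<rightarrow> f z" using tendsto_cong[OF ev] by blast
    then have "\<not> is_pole g z" using not_tendsto_and_filterlim_at_infinity[of "at z" g] by (auto simp: is_pole_def)
    then have "g \<midarrow>z\<rightarrow> g z" using g z by (auto simp: nicely_meromorphic_on_def)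
    then show ?thesis using tendsto_unique[OF _ lim] by simp
  qed
qed

text \<open>
  The substitution \<open>t = s v / 2\<close>. From \<open>s b = M\<close> and \<open>s / b = N\<close> one gets
  \<open>4 sinh (t b) sinh (t / b) = exp (-(M + N) v / 2) (exp (M v) - 1) (exp (N v) - 1)\<close>, and the shift of \<open>x\<close> by
  \<^const>\<open>faddeev_c\<close> compensates the factor \<open>exp (-(M + N) v / 2)\<close>.
\<close>
lemma faddeev_integral_eq_kern:
  assumes "M > 0" "N > 0" and b: "b = sqrt (real M / real N)" and s: "s = sqrt (real M * real N)"
  shows "faddeev_integral b \<epsilon> x =
           (LBINT u. kern M N (2 * of_real pi * of_real s * (x + faddeev_c b)) (Complex u (2 * \<epsilon> / s)) / Complex u (2 * \<epsilon> / s))"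
proof -
  have s0: "s > 0" using assms by simp
  have b0: "b > 0" using assms by simp
  have sb: "s * b = real M" unfolding s b using assms(1,2) by (simp add: real_sqrt_mult real_sqrt_divide)
  have "s * inverse b = real N"
  proof -
    have "inverse b = sqrt (real N / real M)" unfolding b by (simp add: real_sqrt_divide)
    then show ?thesis unfolding s using assms(1,2) by (simp add: real_sqrt_mult real_sqrt_divide)
  qed
  note sb' = this
  define z where "z = 2 * of_real pi * of_real s * (x + faddeev_c b)"
  define d where "d = 2 * \<epsilon> / s"
  define f where "f u = (let t = of_real u + \<i> * of_real \<epsilon>
               in exp (- 2 * \<i> * x * t) / (4 * sinh (t * of_real b) * sinh (t * of_real (inverse b))) / t)" for u :: real
  have "faddeev_integral b \<epsilon> x = (LBINT u. f u)" by (simp add: faddeev_integral_def f_def)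
  also have "\<dots> = \<bar>s / 2\<bar> *\<^sub>R (LBINT u. f (0 + s / 2 * u))"
    by (rule lborel_integral_real_affine) (use s0 in auto)
  also have "\<dots> = (LBINT u. (s / 2) *\<^sub>R f (s / 2 * u))"
    using s0 by simp
  also have "(\<lambda>u. (s / 2) *\<^sub>R f (s / 2 * u)) = (\<lambda>u. kern M N z (Complex u d) / Complex u d)"
  proof
    fix u
    define v where "v = Complex u d"
    define t where "t = of_real (s / 2) * v"
    have t: "of_real (s / 2 * u) + \<i> * of_real \<epsilon> = t"
      using s0 by (simp add: t_def v_def d_def complex_eq_iff)
    have tb: "t * of_real b = of_nat M * v / 2"
    proof -
      have "t * of_real b = of_real (s * b) * v / 2" by (simp add: t_def)
      then show ?thesis by (simp add: sb)
    qed
    have tb': "t * of_real (inverse b) = of_nat N * v / 2"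
    proof -
      have "t * of_real (inverse b) = of_real (s * inverse b) * v / 2" by (simp add: t_def)
      then show ?thesis by (simp add: sb')
    qed
    have sinh_eq: "2 * sinh (w / 2) = exp (- (w / 2)) * (exp w - 1)" for w :: complex
    proof -
      have "exp (w / 2) = exp (- (w / 2)) * exp w" by (simp flip: exp_add)
      then show ?thesis by (simp add: sinh_def scaleR_conv_of_real right_diff_distrib)
    qed
    have cb: "of_real s * faddeev_c b = \<i> / 2 * of_nat (M + N)"
    proof -
      have "of_real s * faddeev_c b = \<i> / 2 * of_real (s * b + s * inverse b)"
        unfolding faddeev_c_def by (simp add: algebra_simps)
      then show ?thesis unfolding sb sb' by simp
    qed
    have z': "- 2 * \<i> * x * t = - (\<i> * z * v) / (2 * of_real pi) + - (of_nat (M + N) * v / 2)"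
    proof -
      have "- (\<i> * z * v) / (2 * of_real pi) = - (\<i> * of_real s * x * v) - \<i> * (of_real s * faddeev_c b) * v"
        by (simp add: z_def field_simps)
      also have "\<dots> = - (\<i> * of_real s * x * v) + of_nat (M + N) * v / 2"
        unfolding cb by (simp add: field_simps)
      finally show ?thesis by (simp add: t_def)
    qed
    have den: "4 * sinh (of_nat M * v / 2) * sinh (of_nat N * v / 2) =
        exp (- (of_nat (M + N) * v / 2)) * ((exp (of_nat M * v) - 1) * (exp (of_nat N * v) - 1))"
    proof -
      have "4 * sinh (of_nat M * v / 2) * sinh (of_nat N * v / 2) = (2 * sinh (of_nat M * v / 2)) * (2 * sinh (of_nat N * v / 2))"
        by simp
      also have "\<dots> = (exp (- (of_nat M * v / 2)) * exp (- (of_nat N * v / 2))) * ((exp (of_nat M * v) - 1) * (exp (of_nat N * v) - 1))"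
        unfolding sinh_eq by (simp only: mult_ac)
      also have "exp (- (of_nat M * v / 2)) * exp (- (of_nat N * v / 2)) = exp (- (of_nat (M + N) * v / 2))"
        unfolding exp_add[symmetric] by (simp add: ring_distribs add_divide_distrib)
      finally show ?thesis .
    qed
    have "f (s / 2 * u) = exp (- (\<i> * z * v) / (2 * of_real pi)) / ((exp (of_nat M * v) - 1) * (exp (of_nat N * v) - 1)) / t"
      unfolding f_def Let_def t tb tb' den z' exp_add by simp
    then show "(s / 2) *\<^sub>R f (s / 2 * u) = kern M N z (Complex u d) / Complex u d"
      using s0 by (simp add: kern_def t_def v_def[symmetric] scaleR_conv_of_real)
  qed
  finally show ?thesis by (simp add: z_def d_def)
qed

lemma dilog_line_exists:
  assumes "M > 0" "N > 0" "coprime M N"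
  shows "\<forall>\<^sub>F d in at_right 0. dilog_line M N d"
proof -
  have "\<forall>\<^sub>F d in at_right (0::real). d \<in> {0<..<pi / real (M + N)}"
    using assms by (intro eventually_at_right_real) simp
  then show ?thesis
  proof eventually_elim
    case (elim d)
    then have "d * real (M + N) < pi" using assms by (simp add: field_simps)
    moreover have "real M * d \<le> d * real (M + N)" "real N * d \<le> d * real (M + N)"
      using elim by (simp_all add: algebra_simps)
    ultimately have "real M * d < pi" "real N * d < pi" by linarith+
    then show ?case using assms elim by unfold_locales auto
  qed
qed

text \<open>
  The glued function satisfies the characterisation of the quantum dilogarithm: on the strip it agrees
  with \<open>exp (log_phi z)\<close> for every admissible height \<open>d\<close> of the line, since all of these coincide with
  \<open>exp (principal_log M N z)\<close> for \<open>Re z < 0\<close>.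
\<close>
lemma quantum_dilog_rational:
  fixes M N :: nat and b s :: real
  assumes MN: "M > 0" "N > 0" "coprime M N" and b: "b = sqrt (real M / real N)" and s: "s = sqrt (real M * real N)"
  defines "\<Psi> \<equiv> (\<lambda>z. quantum_dilog b (z / (2 * of_real pi * of_real s) - faddeev_c b))"
  shows "\<Psi> analytic_on - period_lattice" and "Re z < 0 \<Longrightarrow> \<Psi> z = exp (principal_log M N z)"
proof -
  obtain d0 where "dilog_line M N d0"
    using eventually_happens'[OF _ dilog_line_exists[OF MN]] by auto
  then interpret L: dilog_line M N d0 .
  have s0: "s > 0" using MN s by simp
  have b0: "b > 0" using MN b by simp
  define k :: complex where "k = 2 * of_real pi * of_real s"
  have k0: "k \<noteq> 0" using s0 by (simp add: k_def)
  define aff where "aff x = k * (x + faddeev_c b)" for x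
  have aff_inv: "aff (z / k - faddeev_c b) = z" for z using k0 by (simp add: aff_def)
  have aff_an: "aff analytic_on A" for A
    unfolding aff_def[abs_def] by (intro analytic_intros)
  define \<Phi> where "\<Phi> = remove_sings (\<lambda>x. L.glued (aff x))"
  have "(\<lambda>x. L.glued (aff x)) meromorphic_on UNIV"
    by (rule meromorphic_on_compose[OF L.glued_meromorphic aff_an]) auto
  then have \<Phi>: "\<Phi> nicely_meromorphic_on UNIV"
    unfolding \<Phi>_def by (rule remove_sings_nicely_meromorphic)
  have \<Phi>_off: "\<Phi> x = L.glued (aff x)" if "aff x \<notin> period_lattice" for x
  proof -
    have "(\<lambda>x. L.glued (aff x)) analytic_on {x}"
      by (rule analytic_on_compose_gen[unfolded o_def, OF aff_an L.glued_analytic]) (use that in auto)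
    then show ?thesis unfolding \<Phi>_def by simp
  qed
  have Re_lattice: "z \<notin> period_lattice" if "Re z < 0" for z
    using exp_neq_1_of_Re_neg[OF that] by (simp add: mem_period_lattice_iff)
  define X where "X = {x. \<bar>Im x\<bar> < \<bar>Im (faddeev_c b)\<bar>}"
  have Im_c: "Im (faddeev_c b) = (b + inverse b) / 2"
  proof -
    have "faddeev_c b = \<i> * of_real ((b + inverse b) / 2)" by (simp add: faddeev_c_def)
    then show ?thesis by (simp only: Im_i_times Re_complex_of_real)
  qed
  have Im_c0: "Im (faddeev_c b) > 0" unfolding Im_c using b0 by (simp add: add_pos_pos)
  have scale: "2 * pi * s * (2 * Im (faddeev_c b)) = 2 * pi * real (M + N)"
  proof -
    have "s * b = real M" unfolding s b using MN by (simp add: real_sqrt_mult real_sqrt_divide)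
    moreover have "s * inverse b = real N"
    proof -
      have "inverse b = sqrt (real N / real M)" unfolding b by (simp add: real_sqrt_divide)
      then show ?thesis unfolding s using MN by (simp add: real_sqrt_mult real_sqrt_divide)
    qed
    moreover have "2 * pi * s * (2 * Im (faddeev_c b)) = 2 * pi * (s * b + s * inverse b)"
      unfolding Im_c by (simp add: algebra_simps)
    ultimately show ?thesis by simp
  qed
  have Im_aff: "Im (aff x) = 2 * pi * s * (Im x + Im (faddeev_c b))" for x
  proof -
    have "k = of_real (2 * pi * s)" by (simp add: k_def)
    then show ?thesis by (simp add: aff_def)
  qed
  have aff_strip: "aff x \<in> kern_strip M N" if "x \<in> X" for x
  proof -
    have "0 < Im x + Im (faddeev_c b)" "Im x + Im (faddeev_c b) < 2 * Im (faddeev_c b)"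
      using that Im_c0 by (auto simp: X_def)
    then have "0 < Im (aff x)" "Im (aff x) < 2 * pi * s * (2 * Im (faddeev_c b))"
      unfolding Im_aff using s0 by (simp_all del: mult.assoc)
    then show ?thesis unfolding scale by (simp add: kern_strip_def)
  qed
  have Xeq: "X = {x. - Im (faddeev_c b) < Im x} \<inter> {x. Im x < Im (faddeev_c b)}"
    using Im_c0 by (auto simp: X_def)
  have X: "open X" "connected X"
    unfolding Xeq by (auto intro!: open_Int open_halfspace_Im_gt open_halfspace_Im_lt convex_connected convex_Int
        convex_halfspace_Im_gt convex_halfspace_Im_lt)
  \<comment> \<open>Any point of the strip with \<open>Re z < 0\<close> will do; this one has \<open>x + c = -1 + i Im c\<close>.\<close>
  define x0 where "x0 = Complex (- 1) 0 - faddeev_c b + \<i> * of_real (Im (faddeev_c b))"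
  have x0: "x0 \<in> X" "Re (aff x0) < 0"
  proof -
    show "x0 \<in> X" using Im_c0 by (simp add: X_def x0_def)
    have "k = of_real (2 * pi * s)" by (simp add: k_def)
    then show "Re (aff x0) < 0" using s0 by (simp add: aff_def x0_def)
  qed
  have near_x0: "\<forall>\<^sub>F x in at x0. x \<in> X \<and> Re (aff x) < 0"
  proof -
    have "isCont aff x0" unfolding aff_def[abs_def] by (intro continuous_intros)
    then have "((\<lambda>x. Re (aff x)) \<longlongrightarrow> Re (aff x0)) (at x0)"
      unfolding isCont_def by (rule tendsto_Re)
    then have "\<forall>\<^sub>F x in at x0. Re (aff x) < 0" using x0(2) by (rule order_tendstoD)
    moreover have "\<forall>\<^sub>F x in at x0. x \<in> X" using eventually_at_in_open'[OF X(1) x0(1)] .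
    ultimately show ?thesis by eventually_elim auto
  qed
  have \<Phi>_line: "\<Phi> x = exp (dilog_line.log_phi M N d (aff x))" if x: "x \<in> X" and d: "dilog_line M N d" for x d
  proof -
    interpret D: dilog_line M N d by (rule d)
    have "D.log_phi analytic_on kern_strip M N"
      using D.log_phi_holomorphic D.open_convex_kern_strip(1) by (simp add: analytic_on_open)
    then have "(\<lambda>x. D.log_phi (aff x)) analytic_on X"
      by (rule analytic_on_compose_gen[unfolded o_def, OF aff_an]) (use aff_strip in auto)
    then have "(\<lambda>x. exp (D.log_phi (aff x))) nicely_meromorphic_on X"
      by (intro analytic_on_imp_nicely_meromorphic_on analytic_intros)
    moreover have "\<Phi> nicely_meromorphic_on X" using \<Phi> by (rule nicely_meromorphic_on_subset) auto
    moreover have "\<forall>\<^sub>F x in at x0. \<Phi> x = exp (D.log_phi (aff x))"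
      using near_x0
    proof eventually_elim
      case (elim x)
      then show ?case
        using \<Phi>_off[OF Re_lattice] L.glued_eq_exp_principal_log D.log_phi_eq_principal_log[OF aff_strip] by simp
    qed
    ultimately show ?thesis
      using nicely_meromorphic_eqI[OF _ _ X x0(1) _ x] by blast
  qed
  have small: "\<forall>\<^sub>F \<epsilon> in at_right 0. dilog_line M N (2 * \<epsilon> / s)"
  proof -
    \<comment> \<open>The line \<open>Im t = \<epsilon>\<close> corresponds to \<open>Im v = 2 \<epsilon> / s\<close>.\<close>
    have "filterlim (\<lambda>\<epsilon>. 2 / s * \<epsilon>) (at_right 0) (at_right 0)"
      using s0 by (intro filterlim_times_pos) (auto simp: filterlim_ident)
    from eventually_compose_filterlim[OF dilog_line_exists[OF MN] this] show ?thesis by simp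
  qed
  have \<Phi>_faddeev: "\<Phi> x = exp (faddeev_integral b \<epsilon> x)" if x: "x \<in> X" and d: "dilog_line M N (2 * \<epsilon> / s)" for x \<epsilon>
    unfolding \<Phi>_line[OF x d] dilog_line.log_phi_def[OF d] faddeev_integral_eq_kern[OF MN(1,2) b s] aff_def k_def ..
  have qd: "quantum_dilog b = \<Phi>"
    unfolding quantum_dilog_def
  proof (rule the_equality)
    show "\<Phi> nicely_meromorphic_on UNIV \<and> (\<forall>x. \<bar>Im x\<bar> < \<bar>Im (faddeev_c b)\<bar> \<longrightarrow>
        (\<forall>\<^sub>F \<epsilon> in at_right 0. \<Phi> x = exp (faddeev_integral b \<epsilon> x)))"
      using \<Phi> small \<Phi>_faddeev by (auto simp: X_def elim: eventually_mono)
  next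
    fix \<Theta> assume \<Theta>: "\<Theta> nicely_meromorphic_on UNIV \<and> (\<forall>x. \<bar>Im x\<bar> < \<bar>Im (faddeev_c b)\<bar> \<longrightarrow>
        (\<forall>\<^sub>F \<epsilon> in at_right 0. \<Theta> x = exp (faddeev_integral b \<epsilon> x)))"
    have eqX: "\<Theta> x = \<Phi> x" if x: "x \<in> X" for x
    proof -
      have "\<forall>\<^sub>F \<epsilon> in at_right 0. \<Theta> x = exp (faddeev_integral b \<epsilon> x)"
        using \<Theta> x by (auto simp: X_def)
      then have "\<forall>\<^sub>F \<epsilon> in at_right (0::real). \<Theta> x = \<Phi> x"
        using small by eventually_elim (simp add: \<Phi>_faddeev[OF x])
      then show ?thesis by simp
    qed
    show "\<Theta> = \<Phi>"
    proof
      fix x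
      have "\<forall>\<^sub>F x in at x0. \<Theta> x = \<Phi> x"
        using near_x0 by eventually_elim (use eqX in auto)
      then show "\<Theta> x = \<Phi> x"
        using nicely_meromorphic_eqI[OF _ \<Phi> open_UNIV connected_UNIV UNIV_I _ UNIV_I] \<Theta> by blast
    qed
  qed
  have \<Psi>_eq: "\<Psi> z = L.glued z" if "z \<notin> period_lattice" for z
    unfolding \<Psi>_def qd k_def[symmetric] using \<Phi>_off[of "z / k - faddeev_c b"] that by (simp add: aff_inv)
  have "\<Psi> holomorphic_on - period_lattice \<longleftrightarrow> L.glued holomorphic_on - period_lattice"
    by (rule holomorphic_cong) (auto simp: \<Psi>_eq)
  then show "\<Psi> analytic_on - period_lattice"
    using L.glued_analytic closed_period_lattice by (simp add: analytic_on_open open_Compl)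
  show "\<Psi> z = exp (principal_log M N z)" if "Re z < 0"
    using \<Psi>_eq[OF Re_lattice[OF that]] L.glued_eq_exp_principal_log[OF that] by simp
qed

section \<open>Continuation along arbitrary paths\<close>

lemma root_of_unity_power_N: "N > 0 \<Longrightarrow> (root_of_unity M N ^ k) ^ N = 1"
proof -
  assume "N > 0"
  then have "root_of_unity M N ^ N = exp (of_nat M * (2 * of_real pi * \<i>))"
    by (simp add: root_of_unity_power)
  also have "\<dots> = 1" by (simp only: exp_of_nat_mult exp_two_pi_i power_one)
  finally show ?thesis by (metis power_mult mult.commute power_one)
qed

text \<open>
  Since \<open>a\<^sup>n = 1\<close>, the argument \<open>1 - a exp (w/n)\<close> vanishes only where \<open>exp w = 1\<close>, so the logarithmic
  derivative is holomorphic off the period lattice.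
\<close>
lemma continuation_log_one_minus_exp:
  assumes \<gamma>: "path \<gamma>" "path_image \<gamma> \<subseteq> - period_lattice" "Re (\<gamma> 0) < 0"
    and n: "n > 0" and a: "a ^ n = 1"
  obtains F where "analytic_continuation_along \<gamma> (\<lambda>w. Ln (1 - a * exp (w / of_nat n))) F"
proof -
  define f where "f w = Ln (1 - a * exp (w / of_nat n))" for w
  define g where "g w = - (a * (exp (w / of_nat n) / of_nat n)) / (1 - a * exp (w / of_nat n))" for w
  have nz: "1 - a * exp (w / of_nat n) \<noteq> 0" if "w \<notin> period_lattice" for w
  proof
    assume "1 - a * exp (w / of_nat n) = 0"
    then have "(a * exp (w / of_nat n)) ^ n = 1" by simp
    then have "exp w = 1" using n a by (simp add: power_mult_distrib flip: exp_of_nat_mult)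
    then show False using that by (simp add: mem_period_lattice_iff)
  qed
  have g: "g holomorphic_on - period_lattice"
    unfolding g_def[abs_def] using n nz by (intro holomorphic_intros) auto
  have norm_a: "norm a = 1"
  proof (rule power_eq_imp_eq_base)
    show "norm a ^ n = 1 ^ n" using a by (simp flip: norm_power)
  qed (use n in auto)
  have f': "(f has_field_derivative g w) (at w)" if "Re w < 0" for w
  proof -
    have "1 - a * exp (w / of_nat n) \<notin> \<real>\<^sub>\<le>\<^sub>0"
      using norm_exp_divide_less_1[OF that n] norm_a
      by (intro one_minus_notin_nonpos_Reals) (simp add: norm_mult)
    then show ?thesis
      unfolding f_def[abs_def] g_def using n by (auto intro!: derivative_eq_intros simp: field_simps)
  qed
  have "f holomorphic_on {w. Re w < 0}"
    using f' open_halfspace_Re_lt[of 0] by (auto simp: holomorphic_on_open)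
  then have "f analytic_on {\<gamma> 0}"
    using open_halfspace_Re_lt[of 0] \<gamma>(3) by (auto simp: analytic_at)
  moreover have "\<forall>\<^sub>F w in nhds (\<gamma> 0). deriv (deriv f) w = deriv g w"
  proof (rule eventually_mono[OF eventually_nhds_in_open[OF open_halfspace_Re_lt[of 0]]])
    fix w assume w: "w \<in> {w. Re w < 0}"
    have "\<forall>\<^sub>F v in nhds w. deriv f v = g v"
      by (rule eventually_mono[OF eventually_nhds_in_open[OF open_halfspace_Re_lt w]])
         (auto intro: DERIV_imp_deriv f')
    then show "deriv (deriv f) w = deriv g w" by (rule deriv_cong_ev) simp
  qed (use \<gamma> in simp)
  moreover have "deriv g holomorphic_on - period_lattice"
    using g closed_period_lattice by (intro holomorphic_deriv) (auto simp: open_Compl)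
  ultimately show ?thesis
    using analytic_continuation_along_exists[OF \<gamma>(1,2) _ _] closed_period_lattice that
    unfolding f_def[abs_def] by (metis open_Compl)
qed

lemma continuation_Li2_exp:
  assumes \<gamma>: "path \<gamma>" "path_image \<gamma> \<subseteq> - period_lattice" "Re (\<gamma> 0) < 0"
  obtains F where "analytic_continuation_along \<gamma> (\<lambda>w. Li2 (exp w)) F"
proof -
  define f where "f w = Li2 (exp w)" for w
  define g where "g w = exp w / (1 - exp w)" for w :: complex
  have g: "g holomorphic_on - period_lattice"
    unfolding g_def[abs_def] by (intro holomorphic_intros) (auto simp: mem_period_lattice_iff)
  have f': "(f has_field_derivative - Ln (1 - exp w)) (at w)" if "Re w < 0" for w
    unfolding f_def[abs_def] by (rule has_field_derivative_Li2_exp[OF that])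
  have "f holomorphic_on {w. Re w < 0}"
    using f' open_halfspace_Re_lt[of 0] by (auto simp: holomorphic_on_open)
  then have "f analytic_on {\<gamma> 0}"
    using open_halfspace_Re_lt[of 0] \<gamma>(3) by (auto simp: analytic_at)
  moreover have "\<forall>\<^sub>F w in nhds (\<gamma> 0). deriv (deriv f) w = g w"
  proof (rule eventually_mono[OF eventually_nhds_in_open[OF open_halfspace_Re_lt[of 0]]])
    fix w assume w: "w \<in> {w. Re w < 0}"
    have "\<forall>\<^sub>F v in nhds w. deriv f v = - Ln (1 - exp v)"
      by (rule eventually_mono[OF eventually_nhds_in_open[OF open_halfspace_Re_lt w]])
         (auto intro: DERIV_imp_deriv f')
    then have "deriv (deriv f) w = deriv (\<lambda>v. - Ln (1 - exp v)) w" by (rule deriv_cong_ev) simp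
    also have "\<dots> = g w"
    proof (rule DERIV_imp_deriv)
      have "1 - exp w \<notin> \<real>\<^sub>\<le>\<^sub>0" using w by (intro one_minus_notin_nonpos_Reals) simp
      then show "((\<lambda>v. - Ln (1 - exp v)) has_field_derivative g w) (at w)"
        unfolding g_def by (auto intro!: derivative_eq_intros simp: field_simps)
    qed
    finally show "deriv (deriv f) w = g w" .
  qed (use \<gamma> in simp)
  ultimately show ?thesis
    using analytic_continuation_along_exists[OF \<gamma>(1,2) _ g] closed_period_lattice that
    unfolding f_def[abs_def] by (metis open_Compl)
qed

theorem theorem1p9:
  fixes M N :: nat and b s :: real and qp qm z :: complex and \<gamma> :: "real \<Rightarrow> complex"
  assumes "M > 0" and "N > 0" and "coprime M N"
    and "b = sqrt (real M / real N)"
    and "s = sqrt (real M * real N)"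
    and "qp = exp (2 * of_real pi * \<i> * of_nat M / of_nat N)"
    and "qm = exp (2 * of_real pi * \<i> * of_nat N / of_nat M)"
    and "path \<gamma>"
    and "path_image \<gamma> \<subseteq> - range (\<lambda>m::int. 2 * of_real pi * \<i> * of_int m)"
    and "Re (pathstart \<gamma>) < 0"
    and "pathfinish \<gamma> = z"
  shows "quantum_dilog b (z / (2 * of_real pi * of_real s) - faddeev_c b) =
           exp (\<i> / (2 * of_real pi * of_real s ^ 2) * continued_value \<gamma> (\<lambda>w. Li2 (exp w))) *
           continued_power \<gamma> (\<lambda>w. 1 - exp w) (1 + \<i> * z / (2 * of_real pi * of_real s ^ 2)) /
           (cyclic_dilog \<gamma> N (\<lambda>w. exp (w / of_nat N)) qp *
            cyclic_dilog \<gamma> M (\<lambda>w. exp (w / of_nat M)) qm)"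
proof -
  define \<Psi> where "\<Psi> = (\<lambda>z. quantum_dilog b (z / (2 * of_real pi * of_real s) - faddeev_c b))"
  have \<gamma>: "path \<gamma>" "path_image \<gamma> \<subseteq> - period_lattice" "Re (\<gamma> 0) < 0" "\<gamma> 1 = z"
    using assms(8-11) by (simp_all add: period_lattice_def pathstart_def pathfinish_def)
  have qp: "qp = root_of_unity M N" and qm: "qm = root_of_unity N M"
    using assms(6,7) by (simp_all add: root_of_unity_def)
  have s2: "of_real s ^ 2 = (of_nat M * of_nat N :: complex)"
    using assms(5) by (simp flip: of_real_power)
  define c where "c = \<i> / (2 * of_real pi * (of_nat M * of_nat N))"
  have c: "\<i> / (2 * of_real pi * of_real s ^ 2) = c" "\<i> * w / (2 * of_real pi * of_real s ^ 2) = c * w" for w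
    by (simp_all add: s2 c_def)
  obtain A where A: "analytic_continuation_along \<gamma> (\<lambda>w. Li2 (exp w)) A"
    using continuation_Li2_exp[OF \<gamma>(1-3)] .
  obtain B where B: "analytic_continuation_along \<gamma> (\<lambda>w. Ln (1 - exp w)) B"
    using continuation_log_one_minus_exp[OF \<gamma>(1-3), of 1 1] by auto
  have "\<exists>F. analytic_continuation_along \<gamma> (\<lambda>w. Ln (1 - qp ^ k * exp (w / of_nat N))) F" for k
    using continuation_log_one_minus_exp[OF \<gamma>(1-3) assms(2) root_of_unity_power_N[OF assms(2), of M k]]
    unfolding qp by metis
  then obtain C where C: "\<And>k. analytic_continuation_along \<gamma> (\<lambda>w. Ln (1 - qp ^ k * exp (w / of_nat N))) (C k)"
    by metis
  have "\<exists>F. analytic_continuation_along \<gamma> (\<lambda>w. Ln (1 - qm ^ k * exp (w / of_nat M))) F" for k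
    using continuation_log_one_minus_exp[OF \<gamma>(1-3) assms(1) root_of_unity_power_N[OF assms(1), of N k]]
    unfolding qm by metis
  then obtain D where D: "\<And>k. analytic_continuation_along \<gamma> (\<lambda>w. Ln (1 - qm ^ k * exp (w / of_nat M))) (D k)"
    by metis
  define E where "E t w = c * A t w + (1 + c * w) * B t w +
      (\<Sum>k = 1..<N. - (of_nat k / of_nat N) * C k t w) + (\<Sum>k = 1..<M. - (of_nat k / of_nat M) * D k t w)" for t w
  have const: "analytic_continuation_along \<gamma> (\<lambda>_. a) (\<lambda>_ _. a)" for a
    by (intro analytic_continuation_along_self analytic_on_const)
  have lin: "analytic_continuation_along \<gamma> (\<lambda>w. 1 + c * w) (\<lambda>_ w. 1 + c * w)"
    by (intro analytic_continuation_along_self analytic_intros)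
  have "analytic_continuation_along \<gamma> (\<lambda>w. c * Li2 (exp w) + (1 + c * w) * Ln (1 - exp w) +
      (\<Sum>k = 1..<N. - (of_nat k / of_nat N) * Ln (1 - qp ^ k * exp (w / of_nat N))) +
      (\<Sum>k = 1..<M. - (of_nat k / of_nat M) * Ln (1 - qm ^ k * exp (w / of_nat M)))) E"
    unfolding E_def[abs_def]
    by (intro analytic_continuation_along_add analytic_continuation_along_mult analytic_continuation_along_sum
        const lin A B C D)
  also have "(\<lambda>w. c * Li2 (exp w) + (1 + c * w) * Ln (1 - exp w) +
      (\<Sum>k = 1..<N. - (of_nat k / of_nat N) * Ln (1 - qp ^ k * exp (w / of_nat N))) +
      (\<Sum>k = 1..<M. - (of_nat k / of_nat M) * Ln (1 - qm ^ k * exp (w / of_nat M)))) = principal_log M N"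
    by (simp add: fun_eq_iff principal_log_def cyclic_log_def c_def qp qm sum_negf)
  finally have "analytic_continuation_along \<gamma> (\<lambda>w. exp (principal_log M N w)) (\<lambda>t w. exp (E t w))"
    by (rule analytic_continuation_along_exp)
  moreover have "\<forall>\<^sub>F w in nhds (\<gamma> 0). exp (principal_log M N w) = \<Psi> w"
    by (rule eventually_mono[OF eventually_nhds_in_open[OF open_halfspace_Re_lt[of 0]]])
       (use \<gamma> quantum_dilog_rational(2)[OF assms(1-5)] in \<open>auto simp: \<Psi>_def\<close>)
  ultimately have "analytic_continuation_along \<gamma> \<Psi> (\<lambda>t w. exp (E t w))"
    by (rule analytic_continuation_along_cong)
  moreover have "analytic_continuation_along \<gamma> \<Psi> (\<lambda>_. \<Psi>)"
    using quantum_dilog_rational(1)[OF assms(1-5)] \<gamma>(2) unfolding \<Psi>_def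
    by (intro analytic_continuation_along_self) (rule analytic_on_subset)
  ultimately have "\<forall>\<^sub>F w in nhds (\<gamma> 1). exp (E 1 w) = \<Psi> w"
    using analytic_continuation_along_unique[OF _ _ \<gamma>(1), of \<Psi> "\<lambda>t w. exp (E t w)" "\<lambda>_. \<Psi>" 1] by simp
  from eventually_nhds_x_imp_x[OF this] have "\<Psi> z = exp (E 1 z)"
    by (simp add: \<gamma>(4))
  also have "\<dots> = exp (c * A 1 z) * exp ((1 + c * z) * B 1 z) /
      ((\<Prod>k = 1..<N. exp (of_nat k / of_nat N * C k 1 z)) * (\<Prod>k = 1..<M. exp (of_nat k / of_nat M * D k 1 z)))"
  proof -
    have "E 1 z = c * A 1 z + (1 + c * z) * B 1 z -
        ((\<Sum>k = 1..<N. of_nat k / of_nat N * C k 1 z) + (\<Sum>k = 1..<M. of_nat k / of_nat M * D k 1 z))"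
      by (simp add: E_def sum_negf)
    then show ?thesis by (simp only: exp_diff exp_add exp_sum finite_atLeastLessThan)
  qed
  also have "exp (c * A 1 z) = exp (c * continued_value \<gamma> (\<lambda>w. Li2 (exp w)))"
    using continued_value_eq[OF A \<gamma>(1)] by (simp add: \<gamma>(4))
  also have "exp ((1 + c * z) * B 1 z) = continued_power \<gamma> (\<lambda>w. 1 - exp w) (1 + c * z)"
    using continued_value_eq[OF B \<gamma>(1)] by (simp add: \<gamma>(4) continued_power_def)
  also have "(\<Prod>k = 1..<N. exp (of_nat k / of_nat N * C k 1 z)) = cyclic_dilog \<gamma> N (\<lambda>w. exp (w / of_nat N)) qp"
    using continued_value_eq[OF C \<gamma>(1)] by (simp add: \<gamma>(4) cyclic_dilog_def continued_power_def)
  also have "(\<Prod>k = 1..<M. exp (of_nat k / of_nat M * D k 1 z)) = cyclic_dilog \<gamma> M (\<lambda>w. exp (w / of_nat M)) qm"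
    using continued_value_eq[OF D \<gamma>(1)] by (simp add: \<gamma>(4) cyclic_dilog_def continued_power_def)
  finally show ?thesis unfolding c \<Psi>_def .
qed

end
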